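(* Let $n\ge2$, let $E$, $K_n=E\times\overline{\mathbb D}^{\,n-1}$, $E_w$, $q(w)$, $\rho_*$, $\Phi$ be as in the context, and for $\tau>0$ put $\psi_\tau=\tau\Phi|_{K_n}$, $F_\delta=V_{\delta,K_n,\psi_\tau}^*$, and $D_\tau(2,w)=\lim_{h\downarrow0}\frac{F_{\tau+h}(2,w)-\psi_\tau(2,w)}{h}$. For every $w\in\overline{\mathbb D}^{\,n-1}$ and $\tau>0$, $$D_\tau(2,w)=V_{E_w}^*(2).$$ Consequently, $$D_\tau(2,w)=V_E^*(2)\iff q(w)\le\rho_*.$$ For the remaining points, $$\rho_*<q(w)\le1\implies V_E^*(2)<D_\tau(2,w)\le\log2,$$ and at the boundary of the polydisc, $$q(w)=1\implies D_\tau(2,w)=\log2.$$ In particular, $D_\tau(2,w)$ is independent of $\tau$.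
   Context: $\overline{\mathbb D}$ is the closed unit disk in $\mathbb C$, $\overline D(p,r)$ a closed disk, $\log^+t=\max\{\log t,0\}$, $\log^+0=0$. For $\delta>0$, $\mathcal L_\delta$ is the class of $u\in\mathrm{PSH}(\mathbb C^N)$ with $u\le\delta\log^+\|z\|+C_u$ on $\mathbb C^N$, and $\mathcal L_\delta^+$ the subclass with also $u\ge\delta\log^+\|z\|-C_u$. $f^*(z)=\limsup_{\zeta\to z}f(\zeta)$. $V_{\delta,K,\psi}(z)=\sup\{u(z):u\in\mathcal L_\delta,\ u\le\psi\text{ on }K\}$, $V_E=V_{1,E,0}$ (for planar sets, taken in $\mathbb C$). Planar compact: $p_j=2+2^{-j}$, $\rho_j=\exp(-16\cdot2^j)$, $E=\overline{\mathbb D}\cup\{2\}\cup\bigcup_{j\ge1}\overline D(p_j,\rho_j)\subset\mathbb C$. For $w\in\overline{\mathbb D}^{\,n-1}$: $q(w)=\max_{1\le j\le n-1}|w_j|$, $R_w=2/q(w)$ if $q(w)>0$ and $R_w=+\infty$ if $q(w)=0$, $E_w=E\cap\overline D(0,R_w)$ (with $E_w=E$ if $R_w=+\infty$). $\rho_*=\dfrac{2}{\max_{\zeta\in E}|\zeta|}=\dfrac4{5+2e^{-32}}$. Weight: $b>0$ is a constant and $\Phi\in C^\infty(\mathbb C^n)\cap\mathcal L_1^+$ is a radial function such that $\Phi$ is plurisubharmonic with $0\le\Phi\le b$ on the closed unit ball $\overline B(0,1)$; $\Phi(z)=\log\|z\|+b$ for $\|z\|\ge1$ and $\Phi(z)\ge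 b+\log\|z\|$ for $z\ne0$; and $dd^c\Phi$ has rank $n-1$ on $\{\|z\|>1\}$. (For this weight $F_\tau=\tau\Phi$ on $\mathbb C^n$.) *)

theory Defs
  imports "HOL-Analysis.Analysis"
begin

text \<open>
  Complex \<open>N\<close>-space is \<^typ>\<open>complex^'n\<close> with \<open>N = CARD('n)\<close>; its norm is the Euclidean one and
  \<open>(*s)\<close> is complex scalar multiplication. The splitting of \<open>n\<close>-space into the line times
  \<open>(n-1)\<close>-space, \<open>n \<ge> 2\<close>, is rendered by \<^typ>\<open>complex^('m option)\<close> with \<open>n - 1 = CARD('m)\<close>: the
  coordinate \<^term>\<open>None\<close> is the first one, the coordinates \<^term>\<open>Some j\<close> are the other ones. The complex
  plane, as the one-dimensional complex space, is \<^typ>\<open>complex^1\<close>.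
\<close>

section \<open>Plurisubharmonic functions\<close>

definition usc :: "('a::topological_space \<Rightarrow> ereal) \<Rightarrow> bool" where
  "usc u \<longleftrightarrow> (\<forall>a. open {z. u z < a})"

text \<open>The point itself belongs to the neighbourhoods over which the limes superior is taken.\<close>

definition usc_reg :: "('a::topological_space \<Rightarrow> ereal) \<Rightarrow> 'a \<Rightarrow> ereal" where
  "usc_reg f z = Limsup (nhds z) f"

text \<open>
  The mean over \<open>[0, 2\<pi>]\<close> as positive part minus negative part (\<^const>\<open>e2ennreal\<close> sends negative
  arguments to 0), with value \<open>-\<infinity>\<close> allowed. It is only applied to upper semicontinuous functions
  without the value \<open>\<infinity>\<close>, for which the first term is finite.
\<close>

definition circle_mean :: "(real \<Rightarrow> ereal) \<Rightarrow> ereal" where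
  "circle_mean f =
     (enn2ereal (\<integral>\<^sup>+\<theta>\<in>{0..2*pi}. e2ennreal (f \<theta>) \<partial>lborel)
      - enn2ereal (\<integral>\<^sup>+\<theta>\<in>{0..2*pi}. e2ennreal (- f \<theta>) \<partial>lborel)) / ereal (2 * pi)"

text \<open>Subharmonic on the whole plane; the function \<open>-\<infinity>\<close> is allowed here.\<close>

definition subharmonic :: "(complex \<Rightarrow> ereal) \<Rightarrow> bool" where
  "subharmonic u \<longleftrightarrow> usc u \<and> (\<forall>z. u z < \<infinity>) \<and>
     (\<forall>a r. r > 0 \<longrightarrow> u a \<le> circle_mean (\<lambda>\<theta>. u (a + complex_of_real r * cis \<theta>)))"

definition psh :: "(complex^'n \<Rightarrow> ereal) \<Rightarrow> bool" where
  "psh u \<longleftrightarrow> usc u \<and> (\<forall>z. u z < \<infinity>) \<and> (\<exists>z. u z \<noteq> -\<infinity>) \<and>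
     (\<forall>a c. subharmonic (\<lambda>t. u (a + t *s c)))"

section \<open>Lelong classes and extremal functions\<close>

definition log_plus :: "real \<Rightarrow> real" where
  "log_plus t = (if t = 0 then 0 else max (ln t) 0)"

definition lelong :: "real \<Rightarrow> (complex^'n \<Rightarrow> ereal) set" where
  "lelong \<delta> = {u. psh u \<and> (\<exists>C. \<forall>z. u z \<le> ereal (\<delta> * log_plus (norm z) + C))}"

definition lelong_plus :: "real \<Rightarrow> (complex^'n \<Rightarrow> ereal) set" where
  "lelong_plus \<delta> = {u \<in> lelong \<delta>. \<exists>C. \<forall>z. u z \<ge> ereal (\<delta> * log_plus (norm z) - C)}"

definition extremal :: "real \<Rightarrow> (complex^'n) set \<Rightarrow> (complex^'n \<Rightarrow> real) \<Rightarrow> complex^'n \<Rightarrow> ereal" where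
  "extremal \<delta> K \<psi> z = (SUP u \<in> {u \<in> lelong \<delta>. \<forall>x\<in>K. u x \<le> ereal (\<psi> x)}. u z)"

definition planar_extremal_reg :: "complex set \<Rightarrow> complex \<Rightarrow> ereal" where
  "planar_extremal_reg S \<zeta> = usc_reg (extremal 1 {z :: complex^1. z $ 1 \<in> S} (\<lambda>_. 0)) (\<chi> _. \<zeta>)"

section \<open>The compact sets\<close>

definition p_seq :: "nat \<Rightarrow> real" where
  "p_seq j = 2 + 1 / 2 ^ j"

definition rho_seq :: "nat \<Rightarrow> real" where
  "rho_seq j = exp (- 16 * 2 ^ j)"

definition E_set :: "complex set" where
  "E_set = cball 0 1 \<union> {2} \<union> (\<Union>j\<in>{1..}. cball (complex_of_real (p_seq j)) (rho_seq j))"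

definition polydisc :: "(complex^'m) set" where
  "polydisc = {w. \<forall>j. w $ j \<in> cball 0 1}"

definition K_set :: "(complex^('m::finite option)) set" where
  "K_set = {z. z $ None \<in> E_set \<and> (\<chi> j. z $ Some j) \<in> polydisc}"

definition pt :: "complex \<Rightarrow> complex^'m \<Rightarrow> complex^('m::finite option)" where
  "pt \<zeta> w = (\<chi> i. case i of None \<Rightarrow> \<zeta> | Some j \<Rightarrow> w $ j)"

definition q_max :: "complex^'m \<Rightarrow> real" where
  "q_max w = Max (range (\<lambda>j. cmod (w $ j)))"

definition E_sub :: "complex^'m \<Rightarrow> complex set" where
  "E_sub w = (if q_max w > 0 then E_set \<inter> cball 0 (2 / q_max w) else E_set)"

text \<open>The supremum is a maximum, see \<open>rho_star_eq\<close> below.\<close>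

definition rho_star :: real where
  "rho_star = 2 / (SUP \<zeta>\<in>E_set. cmod \<zeta>)"

lemma E_set_cmod_le:
  assumes "\<zeta> \<in> E_set"
  shows "cmod \<zeta> \<le> 5/2 + exp (-32)"
proof -
  have *: "cmod \<zeta> \<le> 5/2 + exp (-32)"
    if j: "j \<ge> 1" and z: "\<zeta> \<in> cball (complex_of_real (p_seq j)) (rho_seq j)" for j
  proof -
    have pw: "(2::real) \<le> 2 ^ j"
      using j by (metis one_le_numeral power_increasing power_one_right)
    have "p_seq j \<le> 5/2"
      using pw by (simp add: p_seq_def field_simps)
    moreover have "p_seq j \<ge> 0"
      by (simp add: p_seq_def)
    moreover have "rho_seq j \<le> exp (-32)"
      using pw by (simp add: rho_seq_def)
    moreover have "cmod (\<zeta> - complex_of_real (p_seq j)) \<le> rho_seq j"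
      using z by (simp add: dist_norm norm_minus_commute)
    moreover have "cmod \<zeta> \<le> cmod (\<zeta> - complex_of_real (p_seq j)) + cmod (complex_of_real (p_seq j))"
      using norm_triangle_ineq[of "\<zeta> - complex_of_real (p_seq j)" "complex_of_real (p_seq j)"] by simp
    ultimately show ?thesis
      by simp
  qed
  have pos: "(0::real) < exp (-32)"
    by simp
  consider "cmod \<zeta> \<le> 1" | "\<zeta> = 2"
    | j where "j \<ge> 1" "\<zeta> \<in> cball (complex_of_real (p_seq j)) (rho_seq j)"
    using assms unfolding E_set_def by auto
  then show ?thesis
  proof cases
    case 1
    then show ?thesis
      using pos by linarith
  next
    case 2
    then have "cmod \<zeta> = 2"
      by simp
    then show ?thesis
      using pos by linarith
  next
    case 3
    then show ?thesis
      by (rule *)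
  qed
qed

lemma E_set_cmod_attained:
  "complex_of_real (5/2 + exp (-32)) \<in> E_set"
proof -
  have "dist (complex_of_real (p_seq 1)) (complex_of_real (5/2 + exp (-32))) = dist (p_seq 1) (5/2 + exp (-32))"
    unfolding dist_of_real ..
  also have "\<dots> = rho_seq 1"
    by (simp add: p_seq_def rho_seq_def dist_real_def)
  finally have "complex_of_real (5/2 + exp (-32)) \<in> cball (complex_of_real (p_seq 1)) (rho_seq 1)"
    unfolding mem_cball by simp
  then show ?thesis
    unfolding E_set_def by blast
qed

lemma rho_star_eq: "rho_star = 4 / (5 + 2 * exp (-32))"
proof -
  have "(SUP \<zeta>\<in>E_set. cmod \<zeta>) = 5/2 + exp (-32)"
  proof (rule cSup_eq_maximum)
    have "cmod (complex_of_real (5/2 + exp (-32))) = 5/2 + exp (-32)"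
      unfolding norm_of_real by (simp add: add_nonneg_nonneg)
    then show "5/2 + exp (-32) \<in> cmod ` E_set"
      using E_set_cmod_attained by (metis imageI)
  qed (use E_set_cmod_le in auto)
  moreover have "2 / (5/2 + x) = 4 / (5 + 2 * x)" if "x > 0" for x :: real
    using that by (simp add: field_simps)
  ultimately show ?thesis
    by (simp add: rho_star_def)
qed

section \<open>The weight\<close>

primrec Ck :: "nat \<Rightarrow> ('a::real_normed_vector \<Rightarrow> 'b::real_normed_vector) \<Rightarrow> bool" where
  "Ck 0 = (\<lambda>f. continuous_on UNIV f)"
| "Ck (Suc k) = (\<lambda>f. (\<forall>x. f differentiable at x) \<and> (\<forall>v. Ck k (\<lambda>x. frechet_derivative f (at x) v)))"

definition Cinfinity :: "('a::real_normed_vector \<Rightarrow> 'b::real_normed_vector) \<Rightarrow> bool" where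
  "Cinfinity f \<longleftrightarrow> (\<forall>k. Ck k f)"

text \<open>
  The Wirtinger derivatives, from the real directional derivatives along the real and imaginary
  \<open>j\<close>-th coordinate directions. The rank of \<open>dd\<^sup>cf\<close> as a \<open>(1,1)\<close>-form, whatever the normalisation
  of \<open>d\<^sup>c\<close>, is the rank of the complex Hessian matrix.
\<close>

definition wirt :: "'n \<Rightarrow> (complex^'n \<Rightarrow> complex) \<Rightarrow> complex^'n \<Rightarrow> complex" where
  "wirt j f z = (frechet_derivative f (at z) (axis j 1) - \<i> * frechet_derivative f (at z) (axis j \<i>)) / 2"

definition wirt_bar :: "'n \<Rightarrow> (complex^'n \<Rightarrow> complex) \<Rightarrow> complex^'n \<Rightarrow> complex" where
  "wirt_bar j f z = (frechet_derivative f (at z) (axis j 1) + \<i> * frechet_derivative f (at z) (axis j \<i>)) / 2"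

definition complex_hessian :: "(complex^'n \<Rightarrow> real) \<Rightarrow> complex^'n \<Rightarrow> complex^'n^'n" where
  "complex_hessian f z = (\<chi> j k. wirt j (wirt_bar k (\<lambda>x. complex_of_real (f x))) z)"

definition ddc_rank :: "(complex^'n \<Rightarrow> real) \<Rightarrow> complex^'n \<Rightarrow> nat" where
  "ddc_rank f z = rank (complex_hessian f z)"

definition radial :: "('a::real_normed_vector \<Rightarrow> 'b) \<Rightarrow> bool" where
  "radial f \<longleftrightarrow> (\<forall>x y. norm x = norm y \<longrightarrow> f x = f y)"

text \<open>Plurisubharmonicity is part of the membership in the class \<^const>\<open>lelong_plus\<close>.\<close>

definition admissible_weight :: "real \<Rightarrow> (complex^'n \<Rightarrow> real) \<Rightarrow> bool" where
  "admissible_weight b \<Phi> \<longleftrightarrow>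
     b > 0 \<and> Cinfinity \<Phi> \<and> (\<lambda>z. ereal (\<Phi> z)) \<in> lelong_plus 1 \<and> radial \<Phi> \<and>
     (\<forall>z\<in>cball 0 1. 0 \<le> \<Phi> z \<and> \<Phi> z \<le> b) \<and>
     (\<forall>z. norm z \<ge> 1 \<longrightarrow> \<Phi> z = ln (norm z) + b) \<and>
     (\<forall>z. z \<noteq> 0 \<longrightarrow> \<Phi> z \<ge> b + ln (norm z)) \<and>
     (\<forall>z. norm z > 1 \<longrightarrow> ddc_rank \<Phi> z = CARD('n) - 1)"

section \<open>The derivative in the growth parameter\<close>

text \<open>Only the values of \<open>psi \<Phi> \<tau>\<close> on \<^const>\<open>K_set\<close> enter \<open>F_ext\<close> and \<open>diff_quot\<close>.\<close>

definition psi :: "(complex^('m::finite option) \<Rightarrow> real) \<Rightarrow> real \<Rightarrow> complex^('m option) \<Rightarrow> real" where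
  "psi \<Phi> \<tau> z = \<tau> * \<Phi> z"

definition F_ext ::
  "(complex^('m::finite option) \<Rightarrow> real) \<Rightarrow> real \<Rightarrow> real \<Rightarrow> complex^('m option) \<Rightarrow> ereal" where
  "F_ext \<Phi> \<tau> \<delta> = usc_reg (extremal \<delta> K_set (psi \<Phi> \<tau>))"

definition diff_quot ::
  "(complex^('m::finite option) \<Rightarrow> real) \<Rightarrow> real \<Rightarrow> complex^'m \<Rightarrow> real \<Rightarrow> ereal" where
  "diff_quot \<Phi> \<tau> w h = (F_ext \<Phi> \<tau> (\<tau> + h) (pt 2 w) - ereal (psi \<Phi> \<tau> (pt 2 w))) / ereal h"

text \<open>\<^const>\<open>Lim\<close> is meaningful only if the limit exists, which has to be claimed separately.\<close>

definition D_deriv :: "(complex^('m::finite option) \<Rightarrow> real) \<Rightarrow> real \<Rightarrow> complex^'m \<Rightarrow> ereal" where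
  "D_deriv \<Phi> \<tau> w = Lim (at_right 0) (diff_quot \<Phi> \<tau> w)"

end

theory Submission
  imports Defs "HOL-Complex_Analysis.Complex_Analysis"
begin

text \<open>
  Everything rests on two properties of the weight. On each complex line through the origin,
  \<open>\<Phi>\<close> is \<open>log |\<zeta>|\<close> plus a constant outside the unit ball, hence harmonic there; and
  \<open>\<Phi> \<ge> log \<parallel>z\<parallel> + b\<close> everywhere, so that \<open>\<tau> (log |l(z)| + const)\<close>, with \<open>l\<close> the coordinate along a fixed
  line, touches \<open>\<tau> \<Phi>\<close> only on that line.

  \<^bold>\<open>Upper bound.\<close> Let \<open>u\<close> compete for \<open>F\<^bsub>\<tau>+h\<^esub>\<close> and restrict it to the line \<open>\<zeta> \<mapsto> \<zeta> z / z\<^sub>1\<close>. Outside the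
  unit disc \<open>(u - \<tau> \<Phi>) / h\<close> is subharmonic with growth \<open>log |\<zeta>|\<close>, and it is \<open>\<le> 0\<close> where the line meets the
  compact set. Its positive part, extended by 0 to the unit disc, is a planar competitor for the truncation
  of \<open>E\<close> at the radius where the line leaves the polydisc (\<open>extremal_le_on_lines\<close>).

  \<^bold>\<open>Lower bound.\<close> Conversely, from a planar competitor \<open>s\<close> for the truncated set one forms
  \<open>\<tau> (log |l(z)| + const) + h s(l(z))\<close> along the line through \<open>(2, w)\<close>. Near the line the constraint is that
  on \<open>s\<close>; away from it there is a fixed gap below \<open>\<tau> \<Phi>\<close>, by compactness, which absorbs \<open>h s(l(z))\<close> once
  \<open>h\<close> is small (\<open>transversal_gap\<close>, \<open>F_ext_ge\<close>). The truncation \<open>E\<^sub>w\<close> is exactly the part of \<open>E\<close> that the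
  line sees, which is why \<open>E\<^sub>w\<close> and not \<open>E\<close> enters.

  \<^bold>\<open>The point 2.\<close> The value at 2 is positive only after regularization, so the infinitely many discs near 2
  have to be discarded uniformly. A sum of logarithms with poles at their centres and small total
  mass is hugely negative on all of them, yet its mean over small circles around 2 is nearly 0, because
  the radii \<open>exp (-16 \<cdot> 2\<^sup>j)\<close> are so small (\<open>penalty_exists\<close>). Adding it, as a function of the first coordinate,
  shows that the regularized value at 2 is the limit of the values at 2 for finitely many discs
  (\<open>reg_extremal_2_le\<close>, \<open>reg_extremal_2_ge\<close>), both in the plane and in the lower bound above. For finitely many
  discs the value at 2 is stable when the truncation radius and the point move a little
  (\<open>trunc_stability\<close>); this turns the unregularized upper bound into one for the regularized function.

  \<^bold>\<open>Strictness.\<close> If \<open>q(w) > \<rho>\<^sub>*\<close>, the truncation cuts off the right end of the largest disc. There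
  \<open>log (|z| / R)\<close> exceeds all competitors for \<open>E\<close>; gluing with multiples of functions that are subharmonic
  off one pole carries this gain first to 3 and then to 2 (\<open>trunc_strict\<close>).

  Gluing produces functions that are subharmonic by construction only on small circles. That this implies the mean
  inequality on all circles is \<open>subharmonic_iff_local\<close>; its proof approximates the boundary values from
  above by harmonic polynomials and applies the maximum principle.
\<close>

section \<open>Upper semicontinuity\<close>

definition usc_at :: "('a::topological_space \<Rightarrow> ereal) \<Rightarrow> 'a \<Rightarrow> bool" where
  "usc_at f z \<longleftrightarrow> (\<forall>c. f z < c \<longrightarrow> (\<forall>\<^sub>F w in nhds z. f w < c))"

lemma usc_iff_usc_at: "usc f \<longleftrightarrow> (\<forall>z. usc_at f z)"
proof
  assume u: "usc f"
  show "\<forall>z. usc_at f z"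
    unfolding usc_at_def eventually_nhds
  proof (intro allI impI)
    fix z c assume "f z < c"
    then show "\<exists>S. open S \<and> z \<in> S \<and> (\<forall>w\<in>S. f w < c)"
      using u unfolding usc_def by (intro exI[of _ "{w. f w < c}"]) auto
  qed
next
  assume u: "\<forall>z. usc_at f z"
  show "usc f"
    unfolding usc_def
  proof (intro allI, subst open_subopen, intro ballI)
    fix c z assume "z \<in> {z. f z < c}"
    then obtain S where "open S" "z \<in> S" "\<forall>w\<in>S. f w < c"
      using u unfolding usc_at_def eventually_nhds by blast
    then show "\<exists>T. open T \<and> z \<in> T \<and> T \<subseteq> {z. f z < c}"
      by blast
  qed
qed

lemma usc_at_real:
  fixes f :: "'a::t2_space \<Rightarrow> real"
  assumes "isCont f z"
  shows "usc_at (\<lambda>w. ereal (f w)) z"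
proof -
  have "((\<lambda>w. ereal (f w)) \<longlongrightarrow> ereal (f z)) (at z)"
    using assms by (auto simp: isCont_def)
  then have "((\<lambda>w. ereal (f w)) \<longlongrightarrow> ereal (f z)) (nhds z)"
    unfolding tendsto_nhds_iff by simp
  then show ?thesis
    unfolding usc_at_def by (blast dest: order_tendstoD(2))
qed

lemma ereal_add_less_split:
  fixes x y c :: ereal
  assumes "x + y < c" "x < \<infinity>" "y < \<infinity>"
  obtains a b :: real where "x < a" "y < b" "ereal (a + b) \<le> c"
proof (cases x)
  case (real x')
  show thesis
  proof (cases y)
    case (real y')
    obtain c' :: real where c': "x + y < ereal c'" "ereal c' \<le> c"
      using assms(1) by (metis ereal_dense2 order_less_imp_le)
    show thesis
      by (rule that[of "x' + (c' - x' - y') / 2" "y' + (c' - x' - y') / 2"])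
        (use c' real \<open>x = ereal x'\<close> in \<open>auto simp: field_simps\<close>)
  next
    case MInf
    then obtain c' :: real where c': "ereal c' \<le> c"
      using assms(1) by (metis ereal_dense2 order_less_imp_le)
    show thesis
      by (rule that[of "x' + 1" "c' - x' - 1"]) (use c' MInf real in auto)
  qed (use assms in auto)
next
  case MInf
  then obtain c' :: real where c': "ereal c' \<le> c"
    using assms(1) by (metis ereal_dense2 order_less_imp_le)
  obtain b :: real where "y < b"
    using assms(3) ereal_dense2 by blast
  show thesis
    by (rule that[of "c' - b" b]) (use c' MInf \<open>y < b\<close> in auto)
qed (use assms in auto)

lemma usc_at_add:
  assumes "usc_at f z" "usc_at g z" "f z < \<infinity>" "g z < \<infinity>"
  shows "usc_at (\<lambda>w. f w + g w) z"
  unfolding usc_at_def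
proof (intro allI impI)
  fix c assume "f z + g z < c"
  then obtain a b :: real where ab: "f z < a" "g z < b" "ereal (a + b) \<le> c"
    using ereal_add_less_split assms(3,4) by metis
  then have "\<forall>\<^sub>F w in nhds z. f w < a \<and> g w < b"
    using assms(1,2) by (auto simp: usc_at_def eventually_conj_iff)
  then show "\<forall>\<^sub>F w in nhds z. f w + g w < c"
  proof eventually_elim
    case (elim w)
    then have "f w + g w < ereal a + ereal b"
      by (cases "f w"; cases "g w") auto
    then show ?case using ab by auto
  qed
qed

lemma ereal_cmult_less_iff:
  assumes "c > 0"
  shows "ereal c * x < y \<longleftrightarrow> x < ereal (1 / c) * y"
  using assms by (cases x; cases y) (auto simp: field_simps)

lemma usc_at_cmult:
  assumes "usc_at f z" "c > 0"
  shows "usc_at (\<lambda>w. ereal c * f w) z"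
  using assms(1) unfolding usc_at_def ereal_cmult_less_iff[OF assms(2)] by blast

lemma usc_at_max:
  assumes "usc_at f z" "usc_at g z"
  shows "usc_at (\<lambda>w. max (f w) (g w)) z"
  using assms by (auto simp: usc_at_def eventually_conj_iff)

lemma usc_at_compose:
  assumes "usc_at u (g x)" "isCont g x"
  shows "usc_at (\<lambda>y. u (g y)) x"
proof -
  have "(g \<longlongrightarrow> g x) (nhds x)"
    using assms(2) by (simp add: isCont_def tendsto_at_iff_tendsto_nhds)
  then show ?thesis
    using assms(1) eventually_compose_filterlim[of _ "nhds (g x)" g "nhds x"]
    unfolding usc_at_def by auto
qed

lemma usc_at_cong:
  assumes "\<forall>\<^sub>F w in nhds z. f w = g w"
  shows "usc_at f z \<longleftrightarrow> usc_at g z"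
proof -
  have "f z = g z" using assms eventually_nhds_x_imp_x by fastforce
  moreover have "(\<forall>\<^sub>F w in nhds z. f w < c) \<longleftrightarrow> (\<forall>\<^sub>F w in nhds z. g w < c)" for c
    by (rule eventually_cong[OF assms]) auto
  ultimately show ?thesis unfolding usc_at_def by simp
qed

lemma usc_at_attains_max:
  assumes "compact S" "S \<noteq> {}" "\<And>z. z \<in> S \<Longrightarrow> usc_at f z"
  obtains x where "x \<in> S" "\<And>y. y \<in> S \<Longrightarrow> f y \<le> f x"
proof (rule ccontr)
  note attained = that
  assume "\<not> thesis"
  then have *: "\<exists>y\<in>S. f x < f y" if "x \<in> S" for x
    using attained[OF that] not_le by blast
  then obtain h where h: "\<And>x. x \<in> S \<Longrightarrow> h x \<in> S \<and> f x < f (h x)"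
    by metis
  have "\<forall>x\<in>S. \<exists>U. open U \<and> x \<in> U \<and> (\<forall>w\<in>U. f w < f (h x))"
    using assms(3) h unfolding usc_at_def eventually_nhds by blast
  then obtain U where U: "\<And>x. x \<in> S \<Longrightarrow> open (U x) \<and> x \<in> U x \<and> (\<forall>w\<in>U x. f w < f (h x))"
    by metis
  obtain T where T: "T \<subseteq> S" "finite T" "S \<subseteq> (\<Union>x\<in>T. U x)"
    using compactE_image[OF assms(1), of S U] U by (metis UN_I subsetI)
  then have "T \<noteq> {}" using assms(2) by auto
  have "Max ((\<lambda>s. f (h s)) ` T) \<in> (\<lambda>s. f (h s)) ` T"
    using T(2) \<open>T \<noteq> {}\<close> by (intro Max_in) auto
  then obtain t where t: "t \<in> T" "Max ((\<lambda>s. f (h s)) ` T) = f (h t)" by auto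
  have t2: "f (h s) \<le> f (h t)" if "s \<in> T" for s
    using that T(2) unfolding t(2)[symmetric] by (intro Max_ge) auto
  have "h t \<in> S" using h t T by blast
  then obtain s where "s \<in> T" "h t \<in> U s" using T(3) by blast
  then show False using U[of s] T(1) t2[of s] by fastforce
qed

lemma usc_bounded_above:
  assumes "compact S" "\<And>z. z \<in> S \<Longrightarrow> usc_at f z" "\<And>z. z \<in> S \<Longrightarrow> f z < \<infinity>"
  obtains M :: real where "M \<ge> 0" "\<And>z. z \<in> S \<Longrightarrow> f z \<le> ereal M"
proof (cases "S = {}")
  case False
  then obtain x where x: "x \<in> S" "\<And>y. y \<in> S \<Longrightarrow> f y \<le> f x"
    using usc_at_attains_max[OF assms(1) False assms(2)] by blast
  then obtain M :: real where "f x < M"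
    using assms(3) ereal_dense2 by blast
  then have "f x \<le> ereal (max M 0)"
    by (metis ereal_less_eq(3) max.cobounded1 order.strict_implies_order order_trans)
  then show thesis
    using x(2) by (intro that[of "max M 0"]) (auto intro: order_trans)
qed (use that[of 0] in auto)

lemma usc_borel_measurable:
  fixes f :: "real \<Rightarrow> ereal"
  assumes "\<And>t. usc_at f t"
  shows "f \<in> borel_measurable borel"
proof -
  have "usc f" using assms by (simp add: usc_iff_usc_at)
  then show ?thesis
    by (intro borel_measurableI_less) (auto simp: usc_def)
qed

section \<open>Means over circles\<close>

lemma circle_mean_mono:
  assumes "\<And>t. f t \<le> g t"
  shows "circle_mean f \<le> circle_mean g"
  unfolding circle_mean_def
  by (intro ereal_divide_right_mono ereal_minus_mono)
    (auto intro!: nn_integral_mono mult_right_mono e2ennreal_mono simp: less_eq_ennreal.rep_eq[symmetric] assms)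

text \<open>
  For integrands bounded above by \<open>M\<close> the mean is \<open>M\<close> minus the mean of the nonnegative function \<open>M - f\<close>.
  In this form the algebra of means reduces to that of nonnegative integrals, with the value \<open>-\<infinity>\<close> included.
\<close>

lemma circle_mean_bounded_above:
  assumes meas: "f \<in> borel_measurable borel" and le: "\<And>t. f t \<le> ereal M" and "M \<ge> 0"
  shows "circle_mean f = ereal M - enn2ereal (\<integral>\<^sup>+\<theta>\<in>{0..2*pi}. e2ennreal (ereal M - f \<theta>) \<partial>lborel) / ereal (2 * pi)"
proof -
  define P where "P = (\<integral>\<^sup>+\<theta>\<in>{0..2*pi}. e2ennreal (f \<theta>) \<partial>lborel)"
  define N where "N = (\<integral>\<^sup>+\<theta>\<in>{0..2*pi}. e2ennreal (- f \<theta>) \<partial>lborel)"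
  define I where "I = (\<integral>\<^sup>+\<theta>\<in>{0..2*pi}. e2ennreal (ereal M - f \<theta>) \<partial>lborel)"
  have pw: "e2ennreal (ereal M - x) + e2ennreal x = ennreal M + e2ennreal (- x)" if "x \<le> ereal M" for x
  proof (cases x)
    case (real r)
    show ?thesis
    proof (cases "r \<ge> 0")
      case True
      then show ?thesis
        using real that \<open>M \<ge> 0\<close> by (simp add: ennreal_neg flip: ennreal_plus)
    next
      case False
      then have "ennreal (M - r) = ennreal M + ennreal (- r)"
        using \<open>M \<ge> 0\<close> by (simp flip: ennreal_plus)
      then show ?thesis
        using False real by (simp add: ennreal_neg)
    qed
  qed (use that in \<open>auto simp: e2ennreal_neg\<close>)
  have c: "(\<integral>\<^sup>+\<theta>\<in>{0..2*pi}. ennreal M \<partial>lborel) = ennreal (2 * pi * M)"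
    using \<open>M \<ge> 0\<close> by (subst nn_integral_cmult_indicator) (auto simp flip: ennreal_mult simp: mult.commute)
  have meas': "e2ennreal \<circ> f \<in> borel_measurable lborel" "(\<lambda>t. e2ennreal (f t)) \<in> borel_measurable lborel"
    "(\<lambda>t. e2ennreal (- f t)) \<in> borel_measurable lborel" "(\<lambda>t. e2ennreal (ereal M - f t)) \<in> borel_measurable lborel"
    using meas by (auto simp: comp_def)
  have "I + P = (\<integral>\<^sup>+\<theta>. e2ennreal (ereal M - f \<theta>) * indicator {0..2*pi} \<theta> + e2ennreal (f \<theta>) * indicator {0..2*pi} \<theta> \<partial>lborel)"
    unfolding I_def P_def by (rule nn_integral_add[symmetric]) (use meas' in auto)
  also have "\<dots> = (\<integral>\<^sup>+\<theta>. ennreal M * indicator {0..2*pi} \<theta> + e2ennreal (- f \<theta>) * indicator {0..2*pi} \<theta> \<partial>lborel)"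
    by (intro nn_integral_cong) (use pw[OF le] in \<open>auto simp: indicator_def\<close>)
  also have "\<dots> = ennreal (2 * pi * M) + N"
    unfolding N_def c[symmetric] by (rule nn_integral_add) (use meas' in auto)
  finally have eq: "I + P = ennreal (2 * pi * M) + N" .
  have "P \<le> (\<integral>\<^sup>+\<theta>\<in>{0..2*pi}. ennreal M \<partial>lborel)"
    unfolding P_def using le e2ennreal_mono[OF le]
    by (intro nn_integral_mono mult_right_mono) auto
  then have "P < top" unfolding c using le_less_trans by fastforce
  then obtain p where p: "p \<ge> 0" "P = ennreal p" by (cases P) auto
  have "(enn2ereal P - enn2ereal N) / ereal (2 * pi) = ereal M - enn2ereal I / ereal (2 * pi)"
  proof (cases N)
    case (real n)
    then have "I < top" using eq p
      by (metis ennreal_add_eq_top ennreal_less_top less_top)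
    then obtain i where i: "i \<ge> 0" "I = ennreal i" by (cases I) auto
    have "ennreal (i + p) = ennreal (2 * pi * M + n)"
      using eq p i real \<open>M \<ge> 0\<close> by (simp add: ennreal_plus)
    then have "i + p = 2 * pi * M + n"
      using p i real \<open>M \<ge> 0\<close> by (subst (asm) ennreal_inj) auto
    then show ?thesis
      using p i real by (simp add: field_simps)
  next
    case top
    then have "I = top" using eq p by (metis ennreal_add_eq_top ennreal_neq_top)
    then show ?thesis using p top by (simp add: pi_gt_zero)
  qed
  then show ?thesis
    unfolding circle_mean_def P_def N_def I_def .
qed

lemma circle_mean_const: "circle_mean (\<lambda>_. ereal c) = ereal c"
proof -
  define M where "M = max c 0"
  have M: "c \<le> M" "0 \<le> M" by (auto simp: M_def)
  have "(\<integral>\<^sup>+\<theta>\<in>{0..2*pi}. e2ennreal (ereal M - ereal c) \<partial>lborel) = ennreal (M - c) * ennreal (2 * pi)"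
    by (subst nn_integral_cmult_indicator) auto
  also have "\<dots> = ennreal ((M - c) * (2 * pi))"
    by (rule ennreal_mult[symmetric]) (use M in auto)
  finally have I: "(\<integral>\<^sup>+\<theta>\<in>{0..2*pi}. e2ennreal (ereal M - ereal c) \<partial>lborel) = ennreal ((M - c) * (2 * pi))" .
  have "circle_mean (\<lambda>_. ereal c) = ereal M - enn2ereal (ennreal ((M - c) * (2 * pi))) / ereal (2 * pi)"
    unfolding I[symmetric] by (rule circle_mean_bounded_above) (use M in auto)
  then show ?thesis using M by simp
qed

lemma circle_mean_add:
  assumes f: "f \<in> borel_measurable borel" "\<And>t. f t \<le> ereal M"
    and g: "g \<in> borel_measurable borel" "\<And>t. g t \<le> ereal N"
  shows "circle_mean (\<lambda>t. f t + g t) = circle_mean f + circle_mean g"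
proof -
  define A where "A = max M 0"
  define B where "B = max N 0"
  have fA: "f t \<le> ereal A" and gB: "g t \<le> ereal B" for t
    using f(2)[of t] g(2)[of t] by (auto simp: A_def B_def max_def intro: order_trans)
  have AB: "A \<ge> 0" "B \<ge> 0" by (auto simp: A_def B_def)
  define I where "I = (\<integral>\<^sup>+\<theta>\<in>{0..2*pi}. e2ennreal (ereal A - f \<theta>) \<partial>lborel)"
  define J where "J = (\<integral>\<^sup>+\<theta>\<in>{0..2*pi}. e2ennreal (ereal B - g \<theta>) \<partial>lborel)"
  define L where "L = (\<integral>\<^sup>+\<theta>\<in>{0..2*pi}. e2ennreal (ereal (A + B) - (f \<theta> + g \<theta>)) \<partial>lborel)"
  have pw: "e2ennreal (ereal (A + B) - (f \<theta> + g \<theta>)) = e2ennreal (ereal A - f \<theta>) + e2ennreal (ereal B - g \<theta>)" for \<theta>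
    using fA[of \<theta>] gB[of \<theta>]
    by (cases "f \<theta>"; cases "g \<theta>") (auto simp flip: ennreal_plus simp: algebra_simps)
  have "L = (\<integral>\<^sup>+\<theta>. e2ennreal (ereal A - f \<theta>) * indicator {0..2*pi} \<theta> + e2ennreal (ereal B - g \<theta>) * indicator {0..2*pi} \<theta> \<partial>lborel)"
    unfolding L_def pw by (intro nn_integral_cong) (auto simp: indicator_def)
  also have "\<dots> = I + J"
    unfolding I_def J_def by (rule nn_integral_add) (use f g in auto)
  finally have L: "L = I + J" .
  have 1: "circle_mean f = ereal A - enn2ereal I / ereal (2 * pi)"
    unfolding I_def by (rule circle_mean_bounded_above) (use f fA AB in auto)
  have 2: "circle_mean g = ereal B - enn2ereal J / ereal (2 * pi)"
    unfolding J_def by (rule circle_mean_bounded_above) (use g gB AB in auto)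
  have "f t + g t \<le> ereal (A + B)" for t
    using add_mono[OF fA gB] by simp
  then have 3: "circle_mean (\<lambda>t. f t + g t) = ereal (A + B) - enn2ereal L / ereal (2 * pi)"
    unfolding L_def using f g AB by (intro circle_mean_bounded_above) auto
  show ?thesis
    unfolding 1 2 3 L
  proof (cases I; cases J)
    fix i j assume "0 \<le> i" "I = ennreal i" "0 \<le> j" "J = ennreal j"
    then show "ereal (A + B) - enn2ereal (I + J) / ereal (2 * pi) =
       ereal A - enn2ereal I / ereal (2 * pi) + (ereal B - enn2ereal J / ereal (2 * pi))"
      by (simp add: add_divide_distrib flip: ennreal_plus)
  qed (auto simp: pi_gt_zero)
qed

lemma circle_mean_cmult:
  assumes f: "f \<in> borel_measurable borel" "\<And>t. f t \<le> ereal M" and c: "c > 0"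
  shows "circle_mean (\<lambda>t. ereal c * f t) = ereal c * circle_mean f"
proof -
  define A where "A = max M 0"
  have fA: "f t \<le> ereal A" for t
    using f(2)[of t] by (auto simp: A_def max_def intro: order_trans)
  have A: "A \<ge> 0" by (auto simp: A_def)
  define I where "I = (\<integral>\<^sup>+\<theta>\<in>{0..2*pi}. e2ennreal (ereal A - f \<theta>) \<partial>lborel)"
  define L where "L = (\<integral>\<^sup>+\<theta>\<in>{0..2*pi}. e2ennreal (ereal (c * A) - ereal c * f \<theta>) \<partial>lborel)"
  have pw: "e2ennreal (ereal (c * A) - ereal c * f \<theta>) = ennreal c * e2ennreal (ereal A - f \<theta>)" for \<theta>
    using fA[of \<theta>] c
    by (cases "f \<theta>") (auto simp flip: ennreal_mult simp: algebra_simps ennreal_mult_top)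
  have "L = (\<integral>\<^sup>+\<theta>. ennreal c * (e2ennreal (ereal A - f \<theta>) * indicator {0..2*pi} \<theta>) \<partial>lborel)"
    unfolding L_def pw by (intro nn_integral_cong) (auto simp: indicator_def)
  also have "\<dots> = ennreal c * I"
    unfolding I_def by (rule nn_integral_cmult) (use f in auto)
  finally have L: "L = ennreal c * I" .
  have 1: "circle_mean f = ereal A - enn2ereal I / ereal (2 * pi)"
    unfolding I_def by (rule circle_mean_bounded_above) (use f fA A in auto)
  have "ereal c * f t \<le> ereal (c * A)" for t
    using fA[of t] c by (cases "f t") auto
  then have 3: "circle_mean (\<lambda>t. ereal c * f t) = ereal (c * A) - enn2ereal L / ereal (2 * pi)"
    unfolding L_def using f A c by (intro circle_mean_bounded_above) auto
  show ?thesis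
    unfolding 1 3 L
  proof (cases I)
    case (real i)
    then show "ereal (c * A) - enn2ereal (ennreal c * I) / ereal (2 * pi) = ereal c * (ereal A - enn2ereal I / ereal (2 * pi))"
      using c by (simp add: algebra_simps flip: ennreal_mult)
  qed (use c in \<open>auto simp: pi_gt_zero ennreal_mult_top\<close>)
qed

lemma circle_mean_real:
  fixes f :: "real \<Rightarrow> real"
  assumes I: "(f has_integral I) {0..2*pi}" and cont: "\<And>t. isCont f t" and le: "\<And>t. f t \<le> M"
  shows "circle_mean (\<lambda>t. ereal (f t)) = ereal (I / (2 * pi))"
proof -
  define A where "A = max M 0"
  have A: "A \<ge> 0" and fA: "f t \<le> A" for t using le[of t] by (auto simp: A_def)
  have meas: "f \<in> borel_measurable borel"
    using cont by (intro borel_measurable_continuous_onI continuous_at_imp_continuous_on) auto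
  have hi: "((\<lambda>t. A - f t) has_integral (2 * pi * A - I)) {0..2*pi}"
    using has_integral_diff[OF has_integral_const_real[of A 0 "2*pi"] I] by simp
  have nn: "2 * pi * A - I \<ge> 0"
    by (rule has_integral_nonneg[OF hi]) (use fA in auto)
  have "(\<integral>\<^sup>+\<theta>\<in>{0..2*pi}. e2ennreal (ereal A - ereal (f \<theta>)) \<partial>lborel) = (\<integral>\<^sup>+\<theta>\<in>{0..2*pi}. ennreal (A - f \<theta>) \<partial>lborel)"
    by simp
  also have "\<dots> = ennreal (2 * pi * A - I)"
    by (rule nn_integral_has_integral_lebesgue'[OF _ hi]) (use fA in auto)
  finally have "(\<integral>\<^sup>+\<theta>\<in>{0..2*pi}. e2ennreal (ereal A - ereal (f \<theta>)) \<partial>lborel) = ennreal (2 * pi * A - I)" .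
  then have "circle_mean (\<lambda>t. ereal (f t)) = ereal A - enn2ereal (ennreal (2 * pi * A - I)) / ereal (2 * pi)"
    by (subst circle_mean_bounded_above[where M=A]) (use meas fA A in auto)
  then show ?thesis using nn by (simp add: field_simps)
qed

section \<open>Pointwise subharmonicity\<close>

abbreviation mean_on_circle :: "(complex \<Rightarrow> ereal) \<Rightarrow> complex \<Rightarrow> real \<Rightarrow> ereal" where
  "mean_on_circle u z r \<equiv> circle_mean (\<lambda>\<theta>. u (z + complex_of_real r * cis \<theta>))"

text \<open>
  A local notion: the radius up to which the mean inequality holds may depend on the point, so that functions
  glued from pieces satisfy it piece by piece. Semicontinuity nearby makes the means over small circles
  meaningful.
\<close>

definition subharmonic_at :: "(complex \<Rightarrow> ereal) \<Rightarrow> complex \<Rightarrow> bool" where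
  "subharmonic_at u z \<longleftrightarrow> (\<forall>\<^sub>F w in nhds z. usc_at u w \<and> u w < \<infinity>) \<and>
     (\<exists>r0>0. \<forall>r. 0 < r \<and> r < r0 \<longrightarrow> u z \<le> mean_on_circle u z r)"

lemma circle_measurable_bounded:
  assumes "\<And>w. w \<in> sphere a (cmod \<beta>) \<Longrightarrow> usc_at u w \<and> u w < \<infinity>"
  obtains M where "M \<ge> 0" "\<And>\<theta>. u (a + \<beta> * cis \<theta>) \<le> ereal M"
    "(\<lambda>\<theta>. u (a + \<beta> * cis \<theta>)) \<in> borel_measurable borel"
proof -
  have on: "a + \<beta> * cis \<theta> \<in> sphere a (cmod \<beta>)" for \<theta>
    by (simp add: dist_norm norm_mult)
  obtain M where M: "M \<ge> 0" "\<And>w. w \<in> sphere a (cmod \<beta>) \<Longrightarrow> u w \<le> ereal M"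
    using usc_bounded_above[of "sphere a (cmod \<beta>)" u] assms by (metis compact_sphere)
  have "(\<lambda>\<theta>. u (a + \<beta> * cis \<theta>)) \<in> borel_measurable borel"
  proof (rule usc_borel_measurable)
    fix \<theta>
    have "isCont (\<lambda>\<theta>. a + \<beta> * cis \<theta>) \<theta>" unfolding cis_conv_exp by (intro continuous_intros)
    then show "usc_at (\<lambda>\<theta>. u (a + \<beta> * cis \<theta>)) \<theta>"
      using usc_at_compose[of u "\<lambda>\<theta>. a + \<beta> * cis \<theta>" \<theta>] assms[OF on] by blast
  qed
  then show thesis using that M on by blast
qed

lemma small_circle_measurable_bounded:
  assumes "\<And>w. w \<in> ball a r0 \<Longrightarrow> usc_at u w \<and> u w < \<infinity>" "0 < r" "r < r0"
  obtains M where "\<And>\<theta>. u (a + complex_of_real r * cis \<theta>) \<le> ereal M"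
    "(\<lambda>\<theta>. u (a + complex_of_real r * cis \<theta>)) \<in> borel_measurable borel"
proof -
  have "w \<in> ball a r0" if "w \<in> sphere a (cmod (complex_of_real r))" for w
    using that assms(2,3) by auto
  then show thesis
    using circle_measurable_bounded[of a "complex_of_real r" u] assms(1) that by metis
qed

lemma subharmonic_at_circles:
  assumes "subharmonic_at u z"
  obtains r0 where "r0 > 0" "\<And>w. w \<in> ball z r0 \<Longrightarrow> usc_at u w \<and> u w < \<infinity>"
    "\<And>r. 0 < r \<Longrightarrow> r < r0 \<Longrightarrow> u z \<le> mean_on_circle u z r"
proof -
  obtain e where "e > 0" "\<And>w. dist w z < e \<Longrightarrow> usc_at u w \<and> u w < \<infinity>"
    using assms unfolding subharmonic_at_def eventually_nhds_metric by blast
  moreover obtain r1 where "r1 > 0"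
    "\<And>r. 0 < r \<Longrightarrow> r < r1 \<Longrightarrow> u z \<le> mean_on_circle u z r"
    using assms unfolding subharmonic_at_def by blast
  ultimately show thesis
    by (intro that[of "min e r1"]) (auto simp: dist_commute)
qed

lemma subharmonic_at_iff:
  "subharmonic_at u z \<longleftrightarrow> (\<exists>r0>0. (\<forall>w\<in>ball z r0. usc_at u w \<and> u w < \<infinity>) \<and>
    (\<forall>r. 0 < r \<and> r < r0 \<longrightarrow> u z \<le> mean_on_circle u z r))"
  (is "_ \<longleftrightarrow> ?R")
proof
  assume "subharmonic_at u z"
  then obtain r0 where "r0 > 0" "\<And>w. w \<in> ball z r0 \<Longrightarrow> usc_at u w \<and> u w < \<infinity>"
    "\<And>r. 0 < r \<Longrightarrow> r < r0 \<Longrightarrow> u z \<le> mean_on_circle u z r"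
    using subharmonic_at_circles by blast
  then show ?R by (intro exI[of _ r0]) auto
next
  assume ?R
  then obtain r0 where r0: "r0 > 0" "\<forall>w\<in>ball z r0. usc_at u w \<and> u w < \<infinity>"
    "\<forall>r. 0 < r \<and> r < r0 \<longrightarrow> u z \<le> mean_on_circle u z r"
    by blast
  have "\<forall>\<^sub>F w in nhds z. w \<in> ball z r0"
    using r0(1) by (intro eventually_nhds_in_open) auto
  then have "\<forall>\<^sub>F w in nhds z. usc_at u w \<and> u w < \<infinity>"
    using r0(2) by (auto elim: eventually_mono)
  then show "subharmonic_at u z"
    unfolding subharmonic_at_def using r0 by blast
qed

lemma subharmonic_at_usc: "subharmonic_at u z \<Longrightarrow> usc_at u z" and subharmonic_at_less_infty: "subharmonic_at u z \<Longrightarrow> u z < \<infinity>"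
  unfolding subharmonic_at_def by (auto dest: eventually_nhds_x_imp_x)

lemma subharmonic_at_add:
  assumes "subharmonic_at u z" "subharmonic_at v z"
  shows "subharmonic_at (\<lambda>w. u w + v w) z"
proof -
  obtain r0 where r0: "r0 > 0" "\<And>w. w \<in> ball z r0 \<Longrightarrow> usc_at u w \<and> u w < \<infinity>"
    "\<And>r. 0 < r \<Longrightarrow> r < r0 \<Longrightarrow> u z \<le> mean_on_circle u z r"
    using subharmonic_at_circles[OF assms(1)] by blast
  obtain r1 where r1: "r1 > 0" "\<And>w. w \<in> ball z r1 \<Longrightarrow> usc_at v w \<and> v w < \<infinity>"
    "\<And>r. 0 < r \<Longrightarrow> r < r1 \<Longrightarrow> v z \<le> mean_on_circle v z r"
    using subharmonic_at_circles[OF assms(2)] by blast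
  show ?thesis
    unfolding subharmonic_at_iff
  proof (intro exI[of _ "min r0 r1"] conjI ballI allI impI)
    fix r assume r: "0 < r \<and> r < min r0 r1"
    obtain M where M: "\<And>\<theta>. u (z + complex_of_real r * cis \<theta>) \<le> ereal M"
      "(\<lambda>\<theta>. u (z + complex_of_real r * cis \<theta>)) \<in> borel_measurable borel"
      using small_circle_measurable_bounded[of z r0 u r] r0(2) r by auto
    obtain N where N: "\<And>\<theta>. v (z + complex_of_real r * cis \<theta>) \<le> ereal N"
      "(\<lambda>\<theta>. v (z + complex_of_real r * cis \<theta>)) \<in> borel_measurable borel"
      using small_circle_measurable_bounded[of z r1 v r] r1(2) r by auto
    show "u z + v z \<le> circle_mean (\<lambda>\<theta>. u (z + complex_of_real r * cis \<theta>) + v (z + complex_of_real r * cis \<theta>))"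
      unfolding circle_mean_add[OF M(2,1) N(2,1)] using r r0(3) r1(3) by (auto intro: add_mono)
  qed (use r0 r1 in \<open>auto intro: usc_at_add\<close>)
qed

lemma subharmonic_at_cmult:
  assumes "subharmonic_at u z" "c > 0"
  shows "subharmonic_at (\<lambda>w. ereal c * u w) z"
proof -
  obtain r0 where r0: "r0 > 0" "\<And>w. w \<in> ball z r0 \<Longrightarrow> usc_at u w \<and> u w < \<infinity>"
    "\<And>r. 0 < r \<Longrightarrow> r < r0 \<Longrightarrow> u z \<le> mean_on_circle u z r"
    using subharmonic_at_circles[OF assms(1)] by blast
  show ?thesis
    unfolding subharmonic_at_iff
  proof (intro exI[of _ r0] conjI ballI allI impI)
    fix r assume r: "0 < r \<and> r < r0"
    obtain M where M: "\<And>\<theta>. u (z + complex_of_real r * cis \<theta>) \<le> ereal M"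
      "(\<lambda>\<theta>. u (z + complex_of_real r * cis \<theta>)) \<in> borel_measurable borel"
      using small_circle_measurable_bounded[of z r0 u r] r0(2) r by auto
    show "ereal c * u z \<le> circle_mean (\<lambda>\<theta>. ereal c * u (z + complex_of_real r * cis \<theta>))"
      unfolding circle_mean_cmult[OF M(2,1) assms(2)] using r r0(3) assms(2) by (intro ereal_mult_left_mono) auto
  next
    fix w assume "w \<in> ball z r0"
    then show "ereal c * u w < \<infinity>" using r0(2)[of w] assms(2) by (cases "u w") auto
  qed (use r0 assms(2) in \<open>auto intro: usc_at_cmult\<close>)
qed

lemma subharmonic_at_max:
  assumes "subharmonic_at u z" "subharmonic_at v z"
  shows "subharmonic_at (\<lambda>w. max (u w) (v w)) z"
proof -
  obtain r0 where r0: "r0 > 0" "\<And>w. w \<in> ball z r0 \<Longrightarrow> usc_at u w \<and> u w < \<infinity>"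
    "\<And>r. 0 < r \<Longrightarrow> r < r0 \<Longrightarrow> u z \<le> mean_on_circle u z r"
    using subharmonic_at_circles[OF assms(1)] by blast
  obtain r1 where r1: "r1 > 0" "\<And>w. w \<in> ball z r1 \<Longrightarrow> usc_at v w \<and> v w < \<infinity>"
    "\<And>r. 0 < r \<Longrightarrow> r < r1 \<Longrightarrow> v z \<le> mean_on_circle v z r"
    using subharmonic_at_circles[OF assms(2)] by blast
  show ?thesis
    unfolding subharmonic_at_iff
  proof (intro exI[of _ "min r0 r1"] conjI ballI allI impI)
    fix r assume r: "0 < r \<and> r < min r0 r1"
    have "mean_on_circle u z r \<le> circle_mean (\<lambda>\<theta>. max (u (z + complex_of_real r * cis \<theta>)) (v (z + complex_of_real r * cis \<theta>)))"
      "mean_on_circle v z r \<le> circle_mean (\<lambda>\<theta>. max (u (z + complex_of_real r * cis \<theta>)) (v (z + complex_of_real r * cis \<theta>)))"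
      by (auto intro!: circle_mean_mono)
    then show "max (u z) (v z) \<le> circle_mean (\<lambda>\<theta>. max (u (z + complex_of_real r * cis \<theta>)) (v (z + complex_of_real r * cis \<theta>)))"
      using r0(3)[of r] r1(3)[of r] r by (auto intro: order_trans)
  next
    fix w assume "w \<in> ball z (min r0 r1)"
    then show "max (u w) (v w) < \<infinity>" using r0(2)[of w] r1(2)[of w] by (auto simp: max_def)
  qed (use r0 r1 in \<open>auto intro: usc_at_max\<close>)
qed

lemma subharmonic_at_cong:
  assumes "\<forall>\<^sub>F w in nhds z. u w = v w" "subharmonic_at u z"
  shows "subharmonic_at v z"
proof -
  obtain e where e: "e > 0" "\<And>w. w \<in> ball z e \<Longrightarrow> u w = v w"
    using assms(1) unfolding eventually_nhds_metric by (metis dist_commute mem_ball)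
  obtain r0 where r0: "r0 > 0" "\<And>w. w \<in> ball z r0 \<Longrightarrow> usc_at u w \<and> u w < \<infinity>"
    "\<And>r. 0 < r \<Longrightarrow> r < r0 \<Longrightarrow> u z \<le> mean_on_circle u z r"
    using subharmonic_at_circles[OF assms(2)] by blast
  have ev: "\<forall>\<^sub>F y in nhds w. u y = v y" if "w \<in> ball z e" for w
    using that e(2) eventually_nhds_in_open[of "ball z e" w] by (auto elim: eventually_mono)
  show ?thesis
    unfolding subharmonic_at_iff
  proof (intro exI[of _ "min r0 e"] conjI ballI allI impI)
    fix r assume r: "0 < r \<and> r < min r0 e"
    have "(\<lambda>\<theta>. u (z + complex_of_real r * cis \<theta>)) = (\<lambda>\<theta>. v (z + complex_of_real r * cis \<theta>))"
      using r by (intro ext e(2)) (simp add: dist_norm norm_mult)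
    then show "v z \<le> mean_on_circle v z r"
      using r0(3)[of r] r e by simp
  next
    fix w assume w: "w \<in> ball z (min r0 e)"
    show "usc_at v w" using usc_at_cong[OF ev[of w]] r0(2)[of w] w by auto
    show "v w < \<infinity>" using r0(2)[of w] e(2)[of w] w by auto
  qed (use e r0 in auto)
qed

text \<open>
  The mean value property of harmonic functions, read off from Cauchy's integral formula for the function
  transported to the unit circle.
\<close>

lemma has_integral_Re_circle:
  assumes g: "g holomorphic_on S" and S: "cball z (cmod \<beta>) \<subseteq> S"
  shows "((\<lambda>\<theta>. Re (g (z + \<beta> * cis \<theta>))) has_integral (2 * pi * Re (g z))) {0..2*pi}"
proof -
  define G where "G \<xi> = g (z + \<beta> * \<xi>)" for \<xi>
  have "z + \<beta> * \<xi> \<in> cball z (cmod \<beta>)" if "\<xi> \<in> cball 0 1" for \<xi>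
    using that by (simp add: dist_norm norm_mult mult_left_le)
  then have "(g \<circ> (\<lambda>\<xi>. z + \<beta> * \<xi>)) holomorphic_on cball 0 1"
    using S by (intro holomorphic_on_compose_gen[OF _ g] holomorphic_intros) blast
  then have "G holomorphic_on cball 0 1"
    by (simp add: G_def[abs_def] comp_def)
  then have "((\<lambda>u. G u / (u - 0)) has_contour_integral (2 * of_real pi * \<i> * G 0)) (circlepath 0 1)"
    by (rule Cauchy_integral_circlepath_simple) simp
  then have "((\<lambda>t. G (cis t) / cis t * \<i> * cis t) has_integral (2 * of_real pi * \<i> * G 0)) {0..2*pi}"
    unfolding circlepath_def by (subst (asm) has_contour_integral_part_circlepath_iff) auto
  then have "((\<lambda>t. \<i> * G (cis t)) has_integral (\<i> * (2 * of_real pi * G 0))) {0..2*pi}"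
    by (simp add: mult_ac)
  then have "((\<lambda>t. (-\<i>) * (\<i> * G (cis t))) has_integral ((-\<i>) * (\<i> * (2 * of_real pi * G 0)))) {0..2*pi}"
    by (rule has_integral_mult_right)
  then have "((\<lambda>t. G (cis t)) has_integral (2 * of_real pi * G 0)) {0..2*pi}"
    by (simp flip: mult.assoc)
  then have "((\<lambda>t. Re (G (cis t))) has_integral (Re (2 * of_real pi * G 0))) {0..2*pi}"
    by (rule has_integral_linear[OF _ bounded_linear_Re, unfolded comp_def])
  then show ?thesis by (simp add: G_def)
qed

lemma circle_mean_Re:
  assumes g: "g holomorphic_on S" and "open S" and S: "cball z (cmod \<beta>) \<subseteq> S"
  shows "circle_mean (\<lambda>\<theta>. ereal (Re (g (z + \<beta> * cis \<theta>)))) = ereal (Re (g z))"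
proof -
  have "z + \<beta> * cis \<theta> \<in> cball z (cmod \<beta>)" for \<theta>
    by (simp add: dist_norm norm_mult)
  then have inS: "z + \<beta> * cis \<theta> \<in> S" for \<theta>
    using S by blast
  have contS: "isCont g w" if "w \<in> S" for w
    using holomorphic_on_imp_continuous_on[OF g] that unfolding continuous_on_eq_continuous_at[OF \<open>open S\<close>] by simp
  have contg: "isCont (\<lambda>\<theta>. g (z + \<beta> * cis \<theta>)) \<theta>" for \<theta>
  proof (rule isCont_o2[where f="\<lambda>\<theta>. z + \<beta> * cis \<theta>" and g=g])
    show "isCont (\<lambda>\<theta>. z + \<beta> * cis \<theta>) \<theta>" unfolding cis_conv_exp by (intro continuous_intros)
  qed (rule contS[OF inS])
  have cont: "isCont (\<lambda>\<theta>. Re (g (z + \<beta> * cis \<theta>))) \<theta>" for \<theta>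
    by (rule isCont_Re[OF contg])
  have "compact (g ` sphere z (cmod \<beta>))"
  proof (rule compact_continuous_image)
    have "sphere z (cmod \<beta>) \<subseteq> S" using S sphere_cball by blast
    then show "continuous_on (sphere z (cmod \<beta>)) g"
      using holomorphic_on_imp_continuous_on[OF g] continuous_on_subset by blast
  qed simp
  then obtain B where B: "\<And>w. w \<in> g ` sphere z (cmod \<beta>) \<Longrightarrow> norm w \<le> B"
    using compact_imp_bounded bounded_iff by metis
  have M: "Re (g (z + \<beta> * cis \<theta>)) \<le> B" for \<theta>
  proof -
    have "z + \<beta> * cis \<theta> \<in> sphere z (cmod \<beta>)" by (simp add: dist_norm norm_mult)
    then have "cmod (g (z + \<beta> * cis \<theta>)) \<le> B" by (intro B imageI)
    then show ?thesis using complex_Re_le_cmod order_trans by blast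
  qed
  have "circle_mean (\<lambda>\<theta>. ereal (Re (g (z + \<beta> * cis \<theta>)))) = ereal ((2 * pi * Re (g z)) / (2 * pi))"
    by (rule circle_mean_real[OF has_integral_Re_circle[OF g S] cont M])
  then show ?thesis by simp
qed

lemma subharmonic_at_Re:
  assumes "g holomorphic_on S" "open S" "z \<in> S"
  shows "subharmonic_at (\<lambda>w. ereal (Re (g w))) z"
proof -
  obtain e where e: "e > 0" "cball z e \<subseteq> S"
    using assms open_contains_cball by blast
  have "isCont g w" if "w \<in> S" for w
    using holomorphic_on_imp_continuous_on[OF assms(1)] that unfolding continuous_on_eq_continuous_at[OF assms(2)] by simp
  then have u: "usc_at (\<lambda>w. ereal (Re (g w))) w" if "w \<in> S" for w
    using that by (intro usc_at_real isCont_Re) auto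
  have c: "circle_mean (\<lambda>\<theta>. ereal (Re (g (z + complex_of_real r * cis \<theta>)))) = ereal (Re (g z))" if "0 < r" "r < e" for r
  proof (rule circle_mean_Re[OF assms(1,2)])
    have "cball z (cmod (complex_of_real r)) \<subseteq> cball z e" using that by (intro subset_cball) auto
    then show "cball z (cmod (complex_of_real r)) \<subseteq> S" using e(2) by blast
  qed
  have "ball z e \<subseteq> S" using e(2) ball_subset_cball by blast
  then show ?thesis
    unfolding subharmonic_at_iff using e(1) u c by (intro exI[of _ e]) auto
qed

lemma subharmonic_at_const: "subharmonic_at (\<lambda>_. ereal c) z"
  using subharmonic_at_Re[of "\<lambda>_. complex_of_real c" UNIV z] by simp

lemma subharmonic_at_add_const: "subharmonic_at u z \<Longrightarrow> subharmonic_at (\<lambda>w. u w + ereal c) z"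
  by (intro subharmonic_at_add subharmonic_at_const)

text \<open>
  Among the points where a positive maximum is attained choose one with the largest real part. It cannot be
  interior: on the right half of each small circle around it the function is smaller than the maximum.
\<close>

lemma max_principle:
  assumes S: "compact S" and W: "open W" "W \<subseteq> S"
    and usc: "\<And>z. z \<in> S \<Longrightarrow> usc_at f z" and fin: "\<And>z. z \<in> S \<Longrightarrow> f z < \<infinity>"
    and sh: "\<And>z. z \<in> W \<Longrightarrow> subharmonic_at f z" and bd: "\<And>z. z \<in> S - W \<Longrightarrow> f z \<le> 0"
    and z: "z \<in> S"
  shows "f z \<le> 0"
proof (rule ccontr)
  assume "\<not> f z \<le> 0"
  obtain x where x: "x \<in> S" "\<And>y. y \<in> S \<Longrightarrow> f y \<le> f x"
    using usc_at_attains_max[OF S _ usc] z by blast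
  then have "f x > 0" using z \<open>\<not> f z \<le> 0\<close> by (meson le_less_linear less_le_trans)
  then obtain M where M: "f x = ereal M" "M > 0"
    using fin[OF x(1)] by (cases "f x") auto
  define T where "T = {y\<in>S. f y = ereal M}"
  have "T = S - \<Union>{V. open V \<and> (\<forall>w\<in>V. f w < ereal M)}"
  proof -
    have "\<exists>V. open V \<and> y \<in> V \<and> (\<forall>w\<in>V. f w < ereal M)" if "y \<in> S" "f y \<noteq> ereal M" for y
    proof -
      have "f y < ereal M" using x(2)[OF that(1)] that(2) M(1) by auto
      then show ?thesis using usc[OF that(1)] unfolding usc_at_def eventually_nhds by blast
    qed
    then show ?thesis unfolding T_def by (intro set_eqI iffI) (force, blast)
  qed
  then have "compact T" using S by (simp add: compact_diff open_Union)
  moreover have "T \<noteq> {}" using x M T_def by auto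
  ultimately obtain p where p: "p \<in> T" "\<And>y. y \<in> T \<Longrightarrow> Re y \<le> Re p"
    using continuous_attains_sup[of T Re, OF _ _ continuous_on_Re[OF continuous_on_id]] by blast
  have "p \<in> W" using p(1) bd[of p] M(2) T_def by (cases "p \<in> W") auto
  obtain r0 where r0: "r0 > 0" "\<And>w. w \<in> ball p r0 \<Longrightarrow> usc_at f w \<and> f w < \<infinity>"
    "\<And>r. 0 < r \<Longrightarrow> r < r0 \<Longrightarrow> f p \<le> mean_on_circle f p r"
    using subharmonic_at_circles[OF sh[OF \<open>p \<in> W\<close>]] by blast
  obtain e where e: "e > 0" "cball p e \<subseteq> W"
    using W(1) \<open>p \<in> W\<close> open_contains_cball by blast
  define r where "r = min e (r0 / 2)"
  have r: "0 < r" "r < r0" "r \<le> e" using e r0 by (auto simp: r_def)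
  define h where "h \<theta> = f (p + complex_of_real r * cis \<theta>)" for \<theta>
  have onS: "p + complex_of_real r * cis \<theta> \<in> S" for \<theta>
  proof -
    have "p + complex_of_real r * cis \<theta> \<in> cball p e" using r by (simp add: dist_norm norm_mult)
    then show ?thesis using e W by blast
  qed
  have hM: "h \<theta> \<le> ereal M" for \<theta> unfolding h_def M(1)[symmetric] by (rule x(2)[OF onS])
  have meas: "h \<in> borel_measurable borel"
    using small_circle_measurable_bounded[of p r0 f r] r0(2) r unfolding h_def by blast
  have less: "h \<theta> < ereal M" if "\<theta> \<in> {0<..<1}" for \<theta>
  proof (rule ccontr)
    assume "\<not> h \<theta> < ereal M"
    then have "h \<theta> = ereal M" using hM[of \<theta>] by auto
    then have "Re (p + complex_of_real r * cis \<theta>) \<le> Re p"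
      unfolding h_def using onS by (intro p(2)) (auto simp: T_def)
    moreover have "cos \<theta> > 0" using that pi_gt3 by (intro cos_gt_zero_pi) auto
    ultimately show False using r by (simp add: mult_le_0_iff)
  qed
  define I where "I = (\<integral>\<^sup>+\<theta>\<in>{0..2*pi}. e2ennreal (ereal M - h \<theta>) \<partial>lborel)"
  have "circle_mean h = ereal M - enn2ereal I / ereal (2 * pi)"
    unfolding I_def by (rule circle_mean_bounded_above[OF meas hM]) (use M in auto)
  moreover have "ereal M \<le> circle_mean h"
    using r0(3)[OF r(1,2)] p(1) unfolding h_def T_def by auto
  ultimately have "I = 0"
    by (cases I) (auto simp: pi_gt_zero field_simps)
  then have "AE \<theta> in lborel. e2ennreal (ereal M - h \<theta>) * indicator {0..2*pi} \<theta> = 0"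
    unfolding I_def using meas by (subst (asm) nn_integral_0_iff_AE) auto
  then have "AE \<theta> in lborel. \<theta> \<notin> {0<..<1::real}"
  proof (rule AE_mp, intro AE_I2 impI notI)
    fix \<theta> :: real assume a: "e2ennreal (ereal M - h \<theta>) * indicator {0..2*pi} \<theta> = 0" "\<theta> \<in> {0<..<1}"
    have "\<theta> \<in> {0..2*pi}" using a(2) pi_gt3 by auto
    then have "e2ennreal (ereal M - h \<theta>) = 0" using a(1) by auto
    then show False using less[OF a(2)] by (cases "h \<theta>") auto
  qed
  then have "{0<..<1::real} \<in> null_sets lborel"
    by (subst AE_iff_null_sets) auto
  then show False by auto
qed

section \<open>From small circles to all circles\<close>

text \<open>
  On the unit circle \<open>z\<^sup>n cnj z\<^sup>m = z\<^sup>n\<^sup>-\<^sup>m\<close> for \<open>m \<le> n\<close>, so products of real parts of monomials are again real parts of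
  polynomials. This is the algebra property that the Stone-Weierstrass theorem asks for.
\<close>

lemma Re_poly_mult_on_circle:
  "\<exists>r. \<forall>z\<in>sphere 0 1. Re (poly p z) * Re (poly q z) = Re (poly r z)"
proof -
  define Q where "Q p q \<longleftrightarrow> (\<exists>r. \<forall>z\<in>sphere 0 1. Re (poly p z) * Re (poly q z) = Re (poly r z))"
    for p q :: "complex poly"
  have sym: "Q p q \<Longrightarrow> Q q p" for p q
    unfolding Q_def by (simp add: mult.commute)
  have add: "Q (p1 + p2) q" if "Q p1 q" "Q p2 q" for p1 p2 q
  proof -
    obtain r1 r2 where "\<forall>z\<in>sphere 0 1. Re (poly p1 z) * Re (poly q z) = Re (poly r1 z)"
      "\<forall>z\<in>sphere 0 1. Re (poly p2 z) * Re (poly q z) = Re (poly r2 z)"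
      using \<open>Q p1 q\<close> \<open>Q p2 q\<close> unfolding Q_def by blast
    then show ?thesis unfolding Q_def by (intro exI[of _ "r1 + r2"]) (simp add: algebra_simps)
  qed
  have zero: "Q 0 q" for q unfolding Q_def by (intro exI[of _ 0]) simp
  have le: "Q (monom c n) (monom d m)" if "m \<le> n" for c d n m
    unfolding Q_def
  proof (intro exI[of _ "monom (c * d / 2) (n + m) + monom (c * cnj d / 2) (n - m)"] ballI)
    fix z :: complex assume "z \<in> sphere 0 1"
    then have z: "z * cnj z = 1" by (simp add: complex_mult_cnj cmod_def power2_eq_square)
    have "z ^ (n - m) = z ^ (n - m) * (z * cnj z) ^ m" using z by simp
    also have "\<dots> = z ^ n * cnj z ^ m"
      using that by (simp add: power_mult_distrib flip: power_add mult.assoc)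
    finally have e: "z ^ (n - m) = z ^ n * cnj z ^ m" .
    have rr: "Re a * Re b = Re (a * b / 2) + Re (a * cnj b / 2)" for a b :: complex
      by (simp add: field_simps)
    have "Re (c * z ^ n) * Re (d * z ^ m) = Re ((c * z ^ n) * (d * z ^ m) / 2) + Re ((c * z ^ n) * cnj (d * z ^ m) / 2)"
      by (rule rr)
    also have "(c * z ^ n) * (d * z ^ m) / 2 = c * d / 2 * z ^ (n + m)"
      by (simp add: power_add)
    also have "(c * z ^ n) * cnj (d * z ^ m) / 2 = c * cnj d / 2 * z ^ (n - m)"
      unfolding e by simp
    finally show "Re (poly (monom c n) z) * Re (poly (monom d m) z) =
        Re (poly (monom (c * d / 2) (n + m) + monom (c * cnj d / 2) (n - m)) z)"
      by (simp only: poly_monom poly_add plus_complex.sel)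
  qed
  have mm: "Q (monom c n) (monom d m)" for c d n m
  proof (cases "m \<le> n")
    case False
    then have "n \<le> m" by simp
    then show ?thesis by (intro sym[OF le])
  qed (rule le)
  have gen: "Q p q" if mono: "\<And>c n. Q (monom c n) q" for p q
  proof -
    have "Q (\<Sum>i\<in>A. monom (coeff p i) i) q" if fin: "finite A" for A
      using fin
    proof induction
      case (insert x A)
      have "Q (monom (coeff p x) x + (\<Sum>i\<in>A. monom (coeff p i) i)) q"
        by (intro add mono insert.IH)
      then show ?case using insert.hyps by simp
    qed (simp add: zero)
    then have "Q (\<Sum>i\<le>degree p. monom (coeff p i) i) q" by blast
    then show ?thesis by (simp add: poly_as_sum_of_monoms)
  qed
  have "Q q (monom c n)" for c n by (rule gen) (rule mm)
  then have "Q p q" using gen sym by blast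
  then show ?thesis unfolding Q_def .
qed

text \<open>
  Trigonometric polynomials are boundary values of harmonic polynomials, so this solves the Dirichlet
  problem up to an error \<open>e\<close>.
\<close>

lemma harmonic_polynomial_approximation:
  fixes g :: "complex \<Rightarrow> real"
  assumes "continuous_on (sphere 0 1) g" "e > 0"
  obtains p where "\<And>z. z \<in> sphere 0 1 \<Longrightarrow> \<bar>g z - Re (poly p z)\<bar> < e"
proof -
  define P where "P f \<longleftrightarrow> (\<exists>p. \<forall>z\<in>sphere 0 1. f z = Re (poly p z))" for f :: "complex \<Rightarrow> real"
  have "\<exists>h. P h \<and> (\<forall>z\<in>sphere 0 1. \<bar>g z - h z\<bar> < e)"
  proof (rule Stone_Weierstrass_HOL)
    show "compact (sphere (0::complex) 1)" by simp
    show "P (\<lambda>_. c)" for c unfolding P_def by (intro exI[of _ "[:complex_of_real c:]"]) simp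
    show "continuous_on (sphere 0 1) f" if Pf: "P f" for f
    proof -
      obtain p where "\<forall>z\<in>sphere 0 1. f z = Re (poly p z)" using Pf unfolding P_def by blast
      then have "continuous_on (sphere 0 1) f \<longleftrightarrow> continuous_on (sphere 0 1) (\<lambda>z. Re (poly p z))"
        by (intro continuous_on_cong) auto
      moreover have "continuous_on (sphere 0 1) (\<lambda>z. Re (poly p z))"
        by (intro continuous_intros)
      ultimately show ?thesis by blast
    qed
    show "P (\<lambda>x. f x + g x)" if Pfg: "P f \<and> P g" for f g
    proof -
      obtain p q where "\<forall>z\<in>sphere 0 1. f z = Re (poly p z)" "\<forall>z\<in>sphere 0 1. g z = Re (poly q z)"
        using Pfg unfolding P_def by blast
      then show ?thesis unfolding P_def by (intro exI[of _ "p + q"]) simp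
    qed
    show "P (\<lambda>x. f x * g x)" if Pfg: "P f \<and> P g" for f g
    proof -
      obtain p q where pq: "\<forall>z\<in>sphere 0 1. f z = Re (poly p z)" "\<forall>z\<in>sphere 0 1. g z = Re (poly q z)"
        using Pfg unfolding P_def by blast
      obtain r where "\<forall>z\<in>sphere 0 1. Re (poly p z) * Re (poly q z) = Re (poly r z)"
        using Re_poly_mult_on_circle by blast
      then show ?thesis unfolding P_def using pq by (intro exI[of _ r]) simp
    qed
    show "\<exists>f. P f \<and> f x \<noteq> f y" if "x \<in> sphere 0 1 \<and> y \<in> sphere 0 1 \<and> x \<noteq> y" for x y
    proof -
      have "P Re" unfolding P_def by (intro exI[of _ "[:0, 1:]"]) simp
      moreover have "P Im" unfolding P_def by (intro exI[of _ "[:0, -\<i>:]"]) simp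
      moreover have "Re x \<noteq> Re y \<or> Im x \<noteq> Im y" using that complex_eqI by blast
      ultimately show ?thesis by blast
    qed
  qed (use assms in auto)
  then show thesis using that unfolding P_def by metis
qed

text \<open>
  Lipschitz regularization from above, \<open>g\<^sub>k(x) = sup\<^sub>y (max (f y) (-k) - k |x - y|)\<close>. Far from \<open>x\<close> the
  penalty \<open>k |x - y|\<close> exceeds the bound \<open>M\<close>; near \<open>x\<close> semicontinuity bounds \<open>f\<close>.
\<close>

lemma usc_continuous_approximation:
  fixes f :: "'a::metric_space \<Rightarrow> ereal"
  assumes usc: "\<And>x. x \<in> S \<Longrightarrow> usc_at f x" and le: "\<And>x. x \<in> S \<Longrightarrow> f x \<le> ereal M" and "M \<ge> 0"
  obtains g :: "nat \<Rightarrow> 'a \<Rightarrow> real"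
  where "\<And>k. continuous_on S (g k)" "\<And>k x. x \<in> S \<Longrightarrow> f x \<le> ereal (g k x)"
    "\<And>k x. x \<in> S \<Longrightarrow> g k x \<le> M" "\<And>x. x \<in> S \<Longrightarrow> (\<lambda>k. ereal (g k x)) \<longlonglongrightarrow> f x"
proof -
  define F where "F k x = real_of_ereal (max (f x) (ereal (- real k)))" for k x
  have F: "ereal (F k x) = max (f x) (ereal (- real k))" if "x \<in> S" for k x
    unfolding F_def using le[OF that] by (cases "f x") (auto simp flip: ereal_max)
  have FM: "F k x \<le> M" and Fk: "F k x \<ge> - real k" and Ff: "f x \<le> ereal (F k x)" if "x \<in> S" for k x
  proof -
    have "ereal (F k x) \<le> ereal M" using F[OF that, of k] le[OF that] \<open>M \<ge> 0\<close> by simp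
    then show "F k x \<le> M" by simp
    have "ereal (- real k) \<le> ereal (F k x)" using F[OF that, of k] by simp
    then show "F k x \<ge> - real k" by simp
    show "f x \<le> ereal (F k x)" using F[OF that, of k] by simp
  qed
  define g where "g k x = (SUP y\<in>S. F k y - real k * dist x y)" for k x
  have bdd: "bdd_above ((\<lambda>y. F k y - real k * dist x y) ` S)" for k x
    using FM by (intro bdd_aboveI2[of _ _ M]) (smt (verit) mult_nonneg_nonneg of_nat_0_le_iff zero_le_dist)
  have gF: "F k x \<le> g k x" if "x \<in> S" for k x
    unfolding g_def using cSUP_upper[OF that bdd, of k x] by simp
  have gM: "g k x \<le> M" if "x \<in> S" for k x
    unfolding g_def
  proof (rule cSUP_least)
    fix y assume "y \<in> S"
    have "0 \<le> real k * dist x y" by simp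
    then show "F k y - real k * dist x y \<le> M" using FM[OF \<open>y \<in> S\<close>, of k] by linarith
  qed (use that in auto)
  have lip: "g k x \<le> g k x' + real k * dist x x'" if "x \<in> S" "x' \<in> S" for k x x'
    unfolding g_def[of k x]
  proof (rule cSUP_least)
    fix y assume "y \<in> S"
    have "real k * dist x' y \<le> real k * (dist x x' + dist x y)"
      using dist_triangle[of x' y x] by (intro mult_left_mono) (auto simp: dist_commute)
    moreover have "F k y - real k * dist x' y \<le> g k x'"
      unfolding g_def by (rule cSUP_upper[OF \<open>y \<in> S\<close> bdd])
    ultimately show "F k y - real k * dist x y \<le> g k x' + real k * dist x x'"
      by (simp add: algebra_simps)
  qed (use that in auto)
  have cont: "continuous_on S (g k)" for k
  proof (rule lipschitz_on_continuous_on[of "real k"], rule lipschitz_onI)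
    fix x y assume "x \<in> S" "y \<in> S"
    then show "dist (g k x) (g k y) \<le> real k * dist x y"
      using lip[of x y k] lip[of y x k] by (auto simp: dist_real_def dist_commute)
  qed simp
  have lim: "(\<lambda>k. ereal (g k x)) \<longlonglongrightarrow> f x" if x: "x \<in> S" for x
  proof (rule order_tendstoI)
    fix a assume "a < f x"
    then show "\<forall>\<^sub>F k in sequentially. a < ereal (g k x)"
      using Ff[OF x] gF[OF x] by (intro always_eventually allI) (meson ereal_less_eq(3) less_le_trans order_trans)
  next
    fix a assume "f x < a"
    then obtain c :: real where c: "f x < ereal c" "ereal c < a" using ereal_dense2 by blast
    obtain e where e: "e > 0" "\<And>y. dist y x < e \<Longrightarrow> f y < ereal c"
      using usc[OF x] c(1) unfolding usc_at_def eventually_nhds_metric by blast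
    obtain n1 :: nat where n1: "real n1 \<ge> - c" using real_arch_simple by blast
    obtain n2 :: nat where n2: "real n2 \<ge> (M - c) / e" using real_arch_simple by blast
    have "g k x \<le> c" if "k \<ge> max n1 n2" for k
      unfolding g_def
    proof (rule cSUP_least)
      fix y assume y: "y \<in> S"
      show "F k y - real k * dist x y \<le> c"
      proof (cases "dist x y < e")
        case True
        then have "f y < ereal c" using e(2)[of y] by (simp add: dist_commute)
        moreover have "- real k \<le> c" using that n1 by simp
        ultimately have "ereal (F k y) \<le> ereal c" unfolding F[OF y] by simp
        then have "F k y \<le> c" by simp
        moreover have "0 \<le> real k * dist x y" by simp
        ultimately show ?thesis by linarith
      next
        case False
        have "M - c \<le> real n2 * e" using n2 e(1) by (simp add: field_simps)
        also have "\<dots> \<le> real k * dist x y" using that False e(1) by (intro mult_mono) auto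
        finally show ?thesis using FM[OF y, of k] by linarith
      qed
    qed (use x in auto)
    then have "\<forall>\<^sub>F k in sequentially. g k x \<le> c"
      using eventually_sequentially by blast
    then show "\<forall>\<^sub>F k in sequentially. ereal (g k x) < a"
      by eventually_elim (use c(2) in \<open>meson ereal_less_eq(3) le_less_trans\<close>)
  qed
  have "f x \<le> ereal (g k x)" if "x \<in> S" for k x
    using Ff[OF that, of k] gF[OF that, of k] by (meson ereal_less_eq(3) order_trans)
  then show thesis using that[OF cont _ gM lim] by blast
qed

text \<open>
  Continuous majorants of \<open>u\<close> on the circle are approximated by harmonic polynomials, which majorize \<open>u\<close> at the
  centre by the maximum principle; the limit of the majorants gives the mean of \<open>u\<close>, by Fatou's lemma.
  With a complex factor \<open>\<beta>\<close> instead of a radius the statement covers rotated parametrizations of the circle,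
  as used for compositions with affine maps.
\<close>

lemma submean_all_circles:
  assumes sh: "\<And>z. subharmonic_at u z" and \<beta>: "\<beta> \<noteq> 0"
  shows "u a \<le> circle_mean (\<lambda>\<theta>. u (a + \<beta> * cis \<theta>))"
proof (cases "u a")
  case (real c)
  have usc: "usc_at u z" "u z < \<infinity>" for z using sh subharmonic_at_usc subharmonic_at_less_infty by blast+
  obtain M where M: "M \<ge> 0" "\<And>\<theta>. u (a + \<beta> * cis \<theta>) \<le> ereal M"
    "(\<lambda>\<theta>. u (a + \<beta> * cis \<theta>)) \<in> borel_measurable borel"
    using circle_measurable_bounded[of a \<beta> u] usc by metis
  define f where "f \<xi> = u (a + \<beta> * \<xi>)" for \<xi>
  have uscf: "usc_at f \<xi>" for \<xi>
    unfolding f_def by (rule usc_at_compose[where u=u]) (auto intro!: usc continuous_intros)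
  have fM: "f \<xi> \<le> ereal M" if "\<xi> \<in> sphere 0 1" for \<xi>
  proof -
    have "\<xi> = cis (Arg \<xi>)" using that rcis_cmod_Arg[of \<xi>] by (simp add: rcis_def)
    then show ?thesis unfolding f_def using M(2)[of "Arg \<xi>"] by simp
  qed
  obtain g :: "nat \<Rightarrow> complex \<Rightarrow> real" where g: "\<And>k. continuous_on (sphere 0 1) (g k)"
    "\<And>k x. x \<in> sphere 0 1 \<Longrightarrow> f x \<le> ereal (g k x)" "\<And>k x. x \<in> sphere 0 1 \<Longrightarrow> g k x \<le> M"
    "\<And>x. x \<in> sphere 0 1 \<Longrightarrow> (\<lambda>k. ereal (g k x)) \<longlonglongrightarrow> f x"
    using usc_continuous_approximation[OF uscf fM M(1)] by blast
  have mean_ge: "ereal c \<le> circle_mean (\<lambda>\<theta>. ereal (g k (cis \<theta>))) + ereal (2 * e)" if e: "e > 0" for k e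
  proof -
    obtain p where p: "\<And>z. z \<in> sphere 0 1 \<Longrightarrow> \<bar>g k z - Re (poly p z)\<bar> < e"
      using harmonic_polynomial_approximation[OF g(1) e] by blast
    define G where "G z = - (poly p ((z - a) / \<beta>) + complex_of_real e)" for z
    have holG: "G holomorphic_on UNIV" unfolding G_def using \<beta> by (intro holomorphic_intros) auto
    define v where "v z = u z + ereal (Re (G z))" for z
    have shv: "subharmonic_at v z" for z
      unfolding v_def by (intro subharmonic_at_add sh subharmonic_at_Re[OF holG]) auto
    have "v a \<le> 0"
    proof (rule max_principle[of "cball a (cmod \<beta>)" "ball a (cmod \<beta>)"])
      fix z assume z: "z \<in> cball a (cmod \<beta>) - ball a (cmod \<beta>)"
      define \<xi> where "\<xi> = (z - a) / \<beta>"
      have \<xi>: "\<xi> \<in> sphere 0 1" using z \<beta> by (auto simp: \<xi>_def norm_divide dist_norm norm_minus_commute)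
      have "u z = f \<xi>" unfolding f_def \<xi>_def using \<beta> by simp
      also have "\<dots> \<le> ereal (g k \<xi>)" by (rule g(2)[OF \<xi>])
      also have "\<dots> \<le> ereal (- Re (G z))" using p[OF \<xi>] unfolding G_def \<xi>_def[symmetric] by simp
      finally have "u z \<le> ereal (- Re (G z))" .
      then show "v z \<le> 0" unfolding v_def by (cases "u z") auto
    qed (use shv subharmonic_at_usc subharmonic_at_less_infty in auto)
    then have 1: "c \<le> Re (poly p 0) + e" unfolding v_def G_def real by simp
    have "circle_mean (\<lambda>\<theta>. ereal (Re ((\<lambda>z. poly p z - complex_of_real e) (0 + 1 * cis \<theta>)))) = ereal (Re (poly p 0 - complex_of_real e))"
      by (rule circle_mean_Re[of _ UNIV]) (auto intro!: holomorphic_intros)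
    then have "ereal (Re (poly p 0) - e) = circle_mean (\<lambda>\<theta>. ereal (Re (poly p (cis \<theta>)) - e))" by simp
    also have "\<dots> \<le> circle_mean (\<lambda>\<theta>. ereal (g k (cis \<theta>)))"
    proof (rule circle_mean_mono)
      fix \<theta> have "cis \<theta> \<in> sphere 0 1" by simp
      then show "ereal (Re (poly p (cis \<theta>)) - e) \<le> ereal (g k (cis \<theta>))" using p[of "cis \<theta>"] by simp
    qed
    finally have "ereal (Re (poly p 0) - e) + ereal (2 * e) \<le> circle_mean (\<lambda>\<theta>. ereal (g k (cis \<theta>))) + ereal (2 * e)"
      by (rule add_right_mono)
    moreover have "ereal c \<le> ereal (Re (poly p 0) - e) + ereal (2 * e)" using 1 by simp
    ultimately show ?thesis by (rule order_trans[rotated])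
  qed
  have mean_g: "ereal c \<le> circle_mean (\<lambda>\<theta>. ereal (g k (cis \<theta>)))" for k
    by (rule ereal_le_epsilon2) (use mean_ge[of "_ / 2" k] in auto)
  have measg: "(\<lambda>\<theta>. ereal (g k (cis \<theta>))) \<in> borel_measurable borel" for k
  proof -
    have "continuous_on UNIV (\<lambda>\<theta>. g k (cis \<theta>))"
      unfolding cis_conv_exp
      by (rule continuous_on_compose2[OF g(1)]) (auto intro!: continuous_intros)
    then have "(\<lambda>\<theta>. g k (cis \<theta>)) \<in> borel_measurable borel" by (rule borel_measurable_continuous_onI)
    then show ?thesis by simp
  qed
  define J where "J k = (\<integral>\<^sup>+\<theta>\<in>{0..2*pi}. e2ennreal (ereal M - ereal (g k (cis \<theta>))) \<partial>lborel)" for k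
  define I where "I = (\<integral>\<^sup>+\<theta>\<in>{0..2*pi}. e2ennreal (ereal M - f (cis \<theta>)) \<partial>lborel)"
  have J: "J k \<le> ennreal (2 * pi * (M - c))" for k
  proof -
    have "circle_mean (\<lambda>\<theta>. ereal (g k (cis \<theta>))) = ereal M - enn2ereal (J k) / ereal (2 * pi)"
      unfolding J_def by (rule circle_mean_bounded_above[OF measg _ M(1)]) (use g(3) in auto)
    then have "ereal c \<le> ereal M - enn2ereal (J k) / ereal (2 * pi)" using mean_g[of k] by simp
    then show ?thesis
      by (cases "J k") (auto simp: field_simps pi_gt_zero intro!: ennreal_leI)
  qed
  have lim: "(\<lambda>k. e2ennreal (ereal M - ereal (g k (cis \<theta>))) * indicator {0..2*pi} \<theta>) \<longlonglongrightarrow> e2ennreal (ereal M - f (cis \<theta>)) * indicator {0..2*pi} \<theta>" for \<theta>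
  proof -
    have "(\<lambda>k. ereal (g k (cis \<theta>))) \<longlonglongrightarrow> f (cis \<theta>)" by (rule g(4)) simp
    then have "(\<lambda>k. - ereal (g k (cis \<theta>))) \<longlonglongrightarrow> - f (cis \<theta>)" by (rule tendsto_uminus_ereal)
    then have "(\<lambda>k. ereal M + - ereal (g k (cis \<theta>))) \<longlonglongrightarrow> ereal M + - f (cis \<theta>)"
      by (intro tendsto_add_ereal_general tendsto_const) auto
    then have "(\<lambda>k. e2ennreal (ereal M - ereal (g k (cis \<theta>)))) \<longlonglongrightarrow> e2ennreal (ereal M - f (cis \<theta>))"
      unfolding minus_ereal_def by (rule tendsto_e2ennrealI)
    then show ?thesis by (cases "\<theta> \<in> {0..2*pi}") auto
  qed
  have "I = (\<integral>\<^sup>+\<theta>. liminf (\<lambda>k. e2ennreal (ereal M - ereal (g k (cis \<theta>))) * indicator {0..2*pi} \<theta>) \<partial>lborel)"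
    unfolding I_def using lim_imp_Liminf[OF _ lim] by (intro nn_integral_cong) auto
  also have "\<dots> \<le> liminf J"
    unfolding J_def by (rule nn_integral_liminf) (use measg in auto)
  also have "\<dots> \<le> ennreal (2 * pi * (M - c))"
    by (rule Liminf_le) (use J in auto)
  finally have I: "I \<le> ennreal (2 * pi * (M - c))" .
  have "f 0 = ereal c" using real by (simp add: f_def)
  have "c \<le> M"
  proof -
    have "ereal c \<le> circle_mean (\<lambda>\<theta>. ereal (g 0 (cis \<theta>)))" by (rule mean_g)
    also have "\<dots> \<le> circle_mean (\<lambda>\<theta>. ereal M)" using g(3) by (intro circle_mean_mono) auto
    finally show ?thesis by (simp add: circle_mean_const)
  qed
  have "circle_mean (\<lambda>\<theta>. u (a + \<beta> * cis \<theta>)) = ereal M - enn2ereal I / ereal (2 * pi)"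
    unfolding I_def f_def by (rule circle_mean_bounded_above[OF M(3,2,1)])
  moreover have "ereal c \<le> ereal M - enn2ereal I / ereal (2 * pi)"
  proof (cases I)
    case (real i)
    then have "i \<le> 2 * pi * (M - c)" using I \<open>c \<le> M\<close> by (simp add: ennreal_le_iff)
    then show ?thesis using real by (simp add: field_simps)
  qed (use I in \<open>auto simp: top_unique\<close>)
  ultimately show ?thesis using real by simp
next
  case PInf
  then show ?thesis using sh subharmonic_at_less_infty by force
qed auto

theorem subharmonic_iff_local: "subharmonic u \<longleftrightarrow> (\<forall>z. subharmonic_at u z)"
proof
  assume u: "subharmonic u"
  show "\<forall>z. subharmonic_at u z"
    unfolding subharmonic_at_def using u
    by (auto simp: subharmonic_def usc_iff_usc_at intro!: always_eventually exI[of _ 1])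
next
  assume u: "\<forall>z. subharmonic_at u z"
  then show "subharmonic u"
    unfolding subharmonic_def usc_iff_usc_at
    using subharmonic_at_usc subharmonic_at_less_infty submean_all_circles[of u "complex_of_real _"] by auto
qed

lemma subharmonic_affine:
  assumes "subharmonic u"
  shows "subharmonic (\<lambda>t. u (\<alpha> + t * \<gamma>))"
proof -
  have sh: "subharmonic_at u z" for z using assms subharmonic_iff_local by blast
  have "usc_at (\<lambda>t. u (\<alpha> + t * \<gamma>)) z" for z
    by (rule usc_at_compose[where u=u]) (auto intro!: subharmonic_at_usc[OF sh] continuous_intros)
  moreover have "u (\<alpha> + a * \<gamma>) \<le> circle_mean (\<lambda>\<theta>. u (\<alpha> + (a + complex_of_real r * cis \<theta>) * \<gamma>))"
    if "r > 0" for a r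
  proof (cases "\<gamma> = 0")
    case True
    then show ?thesis
      using subharmonic_at_less_infty[OF sh, of \<alpha>] by (cases "u \<alpha>") (auto simp: circle_mean_const)
  next
    case False
    have "u (\<alpha> + a * \<gamma>) \<le> circle_mean (\<lambda>\<theta>. u (\<alpha> + a * \<gamma> + (complex_of_real r * \<gamma>) * cis \<theta>))"
      by (rule submean_all_circles[OF sh]) (use False that in auto)
    then show ?thesis by (simp add: algebra_simps)
  qed
  ultimately show ?thesis
    unfolding subharmonic_def usc_iff_usc_at using subharmonic_at_less_infty[OF sh] by auto
qed

section \<open>Logarithms and growth estimates\<close>

lemma log_plus_eq: "log_plus t = max (ln t) 0"
  by (simp add: log_plus_def)

lemma log_plus_nonneg: "log_plus t \<ge> 0"
  by (simp add: log_plus_eq)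

lemma ln_le_log_plus: "ln t \<le> log_plus t"
  by (simp add: log_plus_eq)

lemma log_plus_mono: "0 \<le> s \<Longrightarrow> s \<le> t \<Longrightarrow> log_plus s \<le> log_plus t"
  by (cases "s = 0") (auto simp: log_plus_eq max_def ln_mono)

lemma log_plus_le_ln: "0 \<le> s \<Longrightarrow> s \<le> t \<Longrightarrow> 1 \<le> t \<Longrightarrow> log_plus s \<le> ln t"
  using log_plus_mono[of s t] by (simp add: log_plus_eq)

text \<open>
  The logarithmic potential of a point mass at \<open>x\<close>, with its true value at the pole.
\<close>

definition log_dist :: "complex \<Rightarrow> complex \<Rightarrow> ereal" where
  "log_dist x z = (if z = x then -\<infinity> else ereal (ln (cmod (z - x))))"

lemma subharmonic_at_ln_dist:
  assumes "z \<noteq> x"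
  shows "subharmonic_at (\<lambda>w. ereal (c * ln (cmod (w - x)))) z"
proof -
  define g where "g w = complex_of_real c * (Ln ((w - x) / (z - x)) + complex_of_real (ln (cmod (z - x))))" for w
  have quot: "(w - x) / (z - x) \<notin> \<real>\<^sub>\<le>\<^sub>0" if "w \<in> ball z (cmod (z - x))" for w
  proof
    assume neg: "(w - x) / (z - x) \<in> \<real>\<^sub>\<le>\<^sub>0"
    have "cmod ((w - x) / (z - x) - 1) = cmod (w - z) / cmod (z - x)"
      using assms by (simp add: norm_divide[symmetric] diff_divide_distrib[symmetric] divide_simps)
    also have "\<dots> < 1" using that assms by (simp add: dist_norm norm_minus_commute)
    finally have "cmod ((w - x) / (z - x) - 1) < 1" .
    moreover have "\<bar>Re ((w - x) / (z - x) - 1)\<bar> \<le> cmod ((w - x) / (z - x) - 1)"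
      by (rule abs_Re_le_cmod)
    moreover have "Re ((w - x) / (z - x)) \<le> 0" using neg by (simp add: complex_nonpos_Reals_iff)
    ultimately show False by simp
  qed
  have "g holomorphic_on ball z (cmod (z - x))"
    unfolding g_def using quot assms by (intro holomorphic_intros) auto
  then have "subharmonic_at (\<lambda>w. ereal (Re (g w))) z"
    by (rule subharmonic_at_Re) (use assms in auto)
  moreover have "\<forall>\<^sub>F w in nhds z. ereal (Re (g w)) = ereal (c * ln (cmod (w - x)))"
  proof (rule eventually_mono)
    show "\<forall>\<^sub>F w in nhds z. w \<in> ball z (cmod (z - x))"
      using assms by (intro eventually_nhds_in_open) auto
    fix w assume w: "w \<in> ball z (cmod (z - x))"
    have "w \<noteq> x" using w by (auto simp: dist_norm)
    then have "Re (Ln ((w - x) / (z - x))) = ln (cmod (w - x)) - ln (cmod (z - x))"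
      using assms by (simp add: Re_Ln norm_divide ln_div)
    then show "ereal (Re (g w)) = ereal (c * ln (cmod (w - x)))"
      unfolding g_def by simp
  qed
  ultimately show ?thesis by (rule subharmonic_at_cong[rotated])
qed

lemma subharmonic_at_log_dist: "subharmonic_at (log_dist x) z"
proof (cases "z = x")
  case False
  have "\<forall>\<^sub>F w in nhds z. w \<in> - {x}" using False by (intro eventually_nhds_in_open) auto
  then have "\<forall>\<^sub>F w in nhds z. ereal (1 * ln (cmod (w - x))) = log_dist x w"
    by eventually_elim (simp add: log_dist_def)
  then show ?thesis using subharmonic_at_ln_dist[OF False, of 1] by (rule subharmonic_at_cong)
next
  case True
  have "usc_at (log_dist x) x"
    unfolding usc_at_def
  proof (intro allI impI)
    fix c assume "log_dist x x < c"
    then obtain c' :: real where c': "ereal c' < c" using ereal_dense2 by blast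
    have "\<forall>\<^sub>F w in nhds x. w \<in> ball x (exp c')" by (intro eventually_nhds_in_open) auto
    then show "\<forall>\<^sub>F w in nhds x. log_dist x w < c"
    proof eventually_elim
      case (elim w)
      show ?case
      proof (cases "w = x")
        case False
        have "cmod (w - x) < exp c'" using elim by (simp add: dist_norm norm_minus_commute)
        with False have "ln (cmod (w - x)) < ln (exp c')" by (subst ln_less_cancel_iff) auto
        then show ?thesis using False c' by (simp add: log_dist_def) (meson ereal_less_eq(3) le_less_trans less_imp_le)
      qed (use \<open>log_dist x x < c\<close> in auto)
    qed
  qed
  moreover have "usc_at (log_dist x) w" if "w \<noteq> x" for w
  proof -
    have "\<forall>\<^sub>F y in nhds w. y \<in> - {x}" using that by (intro eventually_nhds_in_open) auto
    then have "\<forall>\<^sub>F y in nhds w. ereal (1 * ln (cmod (y - x))) = log_dist x y"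
      by eventually_elim (simp add: log_dist_def)
    then show ?thesis using subharmonic_at_usc[OF subharmonic_at_ln_dist[OF that, of 1]] by (subst (asm) usc_at_cong) auto
  qed
  ultimately have "usc_at (log_dist x) w" for w by (cases "w = x") simp_all
  then show ?thesis
    unfolding subharmonic_at_def True by (auto simp: log_dist_def intro!: always_eventually exI[of _ 1])
qed

text \<open>
  Outside the disc compare \<open>u\<close> with \<open>(1 + \<epsilon>) ln (|z - p| / r)\<close>, which dominates the growth of \<open>u\<close> on
  large circles for each \<open>\<epsilon> > 0\<close>.
\<close>

lemma bernstein_walsh_disc:
  assumes u: "subharmonic u" "\<And>z. u z \<le> ereal (log_plus (cmod z) + C)"
    and le: "\<And>z. z \<in> cball p r \<Longrightarrow> u z \<le> 0" and r: "r > 0" and z: "cmod (z - p) \<ge> r"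
  shows "u z \<le> ereal (ln (cmod (z - p) / r))"
proof -
  have sh: "subharmonic_at u w" for w using u(1) subharmonic_iff_local by blast
  define L where "L = ln (cmod (z - p) / r)"
  have "L \<ge> 0" using z r by (simp add: L_def)
  have *: "u z \<le> ereal ((1 + \<epsilon>) * L)" if \<epsilon>: "\<epsilon> > 0" for \<epsilon>
  proof -
    \<comment> \<open>A radius \<open>T\<close> with \<open>K \<le> \<epsilon> ln T\<close> makes the comparison function dominate \<open>u\<close> on the outer circle.\<close>
    define K where "K = ln (cmod p + 2) + C + (1 + \<epsilon>) * ln r"
    define T where "T = max (max 1 r) (max (exp (K / \<epsilon>)) (cmod (z - p)))"
    have T: "T \<ge> 1" "T \<ge> r" "T \<ge> exp (K / \<epsilon>)" "cmod (z - p) \<le> T" by (auto simp: T_def)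
    have "exp (K / \<epsilon>) > 0" by simp
    then have "K / \<epsilon> \<le> ln T" using T by (subst ln_ge_iff) auto
    then have K: "K \<le> \<epsilon> * ln T" using \<epsilon> by (simp add: field_simps)
    define f where "f w = u w + ereal (- (1 + \<epsilon>) * ln (cmod (w - p)) + (1 + \<epsilon>) * ln r)" for w
    have shf: "subharmonic_at f w" if "w \<noteq> p" for w
      using subharmonic_at_add[OF sh subharmonic_at_add_const[OF subharmonic_at_ln_dist[OF that, of "- (1 + \<epsilon>)"], of "(1 + \<epsilon>) * ln r"]]
      unfolding f_def by simp
    define S where "S = cball p T - ball p r"
    have "f z \<le> 0"
    proof (rule max_principle[of S "ball p T - cball p r"])
      show "compact S" unfolding S_def by (intro compact_diff) auto
      show "open (ball p T - cball p r)" by (intro open_Diff) auto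
      show "ball p T - cball p r \<subseteq> S" unfolding S_def by auto
      show "z \<in> S" unfolding S_def using z T by (auto simp: dist_norm norm_minus_commute)
    next
      fix w assume "w \<in> S"
      then have "w \<noteq> p" using r unfolding S_def by auto
      then show "usc_at f w" "f w < \<infinity>" using shf subharmonic_at_usc subharmonic_at_less_infty by blast+
    next
      fix w assume "w \<in> ball p T - cball p r"
      then have "w \<noteq> p" using r by auto
      then show "subharmonic_at f w" by (rule shf)
    next
      fix w assume w: "w \<in> S - (ball p T - cball p r)"
      then consider "cmod (w - p) = r" | "cmod (w - p) = T"
        unfolding S_def by (force simp: dist_norm norm_minus_commute)
      then show "f w \<le> 0"
      proof cases
        case 1
        then have "u w \<le> 0" by (intro le) (simp add: dist_norm norm_minus_commute)
        moreover have "- (1 + \<epsilon>) * ln r + (1 + \<epsilon>) * ln r = 0" by (simp add: algebra_simps)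
        ultimately show ?thesis unfolding f_def 1 by (metis add.right_neutral zero_ereal_def)
      next
        case 2
        have "cmod w \<le> cmod p + T" using norm_triangle_ineq[of "w - p" p] 2 by simp
        also have "\<dots> \<le> T * (cmod p + 2)" using T(1) mult_right_mono[of 1 T "cmod p"] by (simp add: algebra_simps)
        finally have "log_plus (cmod w) \<le> ln (T * (cmod p + 2))"
          by (rule log_plus_le_ln[rotated]) (use T(1) mult_mono[of 1 T 1 "cmod p + 2"] in auto)
        also have "\<dots> = ln T + ln (cmod p + 2)"
          using T(1) by (intro ln_mult_pos) (auto intro: add_nonneg_pos)
        finally have "log_plus (cmod w) + C \<le> (1 + \<epsilon>) * ln T - (1 + \<epsilon>) * ln r"
          using K unfolding K_def by (simp add: algebra_simps)
        then have "u w \<le> ereal ((1 + \<epsilon>) * ln T - (1 + \<epsilon>) * ln r)"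
          using u(2)[of w] by (meson ereal_less_eq(3) order_trans)
        then show ?thesis unfolding f_def 2 by (cases "u w") (auto simp: algebra_simps)
      qed
    qed
    moreover have "ln (cmod (z - p)) = L + ln r"
      unfolding L_def using z r by (subst ln_div) auto
    moreover have "- (1 + \<epsilon>) * (L + ln r) + (1 + \<epsilon>) * ln r = - ((1 + \<epsilon>) * L)" by (simp add: algebra_simps)
    ultimately show ?thesis unfolding f_def by (cases "u z") auto
  qed
  have "u z \<le> ereal L + ereal e" if "e > 0" for e
  proof -
    have "u z \<le> ereal ((1 + e / (L + 1)) * L)" using that \<open>L \<ge> 0\<close> by (intro *) simp
    also have "(1 + e / (L + 1)) * L \<le> L + e"
      using that \<open>L \<ge> 0\<close> by (simp add: field_simps)
    finally show ?thesis by simp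
  qed
  then show ?thesis unfolding L_def[symmetric] using ereal_le_epsilon2 by blast
qed

text \<open>
  The function \<open>Re \<zeta> + 2 Im \<surd>\<zeta>\<close> is harmonic off the slit \<open>[0, \<infinity>)\<close>, nonnegative on it, and at least 1 on the
  unit circle; it bounds the harmonic measure of the unit circle in the slit disc.
\<close>

lemma slit_estimate:
  assumes u: "subharmonic u"
    and slit: "\<And>t. t \<in> {0..1} \<Longrightarrow> u (x + complex_of_real t * e) \<le> 0"
    and bd: "\<And>z. z \<in> cball x (cmod e) \<Longrightarrow> u z \<le> ereal M" and "M \<ge> 0"
    and \<zeta>: "cmod \<zeta> \<le> 1"
  shows "u (x + \<zeta> * e) \<le> ereal (3 * M * sqrt (cmod \<zeta>))"
proof -
  define v where "v \<zeta> = u (x + \<zeta> * e)" for \<zeta>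
  have "subharmonic v" unfolding v_def using u by (rule subharmonic_affine)
  then have shv: "subharmonic_at v z" for z using subharmonic_iff_local by blast
  define h where "h \<zeta> = Re \<zeta> + 2 * sqrt ((cmod \<zeta> - Re \<zeta>) / 2)" for \<zeta>
  have conth: "isCont h z" for z
  proof -
    have "continuous_on UNIV h" unfolding h_def by (intro continuous_intros) auto
    then show ?thesis by (simp add: continuous_on_eq_continuous_at)
  qed
  have shh: "subharmonic_at (\<lambda>w. ereal (- (M * h w))) z" if "z \<notin> \<real>\<^sub>\<ge>\<^sub>0" for z
  proof -
    have "subharmonic_at (\<lambda>w. ereal (Re (- (complex_of_real M * (w + 2 * csqrt (- w)))))) z"
    proof (rule subharmonic_at_Re)
      have "- w \<notin> \<real>\<^sub>\<le>\<^sub>0" if "w \<in> - \<real>\<^sub>\<ge>\<^sub>0" for w :: complex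
        using that by (auto simp: complex_nonpos_Reals_iff complex_nonneg_Reals_iff)
      then show "(\<lambda>w. - (complex_of_real M * (w + 2 * csqrt (- w)))) holomorphic_on - \<real>\<^sub>\<ge>\<^sub>0"
        by (intro holomorphic_intros) auto
      show "open (- \<real>\<^sub>\<ge>\<^sub>0 :: complex set)" using closed_nonneg_Reals_complex by (simp add: open_Compl)
    qed (use that in auto)
    then show ?thesis by (simp add: h_def)
  qed
  define f where "f z = v z + ereal (- (M * h z))" for z
  have uscf: "usc_at f z" "f z < \<infinity>" for z
  proof -
    have "usc_at (\<lambda>w. ereal (- (M * h w))) z"
      by (intro usc_at_real isCont_minus isCont_mult conth continuous_const)
    then show "usc_at f z" unfolding f_def
      using subharmonic_at_usc[OF shv] subharmonic_at_less_infty[OF shv] by (intro usc_at_add) auto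
    show "f z < \<infinity>" unfolding f_def using subharmonic_at_less_infty[OF shv, of z] by (cases "v z") auto
  qed
  have "f \<zeta> \<le> 0"
  proof (rule max_principle[of "cball 0 1" "ball 0 1 - \<real>\<^sub>\<ge>\<^sub>0"])
    show "open (ball (0::complex) 1 - \<real>\<^sub>\<ge>\<^sub>0)" using closed_nonneg_Reals_complex by (intro open_Diff) auto
    show "subharmonic_at f z" if "z \<in> ball 0 1 - \<real>\<^sub>\<ge>\<^sub>0" for z
      unfolding f_def using that by (intro subharmonic_at_add shv shh) auto
    fix z :: complex assume z: "z \<in> cball 0 1 - (ball 0 1 - \<real>\<^sub>\<ge>\<^sub>0)"
    show "f z \<le> 0"
    proof (cases "z \<in> \<real>\<^sub>\<ge>\<^sub>0")
      case True
      then obtain t where t: "z = complex_of_real t" "t \<ge> 0" by (auto elim: nonneg_Reals_cases)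
      then have "t \<le> 1" using z by simp
      have "v z \<le> 0" unfolding v_def t(1) using t(2) \<open>t \<le> 1\<close> by (intro slit) auto
      moreover have "M * h z \<ge> 0" using t \<open>M \<ge> 0\<close> by (simp add: h_def)
      ultimately show ?thesis unfolding f_def by (cases "v z") auto
    next
      case False
      then have n: "cmod z = 1" using z by auto
      define s where "s = sqrt ((1 - Re z) / 2)"
      have "Re z \<le> 1" "- 1 \<le> Re z" using n abs_Re_le_cmod[of z] by auto
      then have s: "0 \<le> s" "s \<le> 1" "s\<^sup>2 = (1 - Re z) / 2" by (auto simp: s_def)
      have "s * s \<le> s" using s(1,2) by (simp add: mult_left_le)
      then have "1 \<le> h z" unfolding h_def n s_def[symmetric] using s(3) by (simp add: power2_eq_square)
      then have "M \<le> M * h z" using \<open>M \<ge> 0\<close> by (simp add: mult_le_cancel_left1)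
      moreover have "v z \<le> ereal M" unfolding v_def using n by (intro bd) (simp add: dist_norm norm_mult)
      ultimately show ?thesis unfolding f_def by (cases "v z") auto
    qed
  qed (use uscf \<zeta> in auto)
  then have "v \<zeta> \<le> ereal (M * h \<zeta>)" unfolding f_def by (cases "v \<zeta>") auto
  also have "M * h \<zeta> \<le> M * (3 * sqrt (cmod \<zeta>))"
  proof (intro mult_left_mono \<open>M \<ge> 0\<close>)
    have "cmod \<zeta> = sqrt (cmod \<zeta>) * sqrt (cmod \<zeta>)" by simp
    also have "\<dots> \<le> sqrt (cmod \<zeta>) * 1" using \<zeta> by (intro mult_left_mono) auto
    finally have "Re \<zeta> \<le> sqrt (cmod \<zeta>)" using complex_Re_le_cmod[of \<zeta>] by linarith
    moreover have "sqrt ((cmod \<zeta> - Re \<zeta>) / 2) \<le> sqrt (cmod \<zeta>)"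
      using abs_Re_le_cmod[of \<zeta>] by (intro real_sqrt_le_mono) (simp add: abs_le_iff)
    ultimately show "h \<zeta> \<le> 3 * sqrt (cmod \<zeta>)" unfolding h_def by linarith
  qed
  finally show ?thesis unfolding v_def by (simp add: mult_ac)
qed

section \<open>Planar extremal functions\<close>

definition planar_class :: "complex set \<Rightarrow> (complex \<Rightarrow> ereal) set" where
  "planar_class A = {s. subharmonic s \<and> (\<exists>z. s z \<noteq> -\<infinity>) \<and>
     (\<exists>C. \<forall>z. s z \<le> ereal (log_plus (cmod z) + C)) \<and> (\<forall>z\<in>A. s z \<le> 0)}"

definition planar_extremal :: "complex set \<Rightarrow> complex \<Rightarrow> ereal" where
  "planar_extremal A z = (SUP s\<in>planar_class A. s z)"

lemma planar_classI:
  assumes "\<And>z. subharmonic_at s z" "s z0 \<noteq> -\<infinity>" "\<And>z. s z \<le> ereal (log_plus (cmod z) + C)" "\<And>z. z \<in> A \<Longrightarrow> s z \<le> 0"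
  shows "s \<in> planar_class A"
  using assms unfolding planar_class_def subharmonic_iff_local by blast

lemma planar_class_subharmonic_at: "s \<in> planar_class A \<Longrightarrow> subharmonic_at s z"
  and planar_class_le: "s \<in> planar_class A \<Longrightarrow> z \<in> A \<Longrightarrow> s z \<le> 0"
  unfolding planar_class_def subharmonic_iff_local by auto

lemma planar_extremal_upper: "s \<in> planar_class A \<Longrightarrow> s z \<le> planar_extremal A z"
  unfolding planar_extremal_def by (rule SUP_upper)

lemma planar_extremal_least: "(\<And>s. s \<in> planar_class A \<Longrightarrow> s z \<le> c) \<Longrightarrow> planar_extremal A z \<le> c"
  unfolding planar_extremal_def by (rule SUP_least)

lemma planar_extremal_antimono: "A \<subseteq> B \<Longrightarrow> planar_extremal B z \<le> planar_extremal A z"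
  unfolding planar_extremal_def planar_class_def by (rule SUP_subset_mono) auto

lemma planar_class_max0:
  assumes "s \<in> planar_class A"
  shows "(\<lambda>z. max (s z) 0) \<in> planar_class A"
proof -
  obtain C where C: "\<And>z. s z \<le> ereal (log_plus (cmod z) + C)"
    using assms unfolding planar_class_def by blast
  show ?thesis
  proof (rule planar_classI[where C="max C 0"])
    show "subharmonic_at (\<lambda>z. max (s z) 0) z" for z
      using planar_class_subharmonic_at[OF assms] subharmonic_at_const[of 0] by (intro subharmonic_at_max) (auto simp: zero_ereal_def)
    show "max (s z) 0 \<le> ereal (log_plus (cmod z) + max C 0)" for z
    proof -
      have "s z \<le> ereal (log_plus (cmod z) + max C 0)"
        using C[of z] by (rule order_trans) simp
      moreover have "0 \<le> ereal (log_plus (cmod z) + max C 0)" using log_plus_nonneg[of "cmod z"] by simp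
      ultimately show ?thesis by simp
    qed
    show "max (s 0) 0 \<noteq> - \<infinity>" by (auto simp: max_def)
    show "max (s z) 0 \<le> 0" if "z \<in> A" for z using planar_class_le[OF assms that] by simp
  qed
qed

lemma zero_planar_class: "(\<lambda>_. 0) \<in> planar_class A"
  by (rule planar_classI[where C=0]) (use subharmonic_at_const[of 0] log_plus_nonneg in \<open>auto simp: zero_ereal_def\<close>)

lemma planar_extremal_nonneg: "0 \<le> planar_extremal A z"
  using planar_extremal_upper[OF zero_planar_class] .

lemma planar_class_le_disc:
  assumes "s \<in> planar_class A" "cball p r \<subseteq> A" "r > 0" "cmod (z - p) \<ge> r"
  shows "s z \<le> ereal (ln (cmod (z - p) / r))"
proof -
  obtain C where "\<And>z. s z \<le> ereal (log_plus (cmod z) + C)"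
    using assms(1) unfolding planar_class_def by blast
  then show ?thesis
    using assms by (intro bernstein_walsh_disc[of s C]) (auto simp: planar_class_def)
qed

lemma planar_class_le_log_plus:
  assumes "s \<in> planar_class A" "cball 0 1 \<subseteq> A"
  shows "s z \<le> ereal (log_plus (cmod z))"
proof (cases "cmod z \<le> 1")
  case True
  then have "s z \<le> 0" using assms by (intro planar_class_le) auto
  also have "0 \<le> ereal (log_plus (cmod z))" using log_plus_nonneg by simp
  finally show ?thesis .
next
  case False
  then have "s z \<le> ereal (ln (cmod (z - 0) / 1))"
    by (intro planar_class_le_disc[OF assms]) auto
  also have "\<dots> \<le> ereal (log_plus (cmod z))" using ln_le_log_plus by simp
  finally show ?thesis .
qed

lemma planar_extremal_le_log_plus: "cball 0 1 \<subseteq> A \<Longrightarrow> planar_extremal A z \<le> ereal (log_plus (cmod z))"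
  using planar_class_le_log_plus by (intro planar_extremal_least) auto

lemma log_plus_planar_class: "(\<lambda>z. max (log_dist 0 z) 0) \<in> planar_class (cball 0 1)"
proof (rule planar_class_max0, rule planar_classI[where C=0])
  show "log_dist 0 1 \<noteq> - \<infinity>" by (simp add: log_dist_def)
  show "subharmonic_at (log_dist 0) z" for z by (rule subharmonic_at_log_dist)
qed (auto simp: log_dist_def ln_le_log_plus)

lemma extremal_eq_planar_extremal:
  "extremal 1 {z :: complex^1. z $ 1 \<in> A} (\<lambda>_. 0) z = planar_extremal A (z $ 1)"
proof (rule antisym)
  show "extremal 1 {z :: complex^1. z $ 1 \<in> A} (\<lambda>_. 0) z \<le> planar_extremal A (z $ 1)"
    unfolding extremal_def
  proof (rule SUP_least)
    fix u :: "complex^1 \<Rightarrow> ereal"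
    assume "u \<in> {u \<in> lelong 1. \<forall>x\<in>{z. z $ 1 \<in> A}. u x \<le> ereal 0}"
    then have psh: "psh u" and A: "\<And>x. x $ 1 \<in> A \<Longrightarrow> u x \<le> 0"
      and "\<exists>C. \<forall>z. u z \<le> ereal (1 * log_plus (norm z) + C)"
      unfolding lelong_def by (auto simp: zero_ereal_def)
    then obtain C where C: "\<And>z. u z \<le> ereal (log_plus (norm z) + C)" by auto
    define s where "s t = u (0 + t *s (\<chi> _. 1))" for t
    have s: "s (x $ 1) = u x" for x
    proof -
      have "0 + x $ 1 *s (\<chi> _. 1) = x" by (simp add: vec_eq_iff forall_1)
      then show ?thesis unfolding s_def by simp
    qed
    have nrm: "norm (t *s (\<chi> _. 1) :: complex^1) = cmod t" for t
      by (simp add: norm_vec_def L2_set_def)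
    have "subharmonic s" using psh unfolding psh_def s_def by blast
    moreover obtain x where "u x \<noteq> -\<infinity>" using psh unfolding psh_def by blast
    moreover have "s z \<le> ereal (log_plus (cmod z) + C)" for z
      unfolding s_def using C[of "0 + z *s (\<chi> _. 1)"] nrm[of z] by simp
    moreover have "s z \<le> 0" if "z \<in> A" for z
      unfolding s_def using that by (intro A) simp
    ultimately have "s \<in> planar_class A"
      unfolding subharmonic_iff_local using s[of x] by (intro planar_classI[of s "x $ 1"]) auto
    then show "u z \<le> planar_extremal A (z $ 1)" using planar_extremal_upper[of s A "z $ 1"] s by simp
  qed
next
  show "planar_extremal A (z $ 1) \<le> extremal 1 {z :: complex^1. z $ 1 \<in> A} (\<lambda>_. 0) z"
  proof (rule planar_extremal_least)
    fix s assume s: "s \<in> planar_class A"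
    define u where "u x = s (x $ 1)" for x :: "complex^1"
    have sub: "subharmonic s" using s unfolding planar_class_def by blast
    have nrm: "cmod (x $ 1) = norm x" for x :: "complex^1" by (simp add: norm_vec_def L2_set_def)
    have "psh u"
      unfolding psh_def
    proof (intro conjI allI)
      show "usc u" unfolding usc_iff_usc_at u_def
      proof
        fix x :: "complex^1"
        have "isCont (\<lambda>x :: complex^1. x $ 1) x" by (intro continuous_intros)
        then show "usc_at (\<lambda>x :: complex^1. s (x $ 1)) x"
          by (rule usc_at_compose[OF subharmonic_at_usc[OF planar_class_subharmonic_at[OF s]]])
      qed
      show "u z < \<infinity>" for z unfolding u_def using subharmonic_at_less_infty[OF planar_class_subharmonic_at[OF s]] by blast
      obtain z0 where "s z0 \<noteq> -\<infinity>" using s unfolding planar_class_def by blast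
      then show "\<exists>z. u z \<noteq> -\<infinity>" unfolding u_def by (intro exI[of _ "\<chi> _. z0"]) simp
      show "subharmonic (\<lambda>t. u (a + t *s c))" for a c
        unfolding u_def using subharmonic_affine[OF sub] by simp
    qed
    moreover obtain C where "\<And>z. s z \<le> ereal (log_plus (cmod z) + C)"
      using s unfolding planar_class_def by blast
    then have "u x \<le> ereal (1 * log_plus (norm x) + C)" for x
      unfolding u_def nrm[symmetric] by simp
    moreover have "u x \<le> ereal 0" if "x $ 1 \<in> A" for x :: "complex^1"
      unfolding u_def using planar_class_le[OF s that] by (simp add: zero_ereal_def)
    ultimately have "u \<in> {u \<in> lelong 1. \<forall>x\<in>{z. z $ 1 \<in> A}. u x \<le> ereal 0}"
      unfolding lelong_def by blast
    then have "u z \<le> extremal 1 {z. z $ 1 \<in> A} (\<lambda>_. 0) z"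
      unfolding extremal_def by (rule SUP_upper)
    then show "s (z $ 1) \<le> extremal 1 {z. z $ 1 \<in> A} (\<lambda>_. 0) z" unfolding u_def .
  qed
qed

lemma planar_extremal_reg_eq: "planar_extremal_reg A \<zeta> = Limsup (nhds \<zeta>) (planar_extremal A)"
proof -
  define g where "g = (\<lambda>\<zeta>. (\<chi> _. \<zeta>) :: complex^1)"
  have contg: "isCont g \<zeta>" for \<zeta>
    unfolding g_def isCont_def by (intro tendsto_vec_lambda) (rule tendsto_ident_at)
  have le1: "filtermap (\<lambda>z. z $ 1) (nhds (g \<zeta>)) \<le> nhds \<zeta>"
  proof -
    have "((\<lambda>z. z $ 1) \<longlongrightarrow> g \<zeta> $ 1) (nhds (g \<zeta>))" by (intro tendsto_intros) (simp add: filterlim_ident)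
    then show ?thesis by (simp add: filterlim_def g_def)
  qed
  have "(g \<longlongrightarrow> g \<zeta>) (nhds \<zeta>)" using contg by (simp add: isCont_def tendsto_at_iff_tendsto_nhds)
  then have "filtermap g (nhds \<zeta>) \<le> nhds (g \<zeta>)" by (simp add: filterlim_def)
  then have "filtermap (\<lambda>z. z $ 1) (filtermap g (nhds \<zeta>)) \<le> filtermap (\<lambda>z. z $ 1) (nhds (g \<zeta>))"
    by (rule filtermap_mono)
  then have le2: "nhds \<zeta> \<le> filtermap (\<lambda>z. z $ 1) (nhds (g \<zeta>))"
    by (simp add: filtermap_filtermap g_def)
  have "planar_extremal_reg A \<zeta> = Limsup (nhds (g \<zeta>)) (\<lambda>z. planar_extremal A (z $ 1))"
    unfolding planar_extremal_reg_def usc_reg_def g_def extremal_eq_planar_extremal ..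
  also have "\<dots> = Limsup (filtermap (\<lambda>z. z $ 1) (nhds (g \<zeta>))) (planar_extremal A)"
    by (rule Limsup_filtermap_eq[symmetric]) (simp add: inj_def vec_eq_iff forall_1)
  also have "filtermap (\<lambda>z. z $ 1) (nhds (g \<zeta>)) = nhds \<zeta>" using le1 le2 by (rule antisym)
  finally show ?thesis .
qed

section \<open>The discs and their truncations\<close>

abbreviation disc :: "nat \<Rightarrow> complex set" where
  "disc j \<equiv> cball (complex_of_real (p_seq j)) (rho_seq j)"

text \<open>
  The first \<open>m\<close> discs, cut off at the radius \<open>R\<close>; the point 2, at which they accumulate, is left out.
\<close>

definition trunc :: "nat \<Rightarrow> real \<Rightarrow> complex set" where
  "trunc m R = cball 0 1 \<union> (\<Union>j\<in>{1..m}. disc j \<inter> cball 0 R)"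

lemma rho_seq_pos: "rho_seq j > 0"
  by (simp add: rho_seq_def)

text \<open>
  A crude bound that keeps the discs disjoint from the point 2 and inside the disc of radius 3.
\<close>

lemma rho_seq_le: "16 * rho_seq j \<le> 1 / 2 ^ j"
proof -
  have "exp (16 * 2 ^ j :: real) \<ge> 1 + 16 * 2 ^ j" by (rule exp_ge_add_one_self)
  then have "exp (16 * 2 ^ j :: real) \<ge> 16 * 2 ^ j" by linarith
  then have "1 / exp (16 * 2 ^ j :: real) \<le> 1 / (16 * 2 ^ j)" by (intro divide_left_mono) auto
  then show ?thesis by (simp add: rho_seq_def exp_minus field_simps)
qed

lemma p_seq_bounds:
  assumes "j \<ge> 1"
  shows "p_seq j - rho_seq j > 2" "p_seq j \<le> 5/2" "rho_seq j \<le> 1/16"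
proof -
  have "(2::real) ^ 1 \<le> 2 ^ j" using assms by (intro power_increasing) auto
  then have j: "1 / 2 ^ j \<le> (1/2::real)" by (simp add: field_simps)
  then show "p_seq j \<le> 5/2" by (simp add: p_seq_def)
  define x :: real where "x = 1 / 2 ^ j"
  have "x > 0" "16 * rho_seq j \<le> x" using rho_seq_le[of j] by (auto simp: x_def)
  then show "p_seq j - rho_seq j > 2" unfolding p_seq_def x_def[symmetric] by linarith
  show "rho_seq j \<le> 1/16" using rho_seq_le[of j] j by linarith
qed

lemma disc_norm_le:
  assumes "j \<ge> 1" "z \<in> disc j"
  shows "cmod z \<le> 3"
proof -
  have "cmod (z - complex_of_real (p_seq j)) \<le> rho_seq j"
    using assms(2) by (simp add: dist_norm norm_minus_commute)
  moreover have "cmod (complex_of_real (p_seq j)) \<le> 5/2"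
    using p_seq_bounds[OF assms(1)] rho_seq_pos[of j] unfolding norm_of_real by simp
  ultimately show ?thesis
    using p_seq_bounds(3)[OF assms(1)] norm_triangle_ineq[of "z - complex_of_real (p_seq j)" "complex_of_real (p_seq j)"]
    by simp
qed

lemma trunc_norm_le: "z \<in> trunc m R \<Longrightarrow> cmod z \<le> 3"
  unfolding trunc_def using disc_norm_le by fastforce

lemma cball_subset_trunc: "cball 0 1 \<subseteq> trunc m R"
  by (auto simp: trunc_def)

lemma trunc_subset_E: "R \<ge> 1 \<Longrightarrow> trunc m R \<subseteq> E_set \<inter> cball 0 R"
  by (fastforce simp: trunc_def E_set_def)

lemma E_cases:
  assumes "z \<in> E_set" "cmod z \<le> R"
  obtains "z = 2" | "z \<in> trunc m R" | j where "j > m" "z \<in> disc j"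
proof -
  consider "z \<in> cball 0 1" | "z = 2" | j where "j \<ge> 1" "z \<in> disc j"
    using assms(1) unfolding E_set_def by blast
  then show thesis
  proof cases
    case 3
    show thesis
    proof (cases "j \<le> m")
      case True
      then have "z \<in> trunc m R" using 3 assms(2) unfolding trunc_def by auto
      then show thesis by (rule that(2))
    qed (use 3 that(3)[of j] in auto)
  qed (use that(1,2) cball_subset_trunc in blast)+
qed

lemma log_plus_le_2: "0 \<le> t \<Longrightarrow> t \<le> 4 \<Longrightarrow> log_plus t \<le> 2"
proof -
  assume t: "0 \<le> t" "t \<le> 4"
  have "ln (4::real) = ln (2 * 2)" by simp
  also have "\<dots> = ln 2 + ln 2" by (rule ln_mult_pos) auto
  also have "\<dots> \<le> 2" using ln_2_less_1 by linarith
  finally show "log_plus t \<le> 2" using log_plus_le_ln[OF t] by simp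
qed

section \<open>Penalty functions\<close>

lemma subharmonic_at_sum:
  assumes "finite A" "\<And>i. i \<in> A \<Longrightarrow> subharmonic_at (f i) z"
  shows "subharmonic_at (\<lambda>w. \<Sum>i\<in>A. f i w) z"
  using assms
proof induction
  case empty
  then show ?case using subharmonic_at_const[of 0] by (simp add: zero_ereal_def)
next
  case (insert i A)
  then show ?case by (simp add: subharmonic_at_add)
qed

text \<open>
  The factor 8 makes this nonpositive on the disc of radius 3, which contains \<open>E\<close>, for all poles there.
\<close>

definition scaled_log :: "complex \<Rightarrow> complex \<Rightarrow> ereal" where
  "scaled_log x z = log_dist x z + ereal (- ln 8)"

lemma scaled_log_eq: "z \<noteq> x \<Longrightarrow> scaled_log x z = ereal (ln (cmod (z - x) / 8))"
  by (simp add: scaled_log_def log_dist_def ln_div)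

lemma scaled_log_self [simp]: "scaled_log x x = -\<infinity>"
  by (simp add: scaled_log_def log_dist_def)

lemma subharmonic_at_scaled_log: "subharmonic_at (scaled_log x) z"
  using subharmonic_at_add_const[OF subharmonic_at_log_dist] unfolding scaled_log_def[abs_def] by simp

lemma scaled_log_le:
  assumes "cmod (z - x) \<le> r" "r > 0"
  shows "scaled_log x z \<le> ereal (ln (r / 8))"
  using assms by (cases "z = x") (auto simp: scaled_log_eq intro!: ln_mono divide_right_mono)

lemma scaled_log_growth:
  assumes "cmod x \<le> 3"
  shows "scaled_log x z \<le> ereal (log_plus (cmod z))"
proof (cases "z = x")
  case False
  have "cmod (z - x) \<le> cmod z + 3" using assms norm_triangle_ineq4[of z x] by simp
  then have "cmod (z - x) / 8 \<le> max 1 (cmod z)" by (simp add: max_def)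
  then have "ln (cmod (z - x) / 8) \<le> ln (max 1 (cmod z))"
    using False by (intro ln_mono) auto
  also have "\<dots> \<le> log_plus (cmod z)"
    using ln_le_log_plus log_plus_nonneg by (simp add: max_def)
  finally show ?thesis using False by (simp add: scaled_log_eq)
qed auto

lemma scaled_log_nonpos:
  assumes "cmod x \<le> 3" "cmod z \<le> 3"
  shows "scaled_log x z \<le> 0"
proof -
  have "cmod (z - x) \<le> 8" using assms norm_triangle_ineq4[of z x] by simp
  then show ?thesis using scaled_log_le[of z x 8] by (simp add: zero_ereal_def)
qed

lemma ereal_cmult_mono: "c \<ge> 0 \<Longrightarrow> x \<le> y \<Longrightarrow> ereal c * x \<le> ereal c * y"
  by (intro ereal_mult_left_mono) auto

text \<open>
  Some value on the circle comes close to the value at the centre. This replaces continuity of \<open>u\<close> when a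
  point near \<open>a\<close> with a large value is needed.
\<close>

lemma circle_mean_attained:
  assumes u: "\<And>z. subharmonic_at u z" and fin: "u a = ereal c" and "\<epsilon> > 0" "r > 0"
  obtains \<zeta> where "cmod (\<zeta> - a) = r" "u \<zeta> \<ge> ereal (c - \<epsilon>)"
proof (rule ccontr)
  assume "\<not> thesis"
  note found = that
  have less: "u (a + complex_of_real r * cis \<theta>) \<le> ereal (c - \<epsilon>)" for \<theta>
    using found[of "a + complex_of_real r * cis \<theta>"] \<open>\<not> thesis\<close> \<open>r > 0\<close>
    by (simp add: norm_mult) (meson linear)
  have "ereal c \<le> mean_on_circle u a r"
    using submean_all_circles[of u "complex_of_real r" a] u fin \<open>r > 0\<close> by auto
  also have "\<dots> \<le> circle_mean (\<lambda>\<theta>. ereal (c - \<epsilon>))" by (rule circle_mean_mono[OF less])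
  also have "\<dots> = ereal (c - \<epsilon>)" by (rule circle_mean_const)
  finally show False using \<open>\<epsilon> > 0\<close> by simp
qed

lemma sum_weighted_powers:
  "m \<le> J \<Longrightarrow> (\<Sum>j\<in>{m<..J}. (real j + 3) / 2 ^ j) = (real m + 5) / 2 ^ m - (real J + 5) / 2 ^ J"
proof (induction rule: dec_induct)
  case (step n)
  have "{m<..Suc n} = insert (Suc n) {m<..n}" using step by auto
  then have *: "(\<Sum>j\<in>{m<..Suc n}. f j) = f (Suc n) + (\<Sum>j\<in>{m<..n}. f j)" for f :: "nat \<Rightarrow> real"
    by simp
  show ?case unfolding * step.IH by (simp add: field_simps)
qed simp

lemma sum_powers:
  "m \<le> J \<Longrightarrow> (\<Sum>j\<in>{m<..J}. 1 / 2 ^ j) = 1 / 2 ^ m - (1 :: real) / 2 ^ J"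
proof (induction rule: dec_induct)
  case (step n)
  have "{m<..Suc n} = insert (Suc n) {m<..n}" using step by auto
  then have *: "(\<Sum>j\<in>{m<..Suc n}. f j) = f (Suc n) + (\<Sum>j\<in>{m<..n}. f j)" for f :: "nat \<Rightarrow> real"
    by simp
  show ?case unfolding * step.IH by (simp add: field_simps)
qed simp

lemma sum_ereal_le_member:
  fixes f :: "'a \<Rightarrow> ereal"
  assumes "finite A" "i \<in> A" "\<And>j. j \<in> A \<Longrightarrow> f j \<le> 0"
  shows "sum f A \<le> f i"
proof -
  have "sum f A = f i + sum f (A - {i})" using assms by (simp add: sum.remove)
  also have "\<dots> \<le> f i + 0" using assms by (intro add_left_mono sum_nonpos) auto
  finally show ?thesis by simp
qed

text \<open>
  A function of small logarithmic growth \<open>\<epsilon>\<close> that is below \<open>-M\<close> at 2 and on all discs with index above \<open>m\<close>.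
  Being so negative at 2, it can be nearly 0 there only in a weak sense: adding it to any
  subharmonic function costs at most \<open>\<epsilon>\<close> at some point within \<open>r0\<close> of 2.
\<close>

definition penalty :: "real \<Rightarrow> real \<Rightarrow> nat \<Rightarrow> real \<Rightarrow> (complex \<Rightarrow> ereal) \<Rightarrow> bool" where
  "penalty M \<epsilon> m r0 Q \<longleftrightarrow> (\<forall>z. subharmonic_at Q z) \<and> (\<forall>z. Q z \<le> ereal (\<epsilon> * log_plus (cmod z))) \<and>
     (\<forall>z. cmod z \<le> 3 \<longrightarrow> Q z \<le> 0) \<and> Q 2 \<le> ereal (- M) \<and> (\<forall>j>m. \<forall>z\<in>disc j. Q z \<le> ereal (- M)) \<and>
     (\<forall>u. (\<forall>z. subharmonic_at u z) \<and> u 2 \<noteq> -\<infinity> \<longrightarrow>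
        (\<exists>\<zeta>. cmod (\<zeta> - 2) < r0 \<and> ereal (1 - \<epsilon>) * u 2 - ereal \<epsilon> \<le> ereal (1 - \<epsilon>) * u \<zeta> + Q \<zeta>))"

text \<open>
  Weights \<open>c\<^sub>j = M 2\<^sup>-\<^sup>j / 16\<close> satisfy \<open>c\<^sub>j log \<rho>\<^sub>j = -M\<close>, while \<open>\<Sum>c\<^sub>j\<close> and \<open>\<Sum>c\<^sub>j |log |2 - p\<^sub>j||\<close> converge, so that the tails
  beyond \<open>m\<close> are small in mass and at the point 2. Only the discs with \<open>m < j \<le> J\<close> receive a logarithm of their
  own: those with \<open>j > J\<close> are so close to 2 that a single term \<open>\<eta> log |z - 2|\<close> handles them. The order of choice is
  circle radius \<open>r\<close>, then \<open>\<eta>\<close> (harmless on that circle), then \<open>J\<close>.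
\<close>

lemma penalty_exists:
  assumes M: "M > 0" and \<epsilon>: "0 < \<epsilon>" "\<epsilon> < 1"
  obtains m0 where "\<And>m r0. m \<ge> m0 \<Longrightarrow> r0 > 0 \<Longrightarrow> \<exists>Q. penalty M \<epsilon> m r0 Q"
proof -
  have "(\<lambda>m. real m * (1/2) ^ m) \<longlonglongrightarrow> 0" by (rule powser_times_n_limit_0) simp
  moreover have "(\<lambda>m. 5 * (1/2 :: real) ^ m) \<longlonglongrightarrow> 0" by (intro tendsto_mult_right_zero LIMSEQ_realpow_zero) auto
  ultimately have "(\<lambda>m. real m * (1/2) ^ m + 5 * (1/2) ^ m) \<longlonglongrightarrow> 0" by (rule tendsto_add_zero)
  then have "(\<lambda>m. M / 16 * (real m * (1/2) ^ m + 5 * (1/2) ^ m)) \<longlonglongrightarrow> 0" by (rule tendsto_mult_right_zero)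
  then have "\<forall>\<^sub>F m in sequentially. M / 16 * (real m * (1/2) ^ m + 5 * (1/2) ^ m) < \<epsilon> / 3"
    using \<epsilon> by (intro order_tendstoD(2)[of _ 0]) auto
  then obtain m0 where m0: "\<And>m. m \<ge> m0 \<Longrightarrow> M / 16 * (real m * (1/2) ^ m + 5 * (1/2) ^ m) < \<epsilon> / 3"
    unfolding eventually_sequentially by blast
  have "\<exists>Q. penalty M \<epsilon> m r0 Q" if m: "m \<ge> m0" and r0: "r0 > 0" for m r0
  proof -
    have tail: "M / 16 * ((real m + 5) / 2 ^ m) < \<epsilon> / 3"
      using m0[OF m] by (simp add: field_simps)
    define r where "r = min (r0 / 2) 1"
    have r: "0 < r" "r < r0" "r \<le> 1" using r0 by (auto simp: r_def)
    define \<eta> where "\<eta> = (\<epsilon> / 3) / (1 + ln (8 / r))"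
    have l8: "ln (8 / r) > 0" using r by (intro ln_gt_zero) (simp add: field_simps)
    have \<eta>: "\<eta> > 0" "\<eta> \<le> \<epsilon> / 3" "\<eta> * ln (8 / r) \<le> \<epsilon> / 3"
      using l8 \<epsilon> by (auto simp: \<eta>_def field_simps)
    obtain J0 :: nat where J0: "real J0 \<ge> M / (\<eta> * ln 2)" using real_arch_simple by blast
    define J where "J = max m J0"
    have J: "m \<le> J" "J0 \<le> J" by (auto simp: J_def)
    define c where "c j = M / 16 / 2 ^ j" for j :: nat
    have c: "c j > 0" for j using M by (simp add: c_def)
    define p where "p j = complex_of_real (p_seq j)" for j
    define Q1 where "Q1 z = (\<Sum>j\<in>{m<..J}. ereal (c j) * scaled_log (p j) z)" for z
    define Q where "Q z = Q1 z + ereal \<eta> * scaled_log 2 z" for z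
    have pn: "cmod (p j) \<le> 3" if "j \<in> {m<..J}" for j
      using disc_norm_le[of j "p j"] that rho_seq_pos[of j] by (auto simp: p_def intro: less_imp_le)
    have c_sum: "(\<Sum>j\<in>{m<..J}. c j) \<le> \<epsilon> / 3"
    proof -
      have "(\<Sum>j\<in>{m<..J}. c j) = M / 16 * (\<Sum>j\<in>{m<..J}. 1 / 2 ^ j)" by (simp add: c_def sum_distrib_left)
      also have "\<dots> \<le> M / 16 * ((real m + 5) / 2 ^ m)"
        unfolding sum_powers[OF J(1)] using M by (intro mult_left_mono) (auto simp: field_simps intro: order_trans[of _ 0])
      finally show ?thesis using tail by linarith
    qed
    have shQ1: "subharmonic_at Q1 z" for z
      unfolding Q1_def by (intro subharmonic_at_sum subharmonic_at_cmult subharmonic_at_scaled_log c) auto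
    have shQ: "subharmonic_at Q z" for z
      unfolding Q_def by (intro subharmonic_at_add shQ1 subharmonic_at_cmult subharmonic_at_scaled_log \<eta>)
    have growth: "Q z \<le> ereal (\<epsilon> * log_plus (cmod z))" for z
    proof -
      have "Q1 z \<le> (\<Sum>j\<in>{m<..J}. ereal (c j) * ereal (log_plus (cmod z)))"
        unfolding Q1_def by (intro sum_mono ereal_cmult_mono scaled_log_growth pn) (auto intro: less_imp_le[OF c])
      also have "\<dots> = ereal ((\<Sum>j\<in>{m<..J}. c j) * log_plus (cmod z))"
        by (simp add: sum_distrib_right)
      also have "\<dots> \<le> ereal (\<epsilon> / 3 * log_plus (cmod z))"
        unfolding ereal_less_eq(3) using c_sum log_plus_nonneg[of "cmod z"] by (rule mult_right_mono)
      finally have 1: "Q1 z \<le> ereal (\<epsilon> / 3 * log_plus (cmod z))" .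
      have "ereal \<eta> * scaled_log 2 z \<le> ereal \<eta> * ereal (log_plus (cmod z))"
        using \<eta> by (intro ereal_cmult_mono scaled_log_growth) auto
      also have "\<dots> \<le> ereal (\<epsilon> / 3 * log_plus (cmod z))"
        unfolding times_ereal.simps ereal_less_eq(3) using \<eta>(2) log_plus_nonneg[of "cmod z"] by (rule mult_right_mono)
      finally have "Q z \<le> ereal (\<epsilon> / 3 * log_plus (cmod z)) + ereal (\<epsilon> / 3 * log_plus (cmod z))"
        unfolding Q_def by (intro add_mono 1)
      also have "\<dots> \<le> ereal (\<epsilon> * log_plus (cmod z))" using \<epsilon> log_plus_nonneg[of "cmod z"] by simp
      finally show ?thesis .
    qed
    have term_nonpos: "ereal (c j) * scaled_log (p j) z \<le> 0" if "j \<in> {m<..J}" "cmod z \<le> 3" for j z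
      using ereal_cmult_mono[OF less_imp_le[OF c[of j]] scaled_log_nonpos[OF pn[OF that(1)] that(2)]] by simp
    have Q1_nonpos: "Q1 z \<le> 0" if "cmod z \<le> 3" for z
      unfolding Q1_def using term_nonpos[OF _ that] by (intro sum_nonpos) auto
    have \<eta>_nonpos: "ereal \<eta> * scaled_log 2 z \<le> 0" if "cmod z \<le> 3" for z
      using ereal_cmult_mono[of \<eta> "scaled_log 2 z" 0] scaled_log_nonpos[of 2 z] that \<eta> by simp
    have Q_nonpos: "Q z \<le> 0" if "cmod z \<le> 3" for z
      unfolding Q_def using add_mono[OF Q1_nonpos[OF that] \<eta>_nonpos[OF that]] by simp
    have Q2: "Q 2 \<le> ereal (- M)"
      unfolding Q_def using \<eta>(1) Q1_nonpos[of 2] by (cases "Q1 2") auto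
    have QD: "Q z \<le> ereal (- M)" if j: "j > m" and z: "z \<in> disc j" for j z
    proof (cases "j \<le> J")
      case True
      have zn: "cmod z \<le> 3" using disc_norm_le[OF _ z] j by simp
      have "Q z \<le> Q1 z" unfolding Q_def using add_left_mono[OF \<eta>_nonpos[OF zn], of "Q1 z"] by simp
      also have "\<dots> \<le> ereal (c j) * scaled_log (p j) z"
        unfolding Q1_def using True j term_nonpos zn by (intro sum_ereal_le_member) auto
      also have "\<dots> \<le> ereal (c j) * ereal (ln (rho_seq j / 8))"
        using z by (intro ereal_cmult_mono less_imp_le[OF c] scaled_log_le rho_seq_pos) (simp add: p_def dist_norm norm_minus_commute)
      also have "\<dots> \<le> ereal (- M)"
      proof -
        have "ln (rho_seq j / 8) = - 16 * 2 ^ j - ln 8"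
          by (subst ln_div) (auto simp: rho_seq_def)
        also have "\<dots> \<le> - 16 * 2 ^ j" by simp
        finally have "c j * ln (rho_seq j / 8) \<le> c j * (- 16 * 2 ^ j)"
          by (intro mult_left_mono less_imp_le[OF c])
        also have "\<dots> = - M" by (simp add: c_def)
        finally show ?thesis by simp
      qed
      finally show ?thesis .
    next
      case False
      have zn: "cmod z \<le> 3" using disc_norm_le[OF _ z] j by simp
      have "cmod (z - 2) \<le> cmod (z - complex_of_real (p_seq j)) + cmod (complex_of_real (p_seq j) - 2)"
        using norm_triangle_ineq[of "z - complex_of_real (p_seq j)" "complex_of_real (p_seq j) - 2"] by simp
      also have "complex_of_real (p_seq j) - 2 = complex_of_real (1 / 2 ^ j)" by (simp add: p_seq_def)
      also have "cmod (complex_of_real (1 / 2 ^ j)) = 1 / 2 ^ j" unfolding norm_of_real by simp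
      also have "cmod (z - complex_of_real (p_seq j)) \<le> 1 / 2 ^ j"
      proof -
        have "(0::real) \<le> 1 / 2 ^ j" by simp
        moreover have "cmod (z - complex_of_real (p_seq j)) \<le> rho_seq j" using z by (simp add: dist_norm norm_minus_commute)
        ultimately show ?thesis using rho_seq_le[of j] rho_seq_pos[of j] by linarith
      qed
      finally have d: "cmod (z - 2) \<le> 2 / 2 ^ j" by simp
      have "Q z \<le> ereal \<eta> * scaled_log 2 z"
        unfolding Q_def using add_right_mono[OF Q1_nonpos[OF zn], of "ereal \<eta> * scaled_log 2 z"] by simp
      also have "\<dots> \<le> ereal \<eta> * ereal (ln (2 / 2 ^ j / 8))"
        using d \<eta> by (intro ereal_cmult_mono scaled_log_le) auto
      also have "\<dots> \<le> ereal (- M)"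
      proof -
        have "ln (2 / 2 ^ j / 8 :: real) \<le> ln (1 / 2 ^ j)" by (intro ln_mono) (auto simp: field_simps)
        also have "\<dots> = - (real j * ln 2)" by (simp add: ln_div ln_realpow)
        also have "\<dots> \<le> - (real J0 * ln 2)" using False J by (simp add: mult_right_mono)
        finally have "\<eta> * ln (2 / 2 ^ j / 8) \<le> \<eta> * (- (real J0 * ln 2))" using \<eta> by (intro mult_left_mono) auto
        also have "\<dots> \<le> - M" using J0 \<eta>(1) by (simp add: field_simps)
        finally show ?thesis by simp
      qed
      finally show ?thesis .
    qed
    have Q12: "Q1 2 \<ge> ereal (- \<epsilon> / 3)"
    proof -
      have t: "ereal (c j) * scaled_log (p j) 2 = ereal (- (M / 16 * ln 2) * ((real j + 3) / 2 ^ j))" for j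
      proof -
        have "2 - p j = complex_of_real (- (1 / 2 ^ j))" by (simp add: p_def p_seq_def)
        then have n: "cmod (2 - p j) = 1 / 2 ^ j" by (simp only: norm_of_real abs_minus_cancel) simp
        have "2 \<noteq> p j" using n by auto
        moreover have "ln (8::real) = 3 * ln 2" using ln_realpow[of 2 3] by simp
        ultimately show ?thesis
          by (simp add: scaled_log_eq n ln_div ln_mult ln_realpow c_def field_simps)
      qed
      have "Q1 2 = ereal (\<Sum>j\<in>{m<..J}. - (M / 16 * ln 2) * ((real j + 3) / 2 ^ j))"
        unfolding Q1_def t by (rule sum_ereal)
      also have "(\<Sum>j\<in>{m<..J}. - (M / 16 * ln 2) * ((real j + 3) / 2 ^ j)) = - (M / 16 * ln 2) * ((real m + 5) / 2 ^ m - (real J + 5) / 2 ^ J)"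
        unfolding sum_distrib_left[symmetric] sum_weighted_powers[OF J(1)] ..
      finally have 1: "Q1 2 = ereal (- (M / 16 * ln 2) * ((real m + 5) / 2 ^ m - (real J + 5) / 2 ^ J))" .
      define k where "k = M / 16 * ln 2"
      define x where "x = (real m + 5) / 2 ^ m"
      define y where "y = (real J + 5) / 2 ^ J"
      have "k \<ge> 0" "x \<ge> 0" "y \<ge> 0" "k \<le> M / 16"
        using M ln_2_less_1 by (auto simp: k_def x_def y_def)
      then have "k * y \<ge> 0" "k * x \<le> M / 16 * x"
        by (auto intro: mult_right_mono simp del: times_divide_eq_left)
      moreover have "- k * (x - y) = k * y - k * x" by (simp add: algebra_simps)
      ultimately have "- \<epsilon> / 3 \<le> - (M / 16 * ln 2) * ((real m + 5) / 2 ^ m - (real J + 5) / 2 ^ J)"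
        using tail unfolding k_def[symmetric] x_def[symmetric] y_def[symmetric] by linarith
      then show ?thesis unfolding 1 by simp
    qed
    have ex: "\<exists>\<zeta>. cmod (\<zeta> - 2) < r0 \<and> ereal (1 - \<epsilon>) * u 2 - ereal \<epsilon> \<le> ereal (1 - \<epsilon>) * u \<zeta> + Q \<zeta>"
      if u: "\<And>z. subharmonic_at u z" "u 2 \<noteq> -\<infinity>" for u
    proof -
      obtain a where a: "u 2 = ereal a" using u(2) subharmonic_at_less_infty[OF u(1), of 2] by (cases "u 2") auto
      obtain q where q: "Q1 2 = ereal q" using Q12 Q1_nonpos[of 2] by (cases "Q1 2") auto
      define f where "f z = ereal (1 - \<epsilon>) * u z + Q1 z" for z
      have shf: "subharmonic_at f z" for z unfolding f_def using \<epsilon> by (intro subharmonic_at_add subharmonic_at_cmult u shQ1) auto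
      have f2: "f 2 = ereal ((1 - \<epsilon>) * a + q)" unfolding f_def a q by simp
      obtain \<zeta> where \<zeta>: "cmod (\<zeta> - 2) = r" "f \<zeta> \<ge> ereal ((1 - \<epsilon>) * a + q - \<epsilon> / 3)"
        using circle_mean_attained[OF shf f2, of "\<epsilon> / 3" r] \<epsilon> r by auto
      have "\<zeta> \<noteq> 2" using \<zeta>(1) r by auto
      then have "ereal \<eta> * scaled_log 2 \<zeta> = ereal (\<eta> * ln (r / 8))" by (simp add: scaled_log_eq \<zeta>(1))
      also have "ln (r / 8) = - ln (8 / r)" using r by (simp add: ln_div)
      finally have "ereal \<eta> * scaled_log 2 \<zeta> \<ge> ereal (- \<epsilon> / 3)" using \<eta>(3) by simp
      then have "ereal ((1 - \<epsilon>) * a + q - \<epsilon> / 3) + ereal (- \<epsilon> / 3) \<le> f \<zeta> + ereal \<eta> * scaled_log 2 \<zeta>"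
        using \<zeta>(2) by (intro add_mono)
      moreover have "ereal (1 - \<epsilon>) * u 2 - ereal \<epsilon> \<le> ereal ((1 - \<epsilon>) * a + q - \<epsilon> / 3) + ereal (- \<epsilon> / 3)"
        using Q12 unfolding q a by simp
      moreover have "f \<zeta> + ereal \<eta> * scaled_log 2 \<zeta> = ereal (1 - \<epsilon>) * u \<zeta> + Q \<zeta>"
        unfolding f_def Q_def by (simp add: add.assoc)
      ultimately show ?thesis using \<zeta>(1) r(2) by (intro exI[of _ \<zeta>]) auto
    qed
    show ?thesis unfolding penalty_def using shQ growth Q_nonpos Q2 QD ex by (intro exI[of _ Q]) blast
  qed
  then show thesis using that by blast
qed

section \<open>Stability under truncation and translation\<close>

lemma log_plus_translate:
  assumes "cmod d \<le> 1"
  shows "log_plus (cmod (z + d)) \<le> log_plus (cmod z) + ln 2"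
proof -
  have "cmod (z + d) \<le> 2 * max 1 (cmod z)" using assms norm_triangle_ineq[of z d] by simp
  then have "log_plus (cmod (z + d)) \<le> ln (2 * max 1 (cmod z))"
    by (intro log_plus_le_ln) auto
  also have "\<dots> = ln 2 + ln (max 1 (cmod z))" by (rule ln_mult_pos) auto
  also have "ln (max 1 (cmod z)) \<le> log_plus (cmod z)"
    using ln_le_log_plus log_plus_nonneg by (simp add: max_def)
  finally show ?thesis by simp
qed

text \<open>
  The intersection \<open>disc j \<inter> cball 0 R\<close> has corners, which no disc inside it touches, so the estimate outside
  discs does not reach them. But each of its points is close to the end of a segment of length at least \<open>\<kappa>0 / 4\<close> in the
  slightly smaller intersection, directed towards whichever of two fixed real points is far away. The slit
  estimate along these segments gives the uniform bound.
\<close>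

lemma lens_stability:
  assumes j: "j \<ge> 1" and R: "p_seq j - rho_seq j < R" and \<epsilon>: "\<epsilon> > 0"
  obtains \<delta> where "\<delta> > 0"
    "\<And>R' s z d. R' > R - \<delta> \<Longrightarrow> subharmonic s \<Longrightarrow> (\<And>z. s z \<le> ereal (log_plus (cmod z))) \<Longrightarrow>
      (\<And>z. z \<in> disc j \<inter> cball 0 R' \<Longrightarrow> s z \<le> 0) \<Longrightarrow> z \<in> disc j \<inter> cball 0 R \<Longrightarrow> cmod d < \<delta> \<Longrightarrow>
      s (z + d) \<le> ereal \<epsilon>"
proof -
  define p where "p = p_seq j"
  define \<rho> where "\<rho> = rho_seq j"
  have \<rho>: "0 < \<rho>" "\<rho> \<le> 1/16" "p - \<rho> > 2"
    using rho_seq_pos p_seq_bounds[OF j] by (auto simp: p_def \<rho>_def)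
  define \<kappa>0 where "\<kappa>0 = min (R - (p - \<rho>)) \<rho> / 2"
  have \<kappa>0: "0 < \<kappa>0" "2 * \<kappa>0 \<le> R - (p - \<rho>)" "2 * \<kappa>0 \<le> \<rho>"
    using R \<rho> by (auto simp: \<kappa>0_def p_def \<rho>_def)
  define m where "m = min 1 ((\<epsilon> / 6)\<^sup>2)"
  have m: "0 < m" "m \<le> 1" "m \<le> (\<epsilon> / 6)\<^sup>2" using \<epsilon> by (auto simp: m_def)
  define \<kappa> where "\<kappa> = \<kappa>0 * m / 8"
  have \<kappa>: "0 < \<kappa>" "\<kappa> \<le> 1/2" "8 * \<kappa> / \<kappa>0 = m"
  proof -
    have "\<kappa>0 * m \<le> 1 * 1" using \<kappa>0 \<rho> m by (intro mult_mono) auto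
    then show "\<kappa> \<le> 1/2" by (simp add: \<kappa>_def)
  qed (use \<kappa>0 m in \<open>auto simp: \<kappa>_def\<close>)
  define \<delta> where "\<delta> = min \<kappa> (\<kappa> * \<kappa>0)"
  have \<delta>: "\<delta> > 0" "\<delta> \<le> \<kappa>" "\<delta> \<le> \<kappa> * \<kappa>0" using \<kappa> \<kappa>0 by (auto simp: \<delta>_def)
  have "s (z + d) \<le> ereal \<epsilon>"
    if R': "R' > R - \<delta>" and sub: "subharmonic s" and growth: "\<And>z. s z \<le> ereal (log_plus (cmod z))"
      and le: "\<And>z. z \<in> disc j \<inter> cball 0 R' \<Longrightarrow> s z \<le> 0" and z: "z \<in> disc j \<inter> cball 0 R" and d: "cmod d < \<delta>"
    for R' s z d
  proof -
    define c1 where "c1 = complex_of_real (p - \<rho>)"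
    define c2 where "c2 = complex_of_real (p - \<rho> + \<kappa>0)"
    have "cmod (c2 - c1) = \<kappa>0" unfolding c1_def c2_def of_real_diff[symmetric] norm_of_real using \<kappa>0 by simp
    then have "\<kappa>0 \<le> cmod (z - c1) + cmod (z - c2)"
      using norm_triangle_ineq4[of "z - c1" "z - c2"] by simp
    then have "\<kappa>0 / 2 \<le> cmod (z - c1) \<or> \<kappa>0 / 2 \<le> cmod (z - c2)" by linarith
    moreover have "c1 \<in> disc j" "c2 \<in> disc j" "cmod c1 \<le> p - \<rho> + \<kappa>0" "cmod c2 \<le> p - \<rho> + \<kappa>0"
    proof -
      have "dist (complex_of_real p) c1 = \<rho>" "dist (complex_of_real p) c2 = \<rho> - \<kappa>0"
        unfolding c1_def c2_def dist_of_real using \<rho> \<kappa>0 by (auto simp: dist_real_def)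
      then show "c1 \<in> disc j" "c2 \<in> disc j" unfolding mem_cball p_def[symmetric] \<rho>_def[symmetric] using \<kappa>0 by auto
      show "cmod c1 \<le> p - \<rho> + \<kappa>0" "cmod c2 \<le> p - \<rho> + \<kappa>0"
        unfolding c1_def c2_def norm_of_real using \<rho> \<kappa>0 by auto
    qed
    ultimately obtain c where c: "\<kappa>0 / 2 \<le> cmod (z - c)" "c \<in> disc j" "cmod c \<le> p - \<rho> + \<kappa>0"
      by blast
    define L where "L = cmod (z - c)"
    have L: "\<kappa>0 / 2 \<le> L" "L \<le> 1/8"
    proof -
      have "dist z c \<le> dist z (complex_of_real (p_seq j)) + dist (complex_of_real (p_seq j)) c" by (rule dist_triangle)
      also have "\<dots> \<le> \<rho> + \<rho>" using z c(2) by (intro add_mono) (auto simp: \<rho>_def dist_commute)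
      finally show "L \<le> 1/8" using \<rho> by (simp add: L_def dist_norm)
    qed (use c in \<open>simp add: L_def\<close>)
    define z' where "z' = z + complex_of_real \<kappa> * (c - z)"
    define e where "e = c - z'"
    have e_eq: "e = complex_of_real (1 - \<kappa>) * (c - z)" by (simp add: e_def z'_def algebra_simps)
    have e: "cmod e = (1 - \<kappa>) * L"
      unfolding e_eq norm_mult norm_of_real L_def using \<kappa> by (simp add: norm_minus_commute)
    have e2: "\<kappa>0 / 4 \<le> cmod e" "cmod e \<le> L"
    proof -
      have "1/2 * (\<kappa>0 / 2) \<le> (1 - \<kappa>) * L" using \<kappa> L \<kappa>0 by (intro mult_mono) auto
      then show "\<kappa>0 / 4 \<le> cmod e" unfolding e by simp
      have "(1 - \<kappa>) * L \<le> 1 * L" using \<kappa> L \<kappa>0 by (intro mult_right_mono) auto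
      then show "cmod e \<le> L" unfolding e by simp
    qed
    then have "e \<noteq> 0" using \<kappa>0 by auto
    define K where "K = disc j \<inter> cball 0 R'"
    have K: "convex K" unfolding K_def by (intro convex_Int convex_cball)
    have \<kappa>\<kappa>0: "\<kappa> * \<kappa>0 \<le> \<kappa>0" using \<kappa> \<kappa>0 by (simp add: mult_left_le_one_le)
    have cK: "c \<in> K" unfolding K_def using c R' \<delta> \<kappa>0 \<kappa>\<kappa>0 by simp
    have "z' = (1 - \<kappa>) *\<^sub>R z + \<kappa> *\<^sub>R c" by (simp add: z'_def scaleR_conv_of_real algebra_simps)
    moreover have "(1 - \<kappa>) *\<^sub>R z + \<kappa> *\<^sub>R c \<in> disc j"
      by (rule convexD[OF convex_cball]) (use z c(2) \<kappa> in auto)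
    ultimately have z'D: "z' \<in> disc j" by simp
    have "cmod z' \<le> (1 - \<kappa>) * cmod z + \<kappa> * cmod c"
    proof -
      have "z' = complex_of_real (1 - \<kappa>) * z + complex_of_real \<kappa> * c" by (simp add: z'_def algebra_simps)
      then have "cmod z' \<le> cmod (complex_of_real (1 - \<kappa>) * z) + cmod (complex_of_real \<kappa> * c)"
        by (simp only: norm_triangle_ineq)
      then show ?thesis unfolding norm_mult norm_of_real using \<kappa> by simp
    qed
    also have "\<dots> \<le> (1 - \<kappa>) * R + \<kappa> * (R - \<kappa>0)"
      using z c(3) \<kappa> \<kappa>0 by (intro add_mono mult_left_mono) auto
    also have "\<dots> = R - \<kappa> * \<kappa>0" by (simp add: algebra_simps)
    finally have "cmod z' \<le> R'" using R' \<delta> by simp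
    then have z'K: "z' \<in> K" unfolding K_def using z'D by simp
    have slit: "s (z' + complex_of_real t * e) \<le> 0" if "t \<in> {0..1}" for t
    proof -
      have "z' + complex_of_real t * e = (1 - t) *\<^sub>R z' + t *\<^sub>R c"
        by (simp add: e_def scaleR_conv_of_real algebra_simps)
      also have "\<dots> \<in> K" using convexD[OF K z'K cK] that by simp
      finally show ?thesis using le unfolding K_def by blast
    qed
    have bd: "s y \<le> ereal 2" if "y \<in> cball z' (cmod e)" for y
    proof -
      have "cmod (y - z') \<le> 1" using that e2 L by (simp add: dist_norm norm_minus_commute)
      then have "cmod y \<le> 4" using disc_norm_le[OF j z'D] norm_triangle_ineq[of "y - z'" z'] by simp
      then have "ereal (log_plus (cmod y)) \<le> ereal 2" using log_plus_le_2[of "cmod y"] by simp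
      then show ?thesis using growth[of y] by (rule order_trans[rotated])
    qed
    define \<zeta> where "\<zeta> = (z + d - z') / e"
    have "cmod (z + d - z') = cmod (d + complex_of_real \<kappa> * (z - c))" by (simp add: z'_def algebra_simps)
    also have "\<dots> \<le> cmod d + \<kappa> * L"
      using norm_triangle_ineq[of d "complex_of_real \<kappa> * (z - c)"] \<kappa> by (simp add: norm_mult L_def)
    also have "\<dots> \<le> \<kappa> + \<kappa> * 1" using d \<delta> \<kappa> L by (intro add_mono mult_left_mono) auto
    finally have "cmod (z + d - z') \<le> 2 * \<kappa>" by simp
    then have "cmod \<zeta> \<le> 2 * \<kappa> / (\<kappa>0 / 4)"
      unfolding \<zeta>_def norm_divide using e2 \<kappa>0 \<kappa> by (intro frac_le) auto
    then have \<zeta>: "cmod \<zeta> \<le> m" using \<kappa>(3) by simp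
    have "s (z' + \<zeta> * e) \<le> ereal (3 * 2 * sqrt (cmod \<zeta>))"
      by (rule slit_estimate[OF sub slit bd]) (use \<zeta> m in auto)
    also have "3 * 2 * sqrt (cmod \<zeta>) \<le> \<epsilon>"
    proof -
      have "sqrt (cmod \<zeta>) \<le> sqrt ((\<epsilon> / 6)\<^sup>2)" using \<zeta> m by (intro real_sqrt_le_mono) linarith
      then show ?thesis using \<epsilon> by simp
    qed
    finally show ?thesis unfolding \<zeta>_def using \<open>e \<noteq> 0\<close> by simp
  qed
  then show thesis using that[OF \<delta>(1)] by blast
qed

lemma disc_degenerate:
  assumes "j \<ge> 1" "R \<le> p_seq j - rho_seq j" "z \<in> disc j" "cmod z \<le> R"
  shows "z = complex_of_real R" "R = p_seq j - rho_seq j"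
proof -
  have "\<bar>Re (complex_of_real (p_seq j) - z)\<bar> \<le> cmod (complex_of_real (p_seq j) - z)" by (rule abs_Re_le_cmod)
  also have "\<dots> \<le> rho_seq j" using assms(3) by (simp add: dist_norm)
  finally have "Re z \<ge> p_seq j - rho_seq j" by simp
  moreover have "Re z \<le> cmod z" by (rule complex_Re_le_cmod)
  ultimately have *: "Re z = R" "cmod z = R" "R = p_seq j - rho_seq j" using assms by linarith+
  then show "R = p_seq j - rho_seq j" by simp
  have "(cmod z)\<^sup>2 = (Re z)\<^sup>2 + (Im z)\<^sup>2" by (rule cmod_power2)
  then have "Im z = 0" using * by simp
  then show "z = complex_of_real R" using * by (simp add: complex_eq_iff)
qed

text \<open>
  A competitor for \<open>trunc m R'\<close>, translated by \<open>\<zeta>' - 2\<close> and lowered a little, competes for \<open>trunc m R\<close>. Only the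
  case where \<open>R\<close> is the smallest modulus of a disc needs more: the intersection is then the single point \<open>R\<close>,
  which \<open>trunc m R'\<close> may miss, and a small multiple of the logarithm with pole \<open>R\<close> takes care of it.
\<close>

lemma trunc_stability:
  assumes R: "R \<ge> 2" "R \<le> 3" and \<epsilon>: "\<epsilon> > 0"
  obtains \<delta> where "\<delta> > 0"
    "\<And>R' \<zeta>'. R' > R - \<delta> \<Longrightarrow> cmod (\<zeta>' - 2) < \<delta> \<Longrightarrow> planar_extremal (trunc m R') \<zeta>' \<le> planar_extremal (trunc m R) 2 + ereal \<epsilon>"
proof -
  define G where "G j \<delta> \<longleftrightarrow> (\<forall>R' s z d. R' > R - \<delta> \<and> subharmonic s \<and> (\<forall>z. s z \<le> ereal (log_plus (cmod z))) \<and>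
      (\<forall>z \<in> disc j \<inter> cball 0 R'. s z \<le> 0) \<and> z \<in> disc j \<inter> cball 0 R \<and> cmod d < \<delta> \<longrightarrow>
      s (z + d) \<le> ereal (\<epsilon> / 3))" for j \<delta>
  define A where "A = {j\<in>{1..m}. p_seq j - rho_seq j < R}"
  have G_mono: "G j \<delta>'" if "G j \<delta>" "\<delta>' \<le> \<delta>" for j \<delta> \<delta>'
    unfolding G_def
  proof (intro allI impI, elim conjE)
    fix R' s z d assume "R - \<delta>' < R'" "subharmonic s" "\<forall>z. s z \<le> ereal (log_plus (cmod z))"
      "\<forall>z\<in>disc j \<inter> cball 0 R'. s z \<le> 0" "z \<in> disc j \<inter> cball 0 R" "cmod d < \<delta>'"
    moreover from this have "R - \<delta> < R'" "cmod d < \<delta>" using that(2) by auto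
    ultimately show "s (z + d) \<le> ereal (\<epsilon> / 3)" using that(1) unfolding G_def by blast
  qed
  have "\<exists>\<delta>>0. \<forall>j\<in>B. G j \<delta>" if "finite B" "B \<subseteq> A" for B
    using that
  proof induction
    case (insert j B)
    then obtain \<delta>1 where \<delta>1: "\<delta>1 > 0" "\<forall>j\<in>B. G j \<delta>1" by blast
    have "j \<ge> 1" "p_seq j - rho_seq j < R" "\<epsilon> / 3 > 0" using insert.prems \<epsilon> by (auto simp: A_def)
    from lens_stability[OF this] obtain \<delta>2 where "\<delta>2 > 0" "G j \<delta>2" unfolding G_def by metis
    then show ?case using \<delta>1 by (intro exI[of _ "min \<delta>1 \<delta>2"]) (auto intro: G_mono)
  qed (auto intro: exI[of _ 1])
  from this[of A] obtain \<delta>0 where \<delta>0: "\<delta>0 > 0" "\<And>j. j \<in> A \<Longrightarrow> G j \<delta>0" unfolding A_def by auto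
  \<comment> \<open>For \<open>R = 2\<close> no disc is degenerate, and a pole at 2 would spoil the value there; 3 stands for any other point.\<close>
  define x0 :: real where "x0 = (if R = 2 then 3 else R)"
  have x0: "x0 \<noteq> 2" "R = 2 \<or> x0 = R" "2 \<le> x0" "x0 \<le> 3" using R by (auto simp: x0_def)
  have x0n: "cmod (complex_of_real x0) \<le> 3" using x0 by simp
  define K where "K = \<bar>ln \<bar>2 - x0\<bar>\<bar> + ln 8"
  have K: "K \<ge> 0" by (simp add: K_def)
  define \<eta> where "\<eta> = min (1/2) (\<epsilon> / 3 / (2 + K))"
  have \<eta>: "0 < \<eta>" "\<eta> \<le> 1/2" "\<eta> * (2 + K) \<le> \<epsilon> / 3"
  proof -
    have "\<eta> * (2 + K) \<le> \<epsilon> / 3 / (2 + K) * (2 + K)" using K by (intro mult_right_mono) (auto simp: \<eta>_def)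
    also have "\<dots> = \<epsilon> / 3" by (subst nonzero_eq_divide_eq[symmetric]) (use K in auto)
    finally show "\<eta> * (2 + K) \<le> \<epsilon> / 3" .
    show "\<eta> \<le> 1/2" unfolding \<eta>_def by (rule min.cobounded1)
    show "0 < \<eta>" unfolding \<eta>_def using K \<epsilon> by auto
  qed
  define \<delta> where "\<delta> = min \<delta>0 (min 1 (\<epsilon> / 3))"
  have \<delta>: "\<delta> > 0" "\<delta> \<le> \<delta>0" "\<delta> \<le> 1" "\<delta> \<le> \<epsilon> / 3" using \<delta>0 \<epsilon> by (auto simp: \<delta>_def)
  have "planar_extremal (trunc m R') \<zeta>' \<le> planar_extremal (trunc m R) 2 + ereal \<epsilon>" if R': "R' > R - \<delta>" and \<zeta>': "cmod (\<zeta>' - 2) < \<delta>" for R' \<zeta>'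
  proof (rule planar_extremal_least)
    fix s assume s: "s \<in> planar_class (trunc m R')"
    have sub: "subharmonic s" using s by (simp add: planar_class_def)
    have growth: "s z \<le> ereal (log_plus (cmod z))" for z
      by (rule planar_class_le_log_plus[OF s cball_subset_trunc])
    show "s \<zeta>' \<le> planar_extremal (trunc m R) 2 + ereal \<epsilon>"
    proof (cases "s \<zeta>'")
      case (real \<sigma>)
      define d where "d = \<zeta>' - 2"
      have d: "cmod d < \<delta>" using \<zeta>' by (simp add: d_def)
      have "cmod \<zeta>' \<le> 4" using norm_triangle_ineq[of d 2] d \<delta> by (simp add: d_def)
      then have \<sigma>: "\<sigma> \<le> 2" using growth[of \<zeta>'] log_plus_le_2[of "cmod \<zeta>'"] real by simp
      define c where "c z = ereal (1 - \<eta>) * s (z + d) + (ereal \<eta> * scaled_log (complex_of_real x0) z + ereal (- \<epsilon> / 3))" for z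
      have small: "s (z + d) \<le> ereal (\<epsilon> / 3) \<or> z = complex_of_real x0" if z: "z \<in> trunc m R" for z
      proof -
        consider "cmod z \<le> 1" | j where "j \<in> {1..m}" "z \<in> disc j \<inter> cball 0 R"
          using z unfolding trunc_def by auto
        then show ?thesis
        proof cases
          case 1
          have "cmod (z + d) \<le> 1 + \<delta>" using 1 d norm_triangle_ineq[of z d] by linarith
          then have "log_plus (cmod (z + d)) \<le> ln (1 + \<delta>)" using \<delta> by (intro log_plus_le_ln) auto
          also have "\<dots> \<le> \<delta>" using \<delta> by (intro ln_add_one_self_le_self) auto
          also have "\<dots> \<le> \<epsilon> / 3" by (rule \<delta>)
          finally show ?thesis using growth[of "z + d"] by (meson ereal_less_eq(3) order_trans)
        next
          case 2
          show ?thesis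
          proof (cases "j \<in> A")
            case True
            have "\<forall>z\<in>disc j \<inter> cball 0 R'. s z \<le> 0"
              using 2(1) by (intro ballI planar_class_le[OF s]) (auto simp: trunc_def)
            moreover have "R - \<delta>0 < R'" "cmod d < \<delta>0" using R' d \<delta> by auto
            ultimately have "s (z + d) \<le> ereal (\<epsilon> / 3)"
              using \<delta>0(2)[OF True] sub growth 2(2) unfolding G_def by blast
            then show ?thesis ..
          next
            case False
            then have "R \<le> p_seq j - rho_seq j" using 2(1) by (auto simp: A_def)
            from disc_degenerate[OF _ this] 2 have "z = complex_of_real R" "R = p_seq j - rho_seq j" by auto
            moreover have "R \<noteq> 2" using p_seq_bounds(1)[of j] 2(1) calculation(2) by auto
            ultimately show ?thesis using x0 by simp
          qed
        qed
      qed
      have n2: "cmod (2 - complex_of_real x0) = \<bar>2 - x0\<bar>"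
        using norm_of_real[of "2 - x0", where 'a=complex] by simp
      have scaled_log2: "scaled_log (complex_of_real x0) 2 = ereal (ln \<bar>2 - x0\<bar> - ln 8)"
        using x0 n2 by (auto simp: scaled_log_def log_dist_def)
      have "ln \<bar>2 - x0\<bar> - ln 8 \<ge> - K" by (simp add: K_def)
      then have "\<eta> * (ln \<bar>2 - x0\<bar> - ln 8) \<ge> \<eta> * (- K)" using \<eta> by (intro mult_left_mono) auto
      moreover have "\<eta> * \<sigma> \<le> \<eta> * 2" using \<sigma> \<eta> by (intro mult_left_mono) auto
      ultimately have "\<sigma> - \<epsilon> \<le> (1 - \<eta>) * \<sigma> + (\<eta> * (ln \<bar>2 - x0\<bar> - ln 8) + - \<epsilon> / 3)"
        using \<eta>(3) \<epsilon> by (simp add: algebra_simps)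
      moreover have c2: "c 2 = ereal ((1 - \<eta>) * \<sigma> + (\<eta> * (ln \<bar>2 - x0\<bar> - ln 8) + - \<epsilon> / 3))"
        unfolding c_def scaled_log2 using real by (simp add: d_def)
      ultimately have c2': "ereal (\<sigma> - \<epsilon>) \<le> c 2" by simp
      have "c \<in> planar_class (trunc m R)"
      proof (rule planar_classI[where ?z0.0=2 and C="ln 2"])
        fix z
        have "subharmonic (\<lambda>t. s (d + t * 1))" using sub by (rule subharmonic_affine)
        then have "subharmonic_at (\<lambda>z. s (z + d)) z" unfolding subharmonic_iff_local by (simp add: add.commute)
        then show "subharmonic_at c z" unfolding c_def using \<eta>
          by (intro subharmonic_at_add subharmonic_at_add_const subharmonic_at_cmult subharmonic_at_scaled_log) auto
        show "c z \<le> ereal (log_plus (cmod z) + ln 2)"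
        proof -
          have "ereal (1 - \<eta>) * s (z + d) \<le> ereal (1 - \<eta>) * ereal (log_plus (cmod z) + ln 2)"
          proof (intro ereal_cmult_mono)
            have "log_plus (cmod (z + d)) \<le> log_plus (cmod z) + ln 2"
              using d \<delta> by (intro log_plus_translate) auto
            then show "s (z + d) \<le> ereal (log_plus (cmod z) + ln 2)"
              using growth[of "z + d"] by (meson ereal_less_eq(3) order_trans)
          qed (use \<eta> in auto)
          moreover have "ereal \<eta> * scaled_log (complex_of_real x0) z \<le> ereal \<eta> * ereal (log_plus (cmod z))"
            using \<eta> by (intro ereal_cmult_mono scaled_log_growth x0n) auto
          moreover have "ereal (- \<epsilon> / 3) \<le> 0" using \<epsilon> by simp
          ultimately have "c z \<le> ereal (1 - \<eta>) * ereal (log_plus (cmod z) + ln 2) + (ereal \<eta> * ereal (log_plus (cmod z)) + 0)"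
            unfolding c_def by (intro add_mono)
          also have "\<dots> = ereal (log_plus (cmod z) + ln 2 - \<eta> * ln 2)" by (simp add: algebra_simps)
          also have "\<dots> \<le> ereal (log_plus (cmod z) + ln 2)" using \<eta> by simp
          finally show ?thesis .
        qed
      next
        show "c 2 \<noteq> -\<infinity>" unfolding c2 by simp
      next
        fix z assume z: "z \<in> trunc m R"
        show "c z \<le> 0"
        proof (cases "z = complex_of_real x0")
          case True
          have "s (z + d) < \<infinity>" using planar_class_subharmonic_at[OF s] subharmonic_at_less_infty by blast
          then show ?thesis unfolding c_def True using \<eta> True by (cases "s (z + d)") auto
        next
          case False
          then have "s (z + d) \<le> ereal (\<epsilon> / 3)" using small[OF z] by blast
          then have "ereal (1 - \<eta>) * s (z + d) \<le> ereal (1 - \<eta>) * ereal (\<epsilon> / 3)"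
            using \<eta> by (intro ereal_cmult_mono) auto
          moreover have "ereal \<eta> * scaled_log (complex_of_real x0) z \<le> ereal \<eta> * 0"
            using \<eta> trunc_norm_le[OF z] by (intro ereal_cmult_mono scaled_log_nonpos x0n) auto
          ultimately have "c z \<le> ereal (1 - \<eta>) * ereal (\<epsilon> / 3) + (ereal \<eta> * 0 + ereal (- \<epsilon> / 3))"
            unfolding c_def by (intro add_mono order_refl)
          also have "\<dots> = ereal (- (\<eta> * (\<epsilon> / 3)))" by (simp add: field_simps)
          also have "\<dots> \<le> 0" using \<eta> \<epsilon> by simp
          finally show ?thesis .
        qed
      qed
      then have "c 2 \<le> planar_extremal (trunc m R) 2" by (rule planar_extremal_upper)
      with c2' have "ereal (\<sigma> - \<epsilon>) \<le> planar_extremal (trunc m R) 2" by (rule order_trans)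
      then have "ereal (\<sigma> - \<epsilon>) + ereal \<epsilon> \<le> planar_extremal (trunc m R) 2 + ereal \<epsilon>" by (rule add_right_mono)
      then show ?thesis using real by simp
    qed (use growth[of \<zeta>'] planar_extremal_nonneg[of "trunc m R" 2] in auto)
  qed
  then show thesis using that[OF \<delta>(1)] by blast
qed

section \<open>The regularized extremal function at the point 2\<close>

lemma Limsup_nhds_ge:
  fixes f :: "'a::metric_space \<Rightarrow> ereal"
  assumes "\<And>r. r > 0 \<Longrightarrow> \<exists>\<zeta>. dist \<zeta> a < r \<and> c \<le> f \<zeta>"
  shows "c \<le> Limsup (nhds a) f"
  unfolding Limsup_def
proof (rule INF_greatest)
  fix P assume "P \<in> {P. eventually P (nhds a)}"
  then obtain r where "r > 0" "\<And>x. dist x a < r \<Longrightarrow> P x"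
    unfolding eventually_nhds_metric by blast
  then obtain \<zeta> where "P \<zeta>" "c \<le> f \<zeta>" using assms[of r] by auto
  then show "c \<le> Sup (f ` {x. P x})" by (intro SUP_upper2[of \<zeta>]) auto
qed

lemma eventually_nhds_cmod: "\<delta> > 0 \<Longrightarrow> \<forall>\<^sub>F \<zeta> in nhds a. cmod (\<zeta> - a) < \<delta>"
  unfolding eventually_nhds_metric by (auto simp: dist_norm)

text \<open>
  The right-hand side of the theorem; \<open>E\<^sub>w\<close> is a truncation of \<open>E\<close> for every \<open>w\<close>, see \<open>E_sub_eq\<close>.
\<close>

definition reg_extremal_2 :: "real \<Rightarrow> ereal" where
  "reg_extremal_2 R = planar_extremal_reg (E_set \<inter> cball 0 R) 2"

lemma reg_extremal_2_le:
  assumes R: "2 \<le> R" "R \<le> 3"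
  shows "reg_extremal_2 R \<le> planar_extremal (trunc m R) 2"
proof (rule ereal_le_epsilon2)
  fix e :: real assume "e > 0"
  then obtain \<delta> where \<delta>: "\<delta> > 0"
    "\<And>R' \<zeta>'. R' > R - \<delta> \<Longrightarrow> cmod (\<zeta>' - 2) < \<delta> \<Longrightarrow> planar_extremal (trunc m R') \<zeta>' \<le> planar_extremal (trunc m R) 2 + ereal e"
    using trunc_stability[OF R] by metis
  have "\<forall>\<^sub>F \<zeta> in nhds 2. planar_extremal (E_set \<inter> cball 0 R) \<zeta> \<le> planar_extremal (trunc m R) 2 + ereal e"
    using eventually_nhds_cmod[OF \<delta>(1)]
  proof eventually_elim
    case (elim \<zeta>)
    have "planar_extremal (E_set \<inter> cball 0 R) \<zeta> \<le> planar_extremal (trunc m R) \<zeta>"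
      using R by (intro planar_extremal_antimono trunc_subset_E) auto
    also have "\<dots> \<le> planar_extremal (trunc m R) 2 + ereal e" using elim \<delta> by (intro \<delta>(2)) auto
    finally show ?case .
  qed
  then show "reg_extremal_2 R \<le> planar_extremal (trunc m R) 2 + ereal e"
    unfolding reg_extremal_2_def planar_extremal_reg_eq by (rule Limsup_bounded)
qed

text \<open>
  A competitor for finitely many discs becomes one for the whole truncated set when a penalty is added. The
  index \<open>m0\<close> depends on \<open>\<epsilon>\<close> alone.
\<close>

lemma reg_extremal_2_ge:
  assumes \<epsilon>: "0 < \<epsilon>" "\<epsilon> < 1"
  obtains m0 where "\<And>m R. m \<ge> m0 \<Longrightarrow> ereal (1 - \<epsilon>) * planar_extremal (trunc m R) 2 - ereal \<epsilon> \<le> reg_extremal_2 R"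
proof -
  obtain m0 where m0: "\<And>m r0. m \<ge> m0 \<Longrightarrow> r0 > 0 \<Longrightarrow> \<exists>Q. penalty 2 \<epsilon> m r0 Q"
    using penalty_exists[of 2 \<epsilon>] \<epsilon> by auto
  have main: "ereal (1 - \<epsilon>) * s 2 - ereal \<epsilon> \<le> reg_extremal_2 R" if m: "m \<ge> m0" and s: "s \<in> planar_class (trunc m R)" for m R s
  proof -
    define u where "u z = max (s z) 0" for z
    have u: "u \<in> planar_class (trunc m R)" unfolding u_def by (rule planar_class_max0[OF s])
    have shu: "subharmonic_at u z" for z by (rule planar_class_subharmonic_at[OF u])
    have u0: "u z \<ge> 0" for z by (simp add: u_def)
    have growth: "u z \<le> ereal (log_plus (cmod z))" for z
      by (rule planar_class_le_log_plus[OF u cball_subset_trunc])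
    have "ereal (1 - \<epsilon>) * u 2 - ereal \<epsilon> \<le> reg_extremal_2 R"
      unfolding reg_extremal_2_def planar_extremal_reg_eq
    proof (rule Limsup_nhds_ge)
      fix r :: real assume "r > 0"
      then obtain Q where Q: "penalty 2 \<epsilon> m r Q" using m0[OF m] by blast
      have "u 2 \<noteq> -\<infinity>" using u0[of 2] by auto
      then obtain \<zeta> where \<zeta>: "cmod (\<zeta> - 2) < r" "ereal (1 - \<epsilon>) * u 2 - ereal \<epsilon> \<le> ereal (1 - \<epsilon>) * u \<zeta> + Q \<zeta>"
        using Q shu unfolding penalty_def by blast
      define c where "c z = ereal (1 - \<epsilon>) * u z + Q z" for z
      have "c \<in> planar_class (E_set \<inter> cball 0 R)"
      proof (rule planar_classI[where ?z0.0=\<zeta> and C=0])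
        show "subharmonic_at c z" for z unfolding c_def using \<epsilon> Q
          by (intro subharmonic_at_add subharmonic_at_cmult shu) (auto simp: penalty_def)
        obtain a where a: "u 2 = ereal a" using u0[of 2] growth[of 2] by (cases "u 2") auto
        then show "c \<zeta> \<noteq> -\<infinity>" using \<zeta>(2) unfolding c_def[symmetric] by auto
        show "c z \<le> ereal (log_plus (cmod z) + 0)" for z
        proof -
          have "c z \<le> ereal (1 - \<epsilon>) * ereal (log_plus (cmod z)) + ereal (\<epsilon> * log_plus (cmod z))"
            unfolding c_def using \<epsilon> Q growth by (intro add_mono ereal_cmult_mono) (auto simp: penalty_def)
          then show ?thesis by (simp add: algebra_simps)
        qed
        fix z assume z: "z \<in> E_set \<inter> cball 0 R"
        have bad: "c z \<le> 0" if "Q z \<le> ereal (- 2)" "cmod z \<le> 3"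
        proof -
          have "log_plus (cmod z) \<le> 2" using that by (intro log_plus_le_2) auto
          then have "u z \<le> ereal 2" using growth[of z] by (meson ereal_less_eq(3) order_trans)
          then have "c z \<le> ereal (1 - \<epsilon>) * ereal 2 + ereal (- 2)"
            unfolding c_def using \<epsilon> that by (intro add_mono ereal_cmult_mono) auto
          also have "\<dots> \<le> 0" using \<epsilon> by simp
          finally show ?thesis .
        qed
        show "c z \<le> 0"
        proof (rule E_cases[where z=z and R=R and m=m])
          assume "z = 2" then show ?thesis using bad Q by (simp add: penalty_def)
        next
          assume zt: "z \<in> trunc m R"
          then have "c z \<le> ereal (1 - \<epsilon>) * 0 + 0"
            unfolding c_def using \<epsilon> Q planar_class_le[OF u zt] trunc_norm_le[OF zt]
            by (intro add_mono ereal_cmult_mono) (auto simp: penalty_def)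
          then show ?thesis by simp
        next
          fix j assume "j > m" "z \<in> disc j"
          then show ?thesis using bad Q disc_norm_le[of j z] by (auto simp: penalty_def)
        qed (use z in auto)
      qed
      from planar_extremal_upper[OF this, of \<zeta>] \<zeta> show "\<exists>\<zeta>. dist \<zeta> 2 < r \<and> ereal (1 - \<epsilon>) * u 2 - ereal \<epsilon> \<le> planar_extremal (E_set \<inter> cball 0 R) \<zeta>"
        unfolding c_def dist_norm by (meson order_trans)
    qed
    moreover have "ereal (1 - \<epsilon>) * s 2 - ereal \<epsilon> \<le> ereal (1 - \<epsilon>) * u 2 - ereal \<epsilon>"
      using \<epsilon> by (intro ereal_minus_mono ereal_cmult_mono) (auto simp: u_def)
    ultimately show ?thesis by (rule order_trans[rotated])
  qed
  have "ereal (1 - \<epsilon>) * planar_extremal (trunc m R) 2 - ereal \<epsilon> \<le> reg_extremal_2 R" if m: "m \<ge> m0" for m R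
  proof -
    have "planar_extremal (trunc m R) 2 \<le> ereal (1 / (1 - \<epsilon>)) * (reg_extremal_2 R + ereal \<epsilon>)"
    proof (rule planar_extremal_least)
      fix s assume "s \<in> planar_class (trunc m R)"
      from main[OF m this] show "s 2 \<le> ereal (1 / (1 - \<epsilon>)) * (reg_extremal_2 R + ereal \<epsilon>)"
        using \<epsilon> by (cases "s 2"; cases "reg_extremal_2 R") (auto simp: field_simps)
    qed
    then show ?thesis
      using \<epsilon> by (cases "planar_extremal (trunc m R) 2"; cases "reg_extremal_2 R") (auto simp: field_simps)
  qed
  then show thesis using that by blast
qed

section \<open>Strict monotonicity\<close>

text \<open>
  On the overlap annulus both formulas agree, as \<open>f \<le> W\<close> there; a pole of \<open>f\<close> in the inner disc disappears.
\<close>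

lemma subharmonic_at_glue:
  assumes W: "\<And>z. subharmonic_at W z" and f: "\<And>z. r1 < cmod (z - y) \<Longrightarrow> subharmonic_at f z"
    and le: "\<And>z. r1 < cmod (z - y) \<Longrightarrow> cmod (z - y) < r2 \<Longrightarrow> f z \<le> W z" and r: "r1 < r2"
  shows "subharmonic_at (\<lambda>z. if cmod (z - y) < r2 then W z else max (W z) (f z)) z"
proof (cases "cmod (z - y) < r2")
  case True
  have "\<forall>\<^sub>F w in nhds z. w \<in> {w. cmod (w - y) < r2}"
    using True by (intro eventually_nhds_in_open open_Collect_less continuous_intros) auto
  then have "\<forall>\<^sub>F w in nhds z. W w = (if cmod (w - y) < r2 then W w else max (W w) (f w))"
    by eventually_elim simp
  then show ?thesis using W by (rule subharmonic_at_cong)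
next
  case False
  have "\<forall>\<^sub>F w in nhds z. w \<in> {w. r1 < cmod (w - y)}"
    using False r by (intro eventually_nhds_in_open open_Collect_less continuous_intros) auto
  then have "\<forall>\<^sub>F w in nhds z. max (W w) (f w) = (if cmod (w - y) < r2 then W w else max (W w) (f w))"
    by eventually_elim (use le in \<open>auto simp: max_absorb1\<close>)
  moreover have "subharmonic_at (\<lambda>w. max (W w) (f w)) z" using W f False r by (intro subharmonic_at_max) auto
  ultimately show ?thesis by (rule subharmonic_at_cong)
qed

text \<open>The right end of the largest disc, which is the point of \<open>E\<close> with the largest modulus.\<close>

definition x_max :: real where
  "x_max = 5/2 + exp (-32)"

lemma x_max_eq: "x_max = p_seq 1 + rho_seq 1"
  by (simp add: x_max_def p_seq_def rho_seq_def)

lemma x_max_le: "x_max \<le> 5/2 + 1/16"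
  using p_seq_bounds[of 1] by (simp add: x_max_eq)

lemma trunc_norm_le_radius: "R \<ge> 1 \<Longrightarrow> z \<in> trunc m R \<Longrightarrow> cmod z \<le> R"
  by (auto simp: trunc_def)

lemma trunc_mono: "R \<le> R' \<Longrightarrow> trunc m R \<subseteq> trunc m R'"
  by (auto simp: trunc_def)

text \<open>
  \<open>G\<close> is the Green function of the half-plane \<open>Re z > x_max\<close> with pole \<open>y\<close> just to the right of \<open>x_max\<close>, extended by
  the same formula; it is nonpositive on the other side, which contains the compact set. Close to \<open>y\<close> the
  function \<open>W0 = ln (|z| / R)\<close> is about \<open>\<kappa> > 0\<close>, whereas competitors for \<open>trunc m 3\<close> are smaller than \<open>\<kappa> / 2\<close> by the
  estimate outside the first disc. So \<open>u + c G\<close> can be glued to \<open>W0\<close> at a small circle around \<open>y\<close>.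
\<close>

lemma first_lift:
  assumes R: "2 \<le> R" "R < x_max"
  obtains g where "g > 0"
    "\<And>m u. m \<ge> 1 \<Longrightarrow> u \<in> planar_class (trunc m 3) \<Longrightarrow>
      \<exists>W \<in> planar_class (trunc m R). \<forall>z. cmod (z - 3) \<le> 1/4 \<longrightarrow> u z + ereal g \<le> W z"
proof -
  define \<rho> where "\<rho> = rho_seq 1"
  have \<rho>: "\<rho> > 0" "\<rho> \<le> 1/16" "x_max = 5/2 + \<rho>"
    using rho_seq_pos[of 1] p_seq_bounds[of 1] by (auto simp: \<rho>_def x_max_eq p_seq_def)
  define \<kappa> where "\<kappa> = ln (x_max / R)"
  have \<kappa>: "\<kappa> > 0" "\<kappa> = ln x_max - ln R" using R by (auto simp: \<kappa>_def ln_div)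
  \<comment> \<open>Within distance \<open>\<rho> + 2 s\<close> of the centre of the first disc competitors are at most \<open>2 s / \<rho> \<le> \<kappa> / 2\<close>.\<close>
  define s where "s = min (\<kappa> * \<rho> / 4) (1/20)"
  have s: "s > 0" "s \<le> 1/20" "2 * s / \<rho> \<le> \<kappa> / 2"
  proof -
    have "s \<le> \<kappa> * \<rho> / 4" unfolding s_def by (rule min.cobounded1)
    then show "2 * s / \<rho> \<le> \<kappa> / 2" using \<rho>(1) by (simp add: field_simps)
    show "s > 0" unfolding s_def using \<kappa> \<rho> by auto
    show "s \<le> 1/20" unfolding s_def by (rule min.cobounded2)
  qed
  define y where "y = complex_of_real (x_max + s)"
  define y' where "y' = complex_of_real (x_max - s)"
  define G where "G z = log_dist y' z + ereal (- 1 * ln (cmod (z - y)))" for z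
  define W0 where "W0 z = log_dist 0 z + ereal (- ln R)" for z
  \<comment> \<open>\<open>G \<le> 4\<close> off the small disc, so \<open>c G\<close> contributes at most the other \<open>\<kappa> / 2\<close>.\<close>
  define c where "c = \<kappa> / 8"
  have c: "c > 0" using \<kappa> by (simp add: c_def)
  have yy': "cmod (y - y') = 2 * s"
    unfolding y_def y'_def of_real_diff[symmetric] norm_of_real using s by simp
  have G_less: "G z < \<infinity>" for z by (simp add: G_def log_dist_def)
  have shG: "subharmonic_at G z" if "z \<noteq> y" for z
    unfolding G_def by (intro subharmonic_at_add subharmonic_at_log_dist subharmonic_at_ln_dist that)
  have G_le: "G z \<le> ereal 4" if "cmod (z - y) \<ge> s / 2" for z
  proof (cases "z = y'")
    case False
    have "cmod (z - y') \<le> cmod (z - y) + 2 * s" using norm_triangle_ineq[of "z - y" "y - y'"] yy' by simp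
    also have "\<dots> \<le> 5 * cmod (z - y)" using that by simp
    finally have "ln (cmod (z - y')) \<le> ln (5 * cmod (z - y))" using False by (intro ln_mono) auto
    also have "\<dots> = ln 5 + ln (cmod (z - y))" using that s by (intro ln_mult_pos) auto
    also have "ln (5::real) \<le> 4" using ln_le_minus_one[of 5] by simp
    finally show ?thesis using False by (simp add: G_def log_dist_def)
  qed (simp add: G_def log_dist_def)
  have normsq: "(cmod (z - y'))\<^sup>2 = (cmod (z - y))\<^sup>2 + 4 * s * (Re z - x_max)" for z
    unfolding cmod_power2 y_def y'_def by (simp add: power2_eq_square algebra_simps)
  have G_nonpos: "G z \<le> 0" if "Re z \<le> x_max" for z
  proof (cases "z = y'")
    case False
    have "4 * s * (Re z - x_max) \<le> 0" using s that by (simp add: mult_nonneg_nonpos)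
    then have "(cmod (z - y'))\<^sup>2 \<le> (cmod (z - y))\<^sup>2" using normsq[of z] by linarith
    then have "cmod (z - y') \<le> cmod (z - y)" by (rule power2_le_imp_le) simp
    then have "ln (cmod (z - y')) \<le> ln (cmod (z - y))" using False by (intro ln_mono) auto
    then show ?thesis using False by (simp add: G_def log_dist_def)
  qed (simp add: G_def log_dist_def)
  define h where "h = ln (sqrt (1 + s / 2))"
  have h: "h > 0" using s by (auto simp: h_def intro!: ln_gt_zero)
  have near3: "s \<le> cmod (z - y)" "G z \<ge> ereal h" if z: "cmod (z - 3) \<le> 1/4" for z
  proof -
    have "\<bar>Re (z - 3)\<bar> \<le> cmod (z - 3)" by (rule abs_Re_le_cmod)
    then have Re: "Re z \<ge> 11/4" using z by simp
    have "Re z - (x_max + s) = Re (z - y)" by (simp add: y_def)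
    also have "\<dots> \<le> cmod (z - y)" by (rule complex_Re_le_cmod)
    finally have "Re z - (x_max + s) \<le> cmod (z - y)" .
    then show sz: "s \<le> cmod (z - y)" using Re s x_max_le by linarith
    have "cmod (3 - y) = \<bar>3 - (x_max + s)\<bar>"
      unfolding y_def using norm_of_real[of "3 - (x_max + s)", where 'a=complex] by simp
    also have "\<dots> \<le> 1/2" using s x_max_le \<rho> by simp
    finally have y1: "cmod (z - y) \<le> 1" using z norm_triangle_ineq[of "z - 3" "3 - y"] by simp
    have "(1 + s / 2) * (cmod (z - y))\<^sup>2 \<le> (cmod (z - y))\<^sup>2 + 4 * s * (Re z - x_max)"
    proof -
      have "s / 2 * (cmod (z - y))\<^sup>2 \<le> s / 2 * 1" using y1 s by (intro mult_left_mono) (auto simp: power_le_one)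
      also have "\<dots> \<le> 4 * s * (1/8)" by simp
      also have "\<dots> \<le> 4 * s * (Re z - x_max)" using Re x_max_le s by (intro mult_left_mono) auto
      finally show ?thesis by (simp add: algebra_simps)
    qed
    then have "(1 + s / 2) * (cmod (z - y))\<^sup>2 \<le> (cmod (z - y'))\<^sup>2" using normsq[of z] by simp
    then have "sqrt ((1 + s / 2) * (cmod (z - y))\<^sup>2) \<le> sqrt ((cmod (z - y'))\<^sup>2)" by (rule real_sqrt_le_mono)
    then have le: "sqrt (1 + s / 2) * cmod (z - y) \<le> cmod (z - y')" by (simp add: real_sqrt_mult)
    have pos: "sqrt (1 + s / 2) > 0" "cmod (z - y) > 0" using s sz by auto
    have "h + ln (cmod (z - y)) = ln (sqrt (1 + s / 2) * cmod (z - y))"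
      unfolding h_def by (rule ln_mult_pos[symmetric]) (use pos in auto)
    also have "\<dots> \<le> ln (cmod (z - y'))" using le pos by (intro ln_mono) auto
    finally have "h + ln (cmod (z - y)) \<le> ln (cmod (z - y'))" .
    moreover have "cmod (z - y') > 0" using le mult_pos_pos[OF pos] by linarith
    then have "z \<noteq> y'" by auto
    ultimately show "G z \<ge> ereal h" by (simp add: G_def log_dist_def)
  qed
  have shW0: "subharmonic_at W0 z" for z unfolding W0_def by (intro subharmonic_at_add_const subharmonic_at_log_dist)
  have "\<exists>W \<in> planar_class (trunc m R). \<forall>z. cmod (z - 3) \<le> 1/4 \<longrightarrow> u z + ereal (c * h) \<le> W z"
    if m: "m \<ge> 1" and u: "u \<in> planar_class (trunc m 3)" for m u
  proof -
    have disc1: "disc 1 \<subseteq> trunc m 3" using m disc_norm_le[of 1] unfolding trunc_def by auto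
    define f where "f z = u z + ereal c * G z" for z
    define W where "W z = (if cmod (z - y) < s then W0 z else max (W0 z) (f z))" for z
    have shf: "subharmonic_at f z" if "z \<noteq> y" for z
      unfolding f_def using planar_class_subharmonic_at[OF u] shG[OF that] c by (intro subharmonic_at_add subharmonic_at_cmult) auto
    have growthf: "f z \<le> ereal (log_plus (cmod z) + 4 * c)" if "cmod (z - y) \<ge> s" for z
    proof -
      have "f z \<le> ereal (log_plus (cmod z)) + ereal c * ereal 4"
        unfolding f_def using that s c
        by (intro add_mono planar_class_le_log_plus[OF u cball_subset_trunc] ereal_cmult_mono G_le) auto
      then show ?thesis by (simp add: mult.commute)
    qed
    have growthW0: "W0 z \<le> ereal (log_plus (cmod z))" for z
    proof -
      have "ln R \<ge> 0" using R by simp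
      then show ?thesis using ln_le_log_plus[of "cmod z"] by (auto simp: W0_def log_dist_def)
    qed
    have "W \<in> planar_class (trunc m R)"
    proof (rule planar_classI[where ?z0.0=1 and C="4 * c"])
      show "subharmonic_at W z" for z
        unfolding W_def
      proof (rule subharmonic_at_glue[where ?r1.0="s / 2"])
        show "subharmonic_at f z" if "s / 2 < cmod (z - y)" for z using that s by (intro shf) auto
        fix z assume z: "s / 2 < cmod (z - y)" "cmod (z - y) < s"
        have yp: "cmod (y - complex_of_real (p_seq 1)) = \<rho> + s"
          unfolding y_def of_real_diff[symmetric] norm_of_real using s \<rho> by (simp add: x_max_eq \<rho>_def)
        have n1: "cmod (z - complex_of_real (p_seq 1)) \<le> \<rho> + 2 * s"
          using norm_triangle_ineq[of "z - y" "y - complex_of_real (p_seq 1)"] yp z by simp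
        have n2: "cmod (z - complex_of_real (p_seq 1)) \<ge> \<rho>"
          using norm_triangle_ineq[of "y - z" "z - complex_of_real (p_seq 1)"] yp z by (simp add: norm_minus_commute)
        have "u z \<le> ereal (ln (cmod (z - complex_of_real (p_seq 1)) / \<rho>))"
          using n2 \<rho> disc1 unfolding \<rho>_def by (intro planar_class_le_disc[OF u]) auto
        also have "ln (cmod (z - complex_of_real (p_seq 1)) / \<rho>) \<le> ln (1 + 2 * s / \<rho>)"
          using n1 n2 \<rho> by (intro ln_mono) (auto simp: field_simps)
        also have "\<dots> \<le> 2 * s / \<rho>" using s \<rho> by (intro ln_add_one_self_le_self) auto
        also have "\<dots> \<le> \<kappa> / 2" by (rule s)
        finally have "u z \<le> ereal (\<kappa> / 2)" by simp
        moreover have "ereal c * G z \<le> ereal c * ereal 4" using z c by (intro ereal_cmult_mono G_le) auto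
        ultimately have "f z \<le> ereal (\<kappa> / 2) + ereal c * ereal 4" unfolding f_def by (rule add_mono)
        also have "\<dots> = ereal \<kappa>" by (simp add: c_def)
        also have "\<dots> \<le> W0 z"
        proof -
          have "\<bar>Re (z - y)\<bar> \<le> cmod (z - y)" by (rule abs_Re_le_cmod)
          then have "x_max \<le> Re z" using z by (simp add: y_def)
          also have "\<dots> \<le> cmod z" by (rule complex_Re_le_cmod)
          finally have "x_max \<le> cmod z" .
          then have "ln x_max \<le> ln (cmod z)" "z \<noteq> 0" using R by (auto intro: ln_mono)
          then show ?thesis unfolding W0_def \<kappa>(2) by (simp add: log_dist_def)
        qed
        finally show "f z \<le> W0 z" .
      qed (use shW0 s in auto)
      have "W0 1 \<noteq> -\<infinity>" by (simp add: W0_def log_dist_def)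
      then show "W 1 \<noteq> -\<infinity>" by (auto simp: W_def max_def)
      show "W z \<le> ereal (log_plus (cmod z) + 4 * c)" for z
      proof -
        have "W0 z \<le> ereal (log_plus (cmod z) + 4 * c)"
          using growthW0[of z] by (rule order_trans) (use c in simp)
        then show ?thesis unfolding W_def using growthf[of z] by auto
      qed
      fix z assume z: "z \<in> trunc m R"
      have zR: "cmod z \<le> R" using trunc_norm_le_radius[OF _ z] R by simp
      have "W0 z \<le> 0"
        using zR R by (cases "z = 0") (auto simp: W0_def log_dist_def)
      moreover have "f z \<le> 0"
      proof -
        have "Re z \<le> x_max" using zR R complex_Re_le_cmod[of z] by simp
        then have "ereal c * G z \<le> ereal c * 0" using c by (intro ereal_cmult_mono G_nonpos) auto
        moreover have "u z \<le> 0" using trunc_mono[of R 3 m] z R x_max_le by (intro planar_class_le[OF u]) auto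
        ultimately have "f z \<le> 0 + ereal c * 0" unfolding f_def by (intro add_mono)
        then show ?thesis by simp
      qed
      ultimately show "W z \<le> 0" unfolding W_def by simp
    qed
    moreover have "u z + ereal (c * h) \<le> W z" if "cmod (z - 3) \<le> 1/4" for z
    proof -
      have "u z + ereal (c * h) = u z + ereal c * ereal h" by simp
      also have "\<dots> \<le> f z" unfolding f_def using near3(2)[OF that] c by (intro add_left_mono ereal_cmult_mono) auto
      also have "\<dots> \<le> W z" unfolding W_def using near3(1)[OF that] by simp
      finally show ?thesis .
    qed
    ultimately show ?thesis by blast
  qed
  then show thesis using that[of "c * h"] c h by (metis mult_pos_pos)
qed

text \<open>
  With pole 3: the logarithm \<open>(3/4) ln |z| - ln |z - 3| + ln 2\<close> is nonpositive on the unit disc and positive at 2. The weights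
  \<open>1 / (4 \<cdot> 2\<^sup>j)\<close> at the centres of the discs make it at most \<open>4.5 ln 2 - 4 < 0\<close> on them and cost at
  most \<open>(5/4) ln 2\<close> at 2, for every number \<open>m\<close> of discs. The total mass is at most 0, so the function is
  bounded above off the pole.
\<close>

lemma second_lift_function:
  obtains G where "\<And>z. z \<noteq> 3 \<Longrightarrow> subharmonic_at G z" "\<And>z. cmod (z - 3) \<ge> 1/8 \<Longrightarrow> G z \<le> ereal 49"
    "\<And>z R. z \<in> trunc m R \<Longrightarrow> G z \<le> 0" "G 2 \<ge> ereal (ln 2 / 2)"
proof -
  define d where "d j = 1 / 4 * (1 / 2 ^ j :: real)" for j :: nat
  have d: "d j > 0" for j by (simp add: d_def)
  define p where "p j = complex_of_real (p_seq j)" for j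
  have pn: "cmod (p j) \<le> 3" if "j \<in> {0<..m}" for j
    using disc_norm_le[of j "p j"] that rho_seq_pos[of j] by (auto simp: p_def intro: less_imp_le)
  define Q where "Q z = (\<Sum>j\<in>{0<..m}. ereal (d j) * scaled_log (p j) z)" for z
  define G where "G z = ereal (3/4) * log_dist 0 z + (ereal (- 1 * ln (cmod (z - 3))) + ereal (ln 2)) + Q z" for z
  have d_sum: "(\<Sum>j\<in>{0<..m}. d j) \<le> 1 / 4"
    unfolding d_def sum_distrib_left[symmetric] using sum_powers[of 0 m] by simp
  have term_nonpos: "ereal (d j) * scaled_log (p j) z \<le> 0" if "j \<in> {0<..m}" "cmod z \<le> 3" for j z
    using ereal_cmult_mono[OF less_imp_le[OF d[of j]] scaled_log_nonpos[OF pn[OF that(1)] that(2)]] by simp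
  have 1: "subharmonic_at G z" if "z \<noteq> 3" for z
    unfolding G_def Q_def by (intro subharmonic_at_add subharmonic_at_add_const subharmonic_at_sum subharmonic_at_cmult subharmonic_at_log_dist subharmonic_at_scaled_log subharmonic_at_ln_dist that d) auto
  have lg_growth: "log_dist 0 z \<le> ereal (log_plus (cmod z))" for z
    by (simp add: log_dist_def ln_le_log_plus)
  have 2: "G z \<le> ereal 49" if z: "cmod (z - 3) \<ge> 1/8" for z
  proof -
    have "Q z \<le> (\<Sum>j\<in>{0<..m}. ereal (d j) * ereal (log_plus (cmod z)))"
      unfolding Q_def by (intro sum_mono ereal_cmult_mono scaled_log_growth pn) (auto intro: less_imp_le[OF d])
    also have "\<dots> = ereal ((\<Sum>j\<in>{0<..m}. d j) * log_plus (cmod z))"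
      by (simp add: sum_distrib_right)
    also have "\<dots> \<le> ereal (1 / 4 * log_plus (cmod z))"
      unfolding ereal_less_eq(3) using d_sum log_plus_nonneg[of "cmod z"] by (rule mult_right_mono)
    finally have "G z \<le> ereal (3/4) * ereal (log_plus (cmod z)) + (ereal (- 1 * ln (cmod (z - 3))) + ereal (ln 2)) + ereal (1 / 4 * log_plus (cmod z))"
      unfolding G_def using lg_growth[of z] by (intro add_mono ereal_cmult_mono order_refl) auto
    also have "\<dots> = ereal (log_plus (cmod z) - ln (cmod (z - 3)) + ln 2)" by (simp add: field_simps)
    also have "\<dots> \<le> ereal 49"
    proof -
      have "cmod z \<le> cmod (z - 3) + 3" using norm_triangle_ineq[of "z - 3" 3] by simp
      then have "log_plus (cmod z) \<le> ln (25 * cmod (z - 3))" using z by (intro log_plus_le_ln) auto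
      also have "\<dots> = ln 25 + ln (cmod (z - 3))" using z by (intro ln_mult_pos) auto
      also have "ln (25::real) \<le> 24" using ln_le_minus_one[of 25] by simp
      finally show ?thesis using ln_2_less_1 by simp
    qed
    finally show ?thesis .
  qed
  have 3: "G z \<le> 0" if zt: "z \<in> trunc m R" for z R
  proof -
    have zn: "cmod z \<le> 3" by (rule trunc_norm_le[OF zt])
    consider "cmod z \<le> 1" | j where "j \<in> {0<..m}" "z \<in> disc j"
      using zt unfolding trunc_def by (auto simp: Suc_le_eq)
    then show ?thesis
    proof cases
      case 1
      have "3 \<le> cmod (z - 3) + cmod z" using norm_triangle_ineq[of "3 - z" z] by (simp add: norm_minus_commute)
      then have "cmod (z - 3) \<ge> 2" using 1 by simp
      then have "ln 2 \<le> ln (cmod (z - 3))" by (intro ln_mono) auto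
      then have a: "ereal (- 1 * ln (cmod (z - 3))) + ereal (ln 2) \<le> 0" by simp
      have "Q z \<le> 0" unfolding Q_def using term_nonpos[OF _ zn] by (intro sum_nonpos) auto
      moreover have "ereal (3/4) * log_dist 0 z \<le> ereal (3/4) * 0"
        using lg_growth[of z] 1 log_plus_le_ln[of "cmod z" 1] by (intro ereal_cmult_mono) (auto simp: log_dist_def)
      ultimately have "G z \<le> ereal (3/4) * 0 + 0 + 0" unfolding G_def using a by (intro add_mono)
      then show ?thesis by simp
    next
      case 2
      have j: "j \<ge> 1" using 2 by auto
      have "\<bar>Re (z - complex_of_real (p_seq j))\<bar> \<le> cmod (z - complex_of_real (p_seq j))" by (rule abs_Re_le_cmod)
      also have "\<dots> \<le> rho_seq j" using 2 by (simp add: dist_norm norm_minus_commute)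
      finally have "Re z \<le> p_seq j + rho_seq j" by simp
      then have "Re (3 - z) \<ge> 1/4" using p_seq_bounds(2,3)[OF j] by simp
      then have "cmod (z - 3) \<ge> 1/4" using complex_Re_le_cmod[of "3 - z"] by (simp add: norm_minus_commute)
      then have "ln (1/4) \<le> ln (cmod (z - 3))" by (intro ln_mono) auto
      moreover have l4: "ln (4::real) = 2 * ln 2" using ln_realpow[of 2 2] by simp
      ultimately have "- 1 * ln (cmod (z - 3)) + ln 2 \<le> 3 * ln 2" by (simp add: ln_div)
      then have a: "ereal (- 1 * ln (cmod (z - 3))) + ereal (ln 2) \<le> ereal (3 * ln 2)" by simp
      have "log_dist 0 z \<le> ereal (ln 4)" using zn by (auto simp: log_dist_def)
      then have b: "ereal (3/4) * log_dist 0 z \<le> ereal (3/4) * ereal (ln 4)" by (intro ereal_cmult_mono) auto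
      have "Q z \<le> ereal (d j) * scaled_log (p j) z"
        unfolding Q_def using 2 term_nonpos zn by (intro sum_ereal_le_member) auto
      also have "\<dots> \<le> ereal (d j) * ereal (ln (rho_seq j / 8))"
        using 2 by (intro ereal_cmult_mono less_imp_le[OF d] scaled_log_le rho_seq_pos) (simp add: p_def dist_norm norm_minus_commute)
      also have "\<dots> \<le> ereal (- 4)"
      proof -
        have "ln (rho_seq j / 8) = - 16 * 2 ^ j - ln 8"
          by (subst ln_div) (auto simp: rho_seq_def)
        also have "\<dots> \<le> - 16 * 2 ^ j" by simp
        finally have "d j * ln (rho_seq j / 8) \<le> d j * (- 16 * 2 ^ j)"
          by (intro mult_left_mono less_imp_le[OF d])
        also have "\<dots> = - 4" by (simp add: d_def)
        finally show ?thesis by simp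
      qed
      finally have "Q z \<le> ereal (- 4)" .
      then have "G z \<le> ereal (3/4) * ereal (ln 4) + ereal (3 * ln 2) + ereal (- 4)"
        unfolding G_def using a b by (intro add_mono)
      also have "\<dots> \<le> 0" unfolding l4 using ln2_le_25_over_36 by simp
      finally show ?thesis .
    qed
  qed
  have 4: "G 2 \<ge> ereal (ln 2 / 2)"
  proof -
    have t: "ereal (d j) * scaled_log (p j) 2 = ereal (- (1 / 4 * ln 2) * ((real j + 3) / 2 ^ j))" for j
    proof -
      have "2 - p j = complex_of_real (- (1 / 2 ^ j))" by (simp add: p_def p_seq_def)
      then have n: "cmod (2 - p j) = 1 / 2 ^ j" by (simp only: norm_of_real abs_minus_cancel) simp
      have "2 \<noteq> p j" using n by auto
      moreover have "ln (8::real) = 3 * ln 2" using ln_realpow[of 2 3] by simp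
      ultimately show ?thesis
        by (simp add: scaled_log_eq n ln_div ln_mult ln_realpow d_def field_simps)
    qed
    have Q2: "Q 2 = ereal (- (1 / 4 * ln 2) * (5 - (real m + 5) / 2 ^ m))"
      unfolding Q_def t sum_ereal sum_distrib_left[symmetric] using sum_weighted_powers[of 0 m] by simp
    have "(real m + 5) / 2 ^ m * ln 2 \<ge> 0" by simp
    then show ?thesis unfolding G_def Q2 by (simp add: log_dist_def algebra_simps)
  qed
  show thesis using that[of G] 1 2 3 4 by blast
qed

text \<open>
  The gain near 3 is carried on to 2. The constant \<open>\<gamma>\<close> is the same for all \<open>m\<close> and thus survives the limit.
\<close>

lemma trunc_strict:
  assumes R: "2 \<le> R" "R < x_max"
  obtains \<gamma> where "\<gamma> > 0" "\<And>m. m \<ge> 1 \<Longrightarrow> planar_extremal (trunc m 3) 2 + ereal \<gamma> \<le> planar_extremal (trunc m R) 2"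
proof -
  obtain g where g: "g > 0" "\<And>m u. m \<ge> 1 \<Longrightarrow> u \<in> planar_class (trunc m 3) \<Longrightarrow>
      \<exists>W \<in> planar_class (trunc m R). \<forall>z. cmod (z - 3) \<le> 1/4 \<longrightarrow> u z + ereal g \<le> W z"
    using first_lift[OF R] by blast
  define c where "c = g / 49"
  have c: "c > 0" using g by (simp add: c_def)
  have "planar_extremal (trunc m 3) 2 + ereal (c * (ln 2 / 2)) \<le> planar_extremal (trunc m R) 2" if m: "m \<ge> 1" for m
  proof -
    obtain G where G: "\<And>z. z \<noteq> 3 \<Longrightarrow> subharmonic_at G z" "\<And>z. cmod (z - 3) \<ge> 1/8 \<Longrightarrow> G z \<le> ereal 49"
      "\<And>z R. z \<in> trunc m R \<Longrightarrow> G z \<le> 0" "G 2 \<ge> ereal (ln 2 / 2)"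
      using second_lift_function[of m] by blast
    have "u 2 + ereal (c * (ln 2 / 2)) \<le> planar_extremal (trunc m R) 2" if u: "u \<in> planar_class (trunc m 3)" for u
    proof -
      obtain W0 where W0: "W0 \<in> planar_class (trunc m R)" "\<And>z. cmod (z - 3) \<le> 1/4 \<Longrightarrow> u z + ereal g \<le> W0 z"
        using g(2)[OF m u] by blast
      obtain C z0 where C: "\<And>z. W0 z \<le> ereal (log_plus (cmod z) + C)" and z0: "W0 z0 \<noteq> -\<infinity>"
        using W0(1) unfolding planar_class_def by blast
      define f where "f z = u z + ereal c * G z" for z
      define W where "W z = (if cmod (z - 3) < 1/4 then W0 z else max (W0 z) (f z))" for z
      have cG: "ereal c * G z \<le> ereal g" if "cmod (z - 3) \<ge> 1/8" for z
        using ereal_cmult_mono[OF less_imp_le[OF c] G(2)[OF that]] by (simp add: c_def)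
      have "W \<in> planar_class (trunc m R)"
      proof (rule planar_classI[where ?z0.0=z0 and C="max C g"])
        show "subharmonic_at W z" for z
          unfolding W_def
        proof (rule subharmonic_at_glue[where ?r1.0="1/8"])
          show "subharmonic_at f z" if "1/8 < cmod (z - 3)" for z
            unfolding f_def using that planar_class_subharmonic_at[OF u] c
            by (intro subharmonic_at_add subharmonic_at_cmult G(1)) auto
          show "f z \<le> W0 z" if "1/8 < cmod (z - 3)" "cmod (z - 3) < 1/4" for z
          proof -
            have "f z \<le> u z + ereal g" unfolding f_def using that by (intro add_left_mono cG) auto
            also have "\<dots> \<le> W0 z" using that by (intro W0(2)) auto
            finally show ?thesis .
          qed
        qed (use planar_class_subharmonic_at[OF W0(1)] in auto)
        show "W z0 \<noteq> -\<infinity>" using z0 by (auto simp: W_def max_def)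
        show "W z \<le> ereal (log_plus (cmod z) + max C g)" for z
        proof -
          have "W0 z \<le> ereal (log_plus (cmod z) + max C g)"
            using C[of z] by (rule order_trans) simp
          moreover have "f z \<le> ereal (log_plus (cmod z) + max C g)" if "cmod (z - 3) \<ge> 1/4"
          proof -
            have "f z \<le> ereal (log_plus (cmod z)) + ereal g"
              unfolding f_def using that
              by (intro add_mono planar_class_le_log_plus[OF u cball_subset_trunc] cG) auto
            also have "\<dots> \<le> ereal (log_plus (cmod z) + max C g)" by simp
            finally show ?thesis .
          qed
          ultimately show ?thesis unfolding W_def by auto
        qed
        fix z assume z: "z \<in> trunc m R"
        have "ereal c * G z \<le> ereal c * 0" using c z by (intro ereal_cmult_mono G(3)) auto
        moreover have "u z \<le> 0" using trunc_mono[of R 3 m] z R x_max_le by (intro planar_class_le[OF u]) auto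
        ultimately have "f z \<le> 0 + ereal c * 0" unfolding f_def by (intro add_mono)
        then show "W z \<le> 0" unfolding W_def using planar_class_le[OF W0(1) z] by simp
      qed
      then have "W 2 \<le> planar_extremal (trunc m R) 2" by (rule planar_extremal_upper)
      moreover have "u 2 + ereal c * ereal (ln 2 / 2) \<le> f 2"
        unfolding f_def using G(4) c by (intro add_left_mono ereal_cmult_mono) auto
      moreover have "f 2 \<le> W 2" unfolding W_def by simp
      ultimately show ?thesis by simp
    qed
    then have "planar_extremal (trunc m 3) 2 \<le> planar_extremal (trunc m R) 2 - ereal (c * (ln 2 / 2))"
      by (intro planar_extremal_least) (simp add: ereal_le_minus)
    then show ?thesis by (simp add: ereal_le_minus)
  qed
  then show thesis using that[of "c * (ln 2 / 2)"] c by simp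
qed

section \<open>The upper bound on complex lines through the origin\<close>

lemma norm_cmult_vec: "norm (c *s x) = cmod c * norm (x :: complex^'n)"
  by (simp add: norm_vec_def norm_mult L2_set_right_distrib)

lemma weight_continuous: "admissible_weight b \<Phi> \<Longrightarrow> isCont \<Phi> z"
proof -
  assume "admissible_weight b \<Phi>"
  then have "Ck 0 \<Phi>" unfolding admissible_weight_def Cinfinity_def by blast
  then show ?thesis by (simp add: continuous_on_eq_continuous_at)
qed

text \<open>
  The function \<open>s\<close> in the proof is the planar competitor obtained from \<open>u\<close> on the line through \<open>z\<close>. It is
  subharmonic at the points of the closed unit disc because it attains its minimum 0 there.
\<close>

lemma extremal_le_on_lines:
  fixes \<Phi> :: "complex^('m::finite option) \<Rightarrow> real"
  assumes \<Phi>: "admissible_weight b \<Phi>" and \<tau>: "\<tau> > 0" and h: "h > 0" and R: "R \<ge> 1"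
    and z1: "cmod (z $ None) > 1" and zj: "\<And>j. R * cmod (z $ Some j) \<le> cmod (z $ None)"
  shows "extremal (\<tau> + h) K_set (psi \<Phi> \<tau>) z \<le> ereal (\<tau> * \<Phi> z) + ereal h * planar_extremal (trunc m R) (z $ None)"
  unfolding extremal_def
proof (rule SUP_least)
  fix u assume u: "u \<in> {u \<in> lelong (\<tau> + h). \<forall>x\<in>K_set. u x \<le> ereal (psi \<Phi> \<tau> x)}"
  then obtain C0 where C0: "\<And>x. u x \<le> ereal ((\<tau> + h) * log_plus (norm x) + C0)"
    unfolding lelong_def by blast
  have psh: "psh u" and uK: "\<And>x. x \<in> K_set \<Longrightarrow> u x \<le> ereal (\<tau> * \<Phi> x)"
    using u unfolding lelong_def psi_def by blast+
  define a where "a = (1 / z $ None) *s z"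
  have nz: "z $ None \<noteq> 0" using z1 by auto
  have za: "z = z $ None *s a" unfolding a_def using nz by (simp add: vector_smult_assoc)
  have a1: "a $ None = 1" unfolding a_def using nz by simp
  have na: "norm a \<ge> 1"
  proof -
    have "norm (a $ None) \<le> norm a" by (rule Finite_Cartesian_Product.norm_nth_le)
    then show ?thesis by (simp add: a1)
  qed
  define v where "v \<zeta> = u (0 + \<zeta> *s a)" for \<zeta>
  have "subharmonic v" using psh unfolding psh_def v_def by blast
  then have shv: "subharmonic_at v \<zeta>" for \<zeta> unfolding subharmonic_iff_local by blast
  define f where "f \<zeta> = ereal (1 / h) * (v \<zeta> + ereal (- \<tau> * ln (cmod (\<zeta> - 0)) + (- \<tau> * (ln (norm a) + b))))" for \<zeta>
  define s where "s \<zeta> = (if cmod \<zeta> \<le> 1 then 0 else max 0 (f \<zeta>))" for \<zeta>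
  have shf: "subharmonic_at f \<zeta>" if "\<zeta> \<noteq> 0" for \<zeta>
  proof -
    have "subharmonic_at (\<lambda>\<zeta>. v \<zeta> + (ereal (- \<tau> * ln (cmod (\<zeta> - 0))) + ereal (- \<tau> * (ln (norm a) + b)))) \<zeta>"
      by (intro subharmonic_at_add subharmonic_at_add_const subharmonic_at_ln_dist shv that)
    then show ?thesis unfolding f_def using h by (intro subharmonic_at_cmult) auto
  qed
  have \<Phi>line: "\<Phi> (\<zeta> *s a) = ln (cmod \<zeta>) + ln (norm a) + b" if "cmod \<zeta> \<ge> 1" for \<zeta>
  proof -
    have "1 * 1 \<le> cmod \<zeta> * norm a" using that na by (intro mult_mono) auto
    then have "\<Phi> (\<zeta> *s a) = ln (cmod \<zeta> * norm a) + b"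
      using \<Phi> unfolding admissible_weight_def by (simp add: norm_cmult_vec)
    also have "ln (cmod \<zeta> * norm a) = ln (cmod \<zeta>) + ln (norm a)" using that na by (intro ln_mult_pos) auto
    finally show ?thesis .
  qed
  have lineK: "\<zeta> *s a \<in> K_set" if "\<zeta> \<in> trunc m R" for \<zeta>
  proof -
    have "cmod \<zeta> * cmod (z $ Some j) \<le> R * cmod (z $ Some j)" for j
      using trunc_norm_le_radius[OF R that] by (intro mult_right_mono) auto
    then have "cmod \<zeta> * cmod (z $ Some j) \<le> cmod (z $ None)" for j
      using zj order_trans by blast
    then have "cmod \<zeta> * cmod (z $ Some j) / cmod (z $ None) \<le> 1" for j
      using z1 by (subst divide_le_eq_1_pos) auto
    then have "cmod (\<zeta> * (z $ Some j / z $ None)) \<le> 1" for j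
      by (simp add: norm_mult norm_divide)
    moreover have "\<zeta> \<in> E_set" using trunc_subset_E[OF R] that by blast
    ultimately show ?thesis
      unfolding K_set_def polydisc_def using nz by (simp add: a_def)
  qed
  have f_nonpos: "f \<zeta> \<le> 0" if "\<zeta> \<in> trunc m R" "cmod \<zeta> \<ge> 1" for \<zeta>
  proof -
    have "v \<zeta> \<le> ereal (\<tau> * (ln (cmod \<zeta>) + ln (norm a) + b))"
      unfolding v_def \<Phi>line[OF that(2), symmetric] using uK[OF lineK[OF that(1)]] by simp
    then have "v \<zeta> + ereal (- \<tau> * ln (cmod (\<zeta> - 0)) + (- \<tau> * (ln (norm a) + b))) \<le> 0"
      by (cases "v \<zeta>") (auto simp: algebra_simps)
    then show ?thesis unfolding f_def using ereal_cmult_mono[of "1 / h" _ 0] h by simp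
  qed
  have sh_out: "subharmonic_at s \<zeta>" if "cmod \<zeta> > 1" for \<zeta>
  proof -
    have "\<forall>\<^sub>F w in nhds \<zeta>. w \<in> {w. 1 < cmod w}"
      using that by (intro eventually_nhds_in_open open_Collect_less continuous_intros) auto
    then have "\<forall>\<^sub>F w in nhds \<zeta>. max 0 (f w) = s w"
      by eventually_elim (simp add: s_def)
    moreover have "\<zeta> \<noteq> 0" using that by auto
    then have "subharmonic_at (\<lambda>w. max 0 (f w)) \<zeta>"
      using subharmonic_at_const[of 0] by (intro subharmonic_at_max shf) (auto simp: zero_ereal_def)
    ultimately show ?thesis by (rule subharmonic_at_cong)
  qed
  have usc_s: "usc_at s \<zeta>" for \<zeta>
  proof (cases "cmod \<zeta> > 1")
    case False
    show ?thesis
    proof (cases "cmod \<zeta> = 1")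
      case True
      have "f \<zeta> \<le> 0" using True by (intro f_nonpos) (auto simp: trunc_def)
      have "\<zeta> \<noteq> 0" using True by auto
      show ?thesis
        unfolding usc_at_def
      proof (intro allI impI)
        fix c assume "s \<zeta> < c"
        then have c: "0 < c" using True by (simp add: s_def)
        then have "f \<zeta> < c" using \<open>f \<zeta> \<le> 0\<close> by (rule le_less_trans[rotated])
        then have "\<forall>\<^sub>F w in nhds \<zeta>. f w < c" using subharmonic_at_usc[OF shf[OF \<open>\<zeta> \<noteq> 0\<close>]] unfolding usc_at_def by blast
        then show "\<forall>\<^sub>F w in nhds \<zeta>. s w < c" by eventually_elim (use c in \<open>simp add: s_def\<close>)
      qed
    next
      assume "cmod \<zeta> \<noteq> 1"
      then have "\<forall>\<^sub>F w in nhds \<zeta>. w \<in> ball 0 1"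
        using False by (intro eventually_nhds_in_open) auto
      then have ev: "\<forall>\<^sub>F w in nhds \<zeta>. ereal 0 = s w" by eventually_elim (simp add: s_def zero_ereal_def)
      then show ?thesis using usc_at_cong[OF ev] usc_at_real[where f="\<lambda>_. 0" and z=\<zeta>] by simp
    qed
  qed (use sh_out subharmonic_at_usc in blast)
  have fin_s: "s \<zeta> < \<infinity>" for \<zeta>
  proof (cases "cmod \<zeta> > 1")
    case True
    then show ?thesis using sh_out subharmonic_at_less_infty by blast
  qed (simp add: s_def)
  have s_nonneg: "0 \<le> s \<zeta>" for \<zeta> by (simp add: s_def)
  have shs: "subharmonic_at s \<zeta>" for \<zeta>
  proof (cases "cmod \<zeta> > 1")
    case False
    then have "s \<zeta> = ereal 0" by (simp add: s_def zero_ereal_def)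
    also have "ereal 0 = circle_mean (\<lambda>_. ereal 0)" by (rule circle_mean_const[symmetric])
    also have "\<dots> \<le> mean_on_circle s \<zeta> r" for r
      using s_nonneg by (intro circle_mean_mono) (simp add: zero_ereal_def)
    finally show ?thesis unfolding subharmonic_at_def using usc_s fin_s by (auto intro: exI[of _ 1])
  qed (rule sh_out)
  define C where "C = ln (norm a) + \<bar>C0 - \<tau> * b\<bar> / h"
  have "ln (norm a) \<ge> 0" using na by simp
  have C: "C \<ge> 0" unfolding C_def using \<open>ln (norm a) \<ge> 0\<close> h by (intro add_nonneg_nonneg divide_nonneg_pos) auto
  have "s \<in> planar_class (trunc m R)"
  proof (rule planar_classI[where ?z0.0=0 and C=C])
    show "subharmonic_at s \<zeta>" for \<zeta> by (rule shs)
    show "s 0 \<noteq> -\<infinity>" by (simp add: s_def)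
    show "s \<zeta> \<le> 0" if "\<zeta> \<in> trunc m R" for \<zeta> using f_nonpos[OF that] by (simp add: s_def)
    show "s \<zeta> \<le> ereal (log_plus (cmod \<zeta>) + C)" for \<zeta>
    proof -
      have pos: "0 \<le> ereal (log_plus (cmod \<zeta>) + C)" using log_plus_nonneg[of "cmod \<zeta>"] C by simp
      moreover have "f \<zeta> \<le> ereal (log_plus (cmod \<zeta>) + C)" if "cmod \<zeta> > 1"
      proof -
        have "1 * 1 \<le> cmod \<zeta> * norm a" using that na by (intro mult_mono) auto
        then have "log_plus (norm (\<zeta> *s a)) = ln (cmod \<zeta> * norm a)"
          by (simp add: norm_cmult_vec log_plus_eq)
        also have "\<dots> = ln (cmod \<zeta>) + ln (norm a)" using that na by (intro ln_mult_pos) auto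
        finally have l: "log_plus (norm (\<zeta> *s a)) = ln (cmod \<zeta>) + ln (norm a)" .
        have "v \<zeta> \<le> ereal ((\<tau> + h) * (ln (cmod \<zeta>) + ln (norm a)) + C0)"
          unfolding v_def using C0[of "0 + \<zeta> *s a"] l by simp
        then have "v \<zeta> + ereal (- \<tau> * ln (cmod (\<zeta> - 0)) + (- \<tau> * (ln (norm a) + b)))
            \<le> ereal ((\<tau> + h) * (ln (cmod \<zeta>) + ln (norm a)) + C0) + ereal (- \<tau> * ln (cmod (\<zeta> - 0)) + (- \<tau> * (ln (norm a) + b)))"
          by (rule add_right_mono)
        also have "\<dots> = ereal (h * (ln (cmod \<zeta>) + ln (norm a)) + (C0 - \<tau> * b))"
          by (simp add: algebra_simps)
        finally have "f \<zeta> \<le> ereal (1 / h) * ereal (h * (ln (cmod \<zeta>) + ln (norm a)) + (C0 - \<tau> * b))"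
          unfolding f_def using h by (intro ereal_cmult_mono) auto
        also have "\<dots> = ereal (ln (cmod \<zeta>) + ln (norm a) + (C0 - \<tau> * b) / h)"
          using h by (simp add: field_simps)
        also have "\<dots> \<le> ereal (log_plus (cmod \<zeta>) + C)"
        proof -
          have "(C0 - \<tau> * b) / h \<le> \<bar>C0 - \<tau> * b\<bar> / h" using h by (intro divide_right_mono) auto
          then show ?thesis using ln_le_log_plus[of "cmod \<zeta>"] by (simp add: C_def)
        qed
        finally show ?thesis .
      qed
      ultimately show ?thesis unfolding s_def by auto
    qed
  qed
  then have sV: "s (z $ None) \<le> planar_extremal (trunc m R) (z $ None)" by (rule planar_extremal_upper)
  have "f (z $ None) \<le> s (z $ None)" using z1 by (simp add: s_def)
  with sV have fV: "f (z $ None) \<le> planar_extremal (trunc m R) (z $ None)" by (rule order_trans[rotated])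
  have vz: "v (z $ None) = u z" unfolding v_def using za by simp
  have \<Phi>z: "\<Phi> z = ln (cmod (z $ None)) + ln (norm a) + b" using \<Phi>line[of "z $ None"] za z1 by simp
  have "f (z $ None) = ereal (1 / h) * (u z + ereal (- (\<tau> * \<Phi> z)))"
    unfolding f_def vz \<Phi>z by (simp add: algebra_simps)
  then have "ereal h * (ereal (1 / h) * (u z + ereal (- (\<tau> * \<Phi> z)))) \<le> ereal h * planar_extremal (trunc m R) (z $ None)"
    using fV h by (intro ereal_cmult_mono) auto
  moreover have "ereal h * (ereal (1 / h) * (u z + ereal (- (\<tau> * \<Phi> z)))) = u z + ereal (- (\<tau> * \<Phi> z))"
    using h by (cases "u z") auto
  ultimately have "u z + ereal (- (\<tau> * \<Phi> z)) \<le> ereal h * planar_extremal (trunc m R) (z $ None)" by simp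
  then have "u z + ereal (- (\<tau> * \<Phi> z)) + ereal (\<tau> * \<Phi> z) \<le> ereal h * planar_extremal (trunc m R) (z $ None) + ereal (\<tau> * \<Phi> z)"
    by (rule add_right_mono)
  then show "u z \<le> ereal (\<tau> * \<Phi> z) + ereal h * planar_extremal (trunc m R) (z $ None)"
    by (cases "u z") (auto simp: add.commute)
qed

text \<open>
  For \<open>z\<close> near \<open>(2, w)\<close> the line through \<open>z\<close> leaves the polydisc at a radius that may be slightly smaller than \<open>R\<close>, and
  \<open>z\<^sub>1\<close> differs slightly from 2; both perturbations are controlled by \<open>trunc_stability\<close>.
\<close>

lemma F_ext_le:
  fixes \<Phi> :: "complex^('m::finite option) \<Rightarrow> real" and w :: "complex^'m"
  assumes \<Phi>: "admissible_weight b \<Phi>" and \<tau>: "\<tau> > 0" and h: "h > 0" and R: "2 \<le> R" "R \<le> 3"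
    and w: "\<And>j. R * cmod (w $ j) \<le> 2" and e: "e > 0"
  shows "F_ext \<Phi> \<tau> (\<tau> + h) (pt 2 w) \<le> ereal (\<tau> * \<Phi> (pt 2 w)) + ereal h * (planar_extremal (trunc m R) 2 + ereal e)"
proof -
  obtain \<delta> where \<delta>: "\<delta> > 0"
    "\<And>R' \<zeta>'. R' > R - \<delta> \<Longrightarrow> cmod (\<zeta>' - 2) < \<delta> \<Longrightarrow> planar_extremal (trunc m R') \<zeta>' \<le> planar_extremal (trunc m R) 2 + ereal (e / 2)"
    using trunc_stability[OF R, of "e / 2" m] e by auto
  define R' where "R' = R - min \<delta> 1 / 2"
  have R': "R' > R - \<delta>" "R' \<ge> 1" "R' < R" using R \<delta> by (auto simp: R'_def min_def)
  let ?z0 = "pt 2 w"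
  have pt: "?z0 $ None = 2" "\<And>j. ?z0 $ Some j = w $ j" by (auto simp: pt_def)
  have tend: "((\<lambda>z. z $ i) \<longlongrightarrow> ?z0 $ i) (nhds ?z0)" for i
    by (intro tendsto_vec_nth filterlim_ident)
  have 1: "\<forall>\<^sub>F z in nhds ?z0. cmod (z $ None - 2) < \<delta>"
  proof (rule order_tendstoD(2))
    show "((\<lambda>z. cmod (z $ None - 2)) \<longlongrightarrow> cmod (?z0 $ None - 2)) (nhds ?z0)" by (intro tendsto_intros tend)
  qed (use \<delta> pt in simp)
  have 2: "\<forall>\<^sub>F z in nhds ?z0. 1 < cmod (z $ None)"
  proof (rule order_tendstoD(1))
    show "((\<lambda>z. cmod (z $ None)) \<longlongrightarrow> cmod (?z0 $ None)) (nhds ?z0)" by (intro tendsto_intros tend)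
  qed (use pt in simp)
  have 3: "\<forall>\<^sub>F z in nhds ?z0. \<forall>j. R' * cmod (z $ Some j) - cmod (z $ None) < 0"
  proof (rule eventually_all_finite)
    fix j
    show "\<forall>\<^sub>F z in nhds ?z0. R' * cmod (z $ Some j) - cmod (z $ None) < 0"
    proof (rule order_tendstoD(2))
      show "((\<lambda>z. R' * cmod (z $ Some j) - cmod (z $ None)) \<longlongrightarrow> R' * cmod (?z0 $ Some j) - cmod (?z0 $ None)) (nhds ?z0)"
        by (intro tendsto_intros tend)
      show "R' * cmod (?z0 $ Some j) - cmod (?z0 $ None) < 0"
      proof (cases "w $ j = 0")
        case False
        then have "R' * cmod (w $ j) < R * cmod (w $ j)" using R' by (intro mult_strict_right_mono) auto
        then show ?thesis using w[of j] pt by simp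
      qed (use pt in simp)
    qed
  qed
  have 4: "\<forall>\<^sub>F z in nhds ?z0. \<Phi> z < \<Phi> ?z0 + h * (e / 2) / \<tau>"
  proof (rule order_tendstoD(2))
    show "(\<Phi> \<longlongrightarrow> \<Phi> ?z0) (nhds ?z0)"
      using weight_continuous[OF \<Phi>] by (simp add: isCont_def tendsto_at_iff_tendsto_nhds)
  qed (use h e \<tau> in simp)
  have "\<forall>\<^sub>F z in nhds ?z0. extremal (\<tau> + h) K_set (psi \<Phi> \<tau>) z \<le> ereal (\<tau> * \<Phi> (pt 2 w)) + ereal h * (planar_extremal (trunc m R) 2 + ereal e)"
    using 1 2 3 4
  proof eventually_elim
    case (elim z)
    have "extremal (\<tau> + h) K_set (psi \<Phi> \<tau>) z \<le> ereal (\<tau> * \<Phi> z) + ereal h * planar_extremal (trunc m R') (z $ None)"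
      using elim by (intro extremal_le_on_lines[OF \<Phi> \<tau> h R'(2)]) (auto intro: less_imp_le)
    also have "\<dots> \<le> ereal (\<tau> * \<Phi> ?z0 + h * (e / 2)) + ereal h * (planar_extremal (trunc m R) 2 + ereal (e / 2))"
    proof (intro add_mono ereal_cmult_mono)
      have "\<tau> * \<Phi> z \<le> \<tau> * (\<Phi> ?z0 + h * (e / 2) / \<tau>)" using elim(4) \<tau> by (intro mult_left_mono) auto
      then show "ereal (\<tau> * \<Phi> z) \<le> ereal (\<tau> * \<Phi> ?z0 + h * (e / 2))" using \<tau> by (simp add: algebra_simps)
      show "planar_extremal (trunc m R') (z $ None) \<le> planar_extremal (trunc m R) 2 + ereal (e / 2)" using elim(1) R'(1) by (intro \<delta>(2))
    qed (use h in simp)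
    also have "\<dots> = ereal (\<tau> * \<Phi> (pt 2 w)) + ereal h * (planar_extremal (trunc m R) 2 + ereal e)"
      using h by (cases "planar_extremal (trunc m R) 2") (auto simp: field_simps)
    finally show ?case .
  qed
  then show ?thesis unfolding F_ext_def usc_reg_def by (rule Limsup_bounded)
qed

section \<open>The lower bound by competitors that peak along a line\<close>

text \<open>
  The coordinate of the orthogonal projection of \<open>z\<close> to the line spanned by \<open>a\<close>.
\<close>

definition line_coord :: "complex^'n \<Rightarrow> complex^'n \<Rightarrow> complex" where
  "line_coord a z = (\<Sum>i\<in>UNIV. z $ i * cnj (a $ i)) / complex_of_real ((norm a)\<^sup>2)"

lemma norm_vec_square: "(norm (x :: complex^'n))\<^sup>2 = (\<Sum>i\<in>UNIV. (cmod (x $ i))\<^sup>2)"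
  by (simp add: norm_vec_def L2_set_def sum_nonneg)

lemma line_coord_affine:
  fixes a :: "complex^'n"
  shows "line_coord a (z + t *s c) = line_coord a z + t * line_coord a c"
proof -
  have "(\<Sum>i\<in>UNIV. (z + t *s c) $ i * cnj (a $ i)) = (\<Sum>i\<in>UNIV. z $ i * cnj (a $ i)) + t * (\<Sum>i\<in>UNIV. c $ i * cnj (a $ i))"
    by (simp add: sum.distrib sum_distrib_left algebra_simps)
  then show ?thesis unfolding line_coord_def by (simp add: add_divide_distrib)
qed

lemma line_coord_smult:
  fixes a :: "complex^'n"
  assumes "a \<noteq> 0"
  shows "line_coord a (\<zeta> *s a) = \<zeta>"
proof -
  have *: "complex_of_real ((norm a)\<^sup>2) = (\<Sum>i\<in>UNIV. a $ i * cnj (a $ i))"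
    unfolding norm_vec_square of_real_sum complex_norm_square ..
  have "line_coord a a = 1" unfolding line_coord_def *[symmetric] using assms by simp
  then show ?thesis using line_coord_affine[of a 0 \<zeta> a] by (simp add: line_coord_def)
qed

text \<open>
  Pythagoras; it yields the Cauchy-Schwarz inequality together with its case of equality.
\<close>

lemma norm_line_decomposition:
  fixes a z :: "complex^'n"
  assumes "a \<noteq> 0"
  shows "(norm z)\<^sup>2 = (cmod (line_coord a z) * norm a)\<^sup>2 + (norm (z - line_coord a z *s a))\<^sup>2"
proof -
  define l where "l = line_coord a z"
  define S where "S = (\<Sum>i\<in>UNIV. z $ i * cnj (a $ i))"
  have S: "S = l * complex_of_real ((norm a)\<^sup>2)" using assms unfolding l_def S_def line_coord_def by simp
  have pt: "(cmod (z $ i - l * a $ i))\<^sup>2 = (cmod (z $ i))\<^sup>2 - 2 * Re (cnj l * (z $ i * cnj (a $ i))) + (cmod l)\<^sup>2 * (cmod (a $ i))\<^sup>2" for i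
    unfolding cmod_power2 by (simp add: power2_eq_square algebra_simps)
  have "(norm (z - l *s a))\<^sup>2 = (norm z)\<^sup>2 - 2 * Re (cnj l * S) + (cmod l)\<^sup>2 * (norm a)\<^sup>2"
    unfolding norm_vec_square S_def by (simp add: pt sum.distrib sum_subtractf sum_distrib_left)
  moreover have "Re (cnj l * S) = (cmod l)\<^sup>2 * (norm a)\<^sup>2"
  proof -
    have "cnj l * S = complex_of_real ((cmod l)\<^sup>2 * (norm a)\<^sup>2)"
      unfolding S using complex_norm_square[of l] by (simp add: mult_ac)
    then show ?thesis by simp
  qed
  ultimately show ?thesis unfolding l_def[symmetric] by (simp add: power_mult_distrib)
qed

lemma line_coord_le:
  fixes a z :: "complex^'n"
  assumes "a \<noteq> 0"
  shows "cmod (line_coord a z) * norm a \<le> norm z"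
proof -
  have "(cmod (line_coord a z) * norm a)\<^sup>2 \<le> (norm z)\<^sup>2"
    using norm_line_decomposition[OF assms, of z] by simp
  then show ?thesis by (rule power2_le_imp_le) simp
qed

lemma line_coord_eq:
  fixes a z :: "complex^'n"
  assumes "a \<noteq> 0" "cmod (line_coord a z) * norm a = norm z"
  shows "z = line_coord a z *s a"
  using norm_line_decomposition[OF assms(1), of z] assms(2) by simp

lemma isCont_line_coord:
  fixes a :: "complex^'n"
  shows "isCont (line_coord a) z"
  unfolding line_coord_def[abs_def] divide_inverse by (intro continuous_intros)

lemma psh_add_coordinate_functions:
  fixes a :: "complex^'n"
  assumes S: "\<And>z. subharmonic_at S z" and Q: "\<And>z. subharmonic_at Q z" and fin: "S (line_coord a z0) + Q (z0 $ k) \<noteq> -\<infinity>"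
  shows "psh (\<lambda>z. S (line_coord a z) + Q (z $ k))"
  unfolding psh_def
proof (intro conjI allI)
  show "usc (\<lambda>z. S (line_coord a z) + Q (z $ k))"
    unfolding usc_iff_usc_at
  proof
    fix z
    have "usc_at (\<lambda>z. S (line_coord a z)) z"
      by (rule usc_at_compose[OF subharmonic_at_usc[OF S] isCont_line_coord])
    moreover have "isCont (\<lambda>z :: complex^'n. z $ k) z" by (intro continuous_intros)
    then have "usc_at (\<lambda>z. Q (z $ k)) z"
      by (rule usc_at_compose[OF subharmonic_at_usc[OF Q]])
    ultimately show "usc_at (\<lambda>z. S (line_coord a z) + Q (z $ k)) z"
      using subharmonic_at_less_infty[OF S] subharmonic_at_less_infty[OF Q] by (intro usc_at_add) auto
  qed
  show "S (line_coord a z) + Q (z $ k) < \<infinity>" for z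
    using subharmonic_at_less_infty[OF S, of "line_coord a z"] subharmonic_at_less_infty[OF Q, of "z $ k"] by simp
  show "\<exists>z. S (line_coord a z) + Q (z $ k) \<noteq> -\<infinity>" using fin by blast
  fix x c
  have "subharmonic (\<lambda>t. S (line_coord a x + t * line_coord a c))"
    using S by (intro subharmonic_affine) (simp add: subharmonic_iff_local)
  moreover have "subharmonic (\<lambda>t. Q (x $ k + t * c $ k))"
    using Q by (intro subharmonic_affine) (simp add: subharmonic_iff_local)
  ultimately show "subharmonic (\<lambda>t. S (line_coord a (x + t *s c)) + Q ((x + t *s c) $ k))"
    unfolding subharmonic_iff_local line_coord_affine by (auto intro: subharmonic_at_add)
qed

lemma K_set_norm_le:
  fixes z :: "complex^('m::finite option)"
  assumes "z \<in> K_set"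
  shows "norm z \<le> 3 * real CARD('m option)"
proof -
  have c: "cmod (z $ i) \<le> 3" for i
  proof (cases i)
    case None
    have "z $ None \<in> E_set" using assms by (simp add: K_set_def)
    then have "z $ None = 2 \<or> cmod (z $ None) \<le> 3"
      using E_cases[of "z $ None" "cmod (z $ None)"] trunc_norm_le disc_norm_le
      by (metis Suc_leI less_Suc_eq_0_disj not_gr_zero One_nat_def order_refl less_nat_zero_code)
    then show ?thesis using None by auto
  next
    case (Some j)
    have "cmod (z $ Some j) \<le> 1" using assms by (simp add: K_set_def polydisc_def)
    then show ?thesis using Some by simp
  qed
  have "norm z \<le> (\<Sum>i\<in>UNIV. cmod (z $ i))"
    unfolding norm_vec_def by (rule L2_set_le_sum) simp
  also have "\<dots> \<le> (\<Sum>i\<in>(UNIV :: 'm option set). 3)" using c by (intro sum_mono)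
  finally show ?thesis by (simp add: mult.commute)
qed

lemma closed_trunc: "closed (trunc m R)"
  unfolding trunc_def by (intro closed_Un closed_UN closed_Int closed_cball) auto

text \<open>
  By compactness, the points of the compact set whose line coordinate violates the constraint by more
  than \<open>\<epsilon>\<close> stay away from the line, where the logarithm of the line coordinate has room below the weight.
\<close>

lemma transversal_gap:
  fixes a :: "complex^('m::finite option)"
  assumes a1: "a $ None = 1" and u: "\<And>z. subharmonic_at u z" and u_trunc: "\<And>z. z \<in> trunc m R \<Longrightarrow> u z \<le> 0"
    and R: "\<And>\<zeta>. cmod \<zeta> \<le> 3 \<Longrightarrow> (\<And>j. cmod \<zeta> * cmod (a $ Some j) \<le> 1) \<Longrightarrow> cmod \<zeta> \<le> R"
    and \<epsilon>: "\<epsilon> > 0"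
  obtains c0 where "c0 > 0" "\<And>z. z \<in> K_set \<Longrightarrow> z $ None \<in> trunc m 3 \<Longrightarrow>
    u (line_coord a z) < ereal \<epsilon> \<or> c0 \<le> norm z - cmod (line_coord a z) * norm a"
proof -
  have a0: "a \<noteq> 0" using a1 by auto
  define T where "T = {z :: complex^('m option). z $ None \<in> trunc m 3 \<and> (\<forall>j. cmod (z $ Some j) \<le> 1) \<and> norm z \<le> 3 * real CARD('m option)
    \<and> \<not> u (line_coord a z) < ereal \<epsilon>}"
  have "closed {z :: complex^('m option). z $ None \<in> trunc m 3}"
    using continuous_closed_vimage[OF closed_trunc, of "\<lambda>z :: complex^('m option). z $ None" m 3]
    by (simp add: vimage_def)
  moreover have "closed {z :: complex^('m option). \<forall>j. cmod (z $ Some j) \<le> 1}"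
    by (intro closed_Collect_all closed_Collect_le continuous_intros)
  moreover have "closed {z :: complex^('m option). norm z \<le> 3 * real CARD('m option)}"
    by (intro closed_Collect_le continuous_intros)
  moreover have "closed {z. \<not> u (line_coord a z) < ereal \<epsilon>}"
  proof -
    have "usc (\<lambda>z. u (line_coord a z))"
      unfolding usc_iff_usc_at using usc_at_compose[OF subharmonic_at_usc[OF u] isCont_line_coord] by blast
    then have "open {z. u (line_coord a z) < ereal \<epsilon>}" unfolding usc_def by blast
    then show ?thesis by (simp add: closed_def Collect_neg_eq)
  qed
  ultimately have "closed T"
    unfolding T_def by (intro closed_Collect_conj)
  moreover have "bounded T" unfolding T_def bounded_iff by blast
  ultimately have "compact T" by (simp add: compact_eq_bounded_closed)
  have pos: "norm z - cmod (line_coord a z) * norm a > 0" if z: "z \<in> T" for z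
  proof (rule ccontr)
    assume "\<not> ?thesis"
    then have eq: "cmod (line_coord a z) * norm a = norm z" using line_coord_le[OF a0, of z] by linarith
    have zl: "z = line_coord a z *s a" by (rule line_coord_eq[OF a0 eq])
    then have z1: "z $ None = line_coord a z" using a1 by (metis mult.right_neutral vector_smult_component)
    have zj: "z $ Some j = line_coord a z * a $ Some j" for j using zl by (metis vector_smult_component)
    have "z $ None \<in> trunc m 3" using z unfolding T_def by blast
    then have zt: "line_coord a z \<in> trunc m 3" unfolding z1 .
    have "cmod (line_coord a z) \<le> R"
    proof (rule R)
      show "cmod (line_coord a z) \<le> 3" using trunc_norm_le[OF zt] .
      show "cmod (line_coord a z) * cmod (a $ Some j) \<le> 1" for j
        using z unfolding T_def norm_mult[symmetric] zj[symmetric] by blast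
    qed
    with zt have "line_coord a z \<in> trunc m R" unfolding trunc_def by auto
    then have "u (line_coord a z) \<le> 0" by (rule u_trunc)
    then have "u (line_coord a z) < ereal \<epsilon>" using \<epsilon> by (meson ereal_less(2) le_less_trans)
    then show False using z unfolding T_def by blast
  qed
  obtain c0 where c0: "c0 > 0" "\<And>z. z \<in> T \<Longrightarrow> c0 \<le> norm z - cmod (line_coord a z) * norm a"
  proof (cases "T = {}")
    case False
    have "continuous_on T (\<lambda>z. norm z - cmod (line_coord a z) * norm a)"
      by (intro continuous_at_imp_continuous_on ballI continuous_intros isCont_line_coord)
    then obtain x where "x \<in> T" "\<And>y. y \<in> T \<Longrightarrow> norm x - cmod (line_coord a x) * norm a \<le> norm y - cmod (line_coord a y) * norm a"
      using continuous_attains_inf[OF \<open>compact T\<close> False] by blast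
    then show thesis using that pos by blast
  qed (use that[of 1] in auto)
  show thesis
  proof (rule that[OF c0(1)])
    fix z :: "complex^('m option)" assume z: "z \<in> K_set" "z $ None \<in> trunc m 3"
    show "u (line_coord a z) < ereal \<epsilon> \<or> c0 \<le> norm z - cmod (line_coord a z) * norm a"
    proof (rule disjCI)
      assume n: "\<not> c0 \<le> norm z - cmod (line_coord a z) * norm a"
      show "u (line_coord a z) < ereal \<epsilon>"
      proof (rule ccontr)
        assume "\<not> ?thesis"
        then have "z \<in> T"
          using z K_set_norm_le[OF z(1)] unfolding T_def K_set_def polydisc_def by simp
        then show False using c0(2) n by blast
      qed
    qed
  qed
qed

text \<open>
  The competitor is \<open>U(z) = \<tau> (ln |l(z)| + ln \<parallel>a\<parallel> + b) + h ((1 - \<epsilon>) u(l(z)) + Q(z\<^sub>1) - \<epsilon>)\<close> with a penalty \<open>Q\<close>. For \<open>z\<^sub>1\<close> at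
  2 or in a far disc, \<open>Q\<close> outweighs \<open>u\<close>; for the remaining \<open>z\<close> in the compact set either \<open>u(l(z)) < \<epsilon>\<close>, or \<open>z\<close> is
  away from the line and \<open>\<tau> ln (\<parallel>z\<parallel> / (|l(z)| \<parallel>a\<parallel>))\<close> exceeds \<open>h u(l(z))\<close>. The bound \<open>h0\<close> comes from the second
  alternative alone and does not depend on \<open>Q\<close>, so that \<open>Q\<close> may be adapted to the neighbourhood of \<open>(2, w)\<close> in the
  regularization.
\<close>

lemma F_ext_ge:
  fixes \<Phi> :: "complex^('m::finite option) \<Rightarrow> real" and w :: "complex^'m"
  assumes \<Phi>: "admissible_weight b \<Phi>" and \<tau>: "\<tau> > 0" and \<epsilon>: "0 < \<epsilon>" "\<epsilon> < 1"
    and R: "\<And>\<zeta>. cmod \<zeta> \<le> 3 \<Longrightarrow> (\<And>j. cmod \<zeta> * cmod (w $ j) \<le> 2) \<Longrightarrow> cmod \<zeta> \<le> R"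
  obtains m0 where "\<And>m s. m \<ge> m0 \<Longrightarrow> s \<in> planar_class (trunc m R) \<Longrightarrow>
     \<exists>h0>0. \<forall>h. 0 < h \<and> h < h0 \<longrightarrow>
       ereal (\<tau> * \<Phi> (pt 2 w)) + ereal h * (ereal (1 - \<epsilon>) * s 2 - ereal (2 * \<epsilon>)) \<le> F_ext \<Phi> \<tau> (\<tau> + h) (pt 2 w)"
proof -
  define B where "B = 3 * real CARD('m option)"
  have B: "B \<ge> 3" unfolding B_def using zero_less_card_finite[where 'a="'m option"] by (simp del: zero_less_card_finite)
  define M where "M = ln B"
  have M: "M > 0" using B by (simp add: M_def)
  obtain m0 where m0: "\<And>m r0. m \<ge> m0 \<Longrightarrow> r0 > 0 \<Longrightarrow> \<exists>Q. penalty M \<epsilon> m r0 Q"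
    using penalty_exists[OF M \<epsilon>] by blast
  define a :: "complex^('m option)" where "a = pt 1 ((1/2) *s w)"
  have a1: "a $ None = 1" and aj: "a $ Some j = w $ j / 2" for j by (auto simp: a_def pt_def)
  have a0: "a \<noteq> 0" using a1 by auto
  have na: "norm a \<ge> 1" using Finite_Cartesian_Product.norm_nth_le[of a None] by (simp add: a1)
  have pta: "pt 2 w = 2 *s a"
    by (auto simp: vec_eq_iff pt_def a_def split: option.splits)
  define l where "l = line_coord a"
  have l_le: "cmod (l z) \<le> norm z" for z
  proof -
    have "cmod (l z) * 1 \<le> cmod (l z) * norm a" using na by (intro mult_left_mono) auto
    also have "\<dots> \<le> norm z" unfolding l_def by (rule line_coord_le[OF a0])
    finally show ?thesis by simp
  qed
  have \<Phi>_ge: "b + ln (norm z) \<le> \<Phi> z" if "z \<noteq> 0" for z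
    using \<Phi> that unfolding admissible_weight_def by blast
  have \<Phi>_eq: "\<Phi> z = ln (norm z) + b" if "norm z \<ge> 1" for z
    using \<Phi> that unfolding admissible_weight_def by blast
  have "\<exists>h0>0. \<forall>h. 0 < h \<and> h < h0 \<longrightarrow>
       ereal (\<tau> * \<Phi> (pt 2 w)) + ereal h * (ereal (1 - \<epsilon>) * s 2 - ereal (2 * \<epsilon>)) \<le> F_ext \<Phi> \<tau> (\<tau> + h) (pt 2 w)"
    if m: "m \<ge> m0" and s: "s \<in> planar_class (trunc m R)" for m s
  proof -
    define u where "u z = max (s z) 0" for z
    have u: "u \<in> planar_class (trunc m R)" unfolding u_def by (rule planar_class_max0[OF s])
    have shu: "subharmonic_at u z" for z by (rule planar_class_subharmonic_at[OF u])
    have u0: "u z \<ge> 0" for z by (simp add: u_def)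
    have growth: "u z \<le> ereal (log_plus (cmod z))" for z
      by (rule planar_class_le_log_plus[OF u cball_subset_trunc])
    obtain c0 where c0: "c0 > 0" "\<And>z. z \<in> K_set \<Longrightarrow> z $ None \<in> trunc m 3 \<Longrightarrow>
        u (l z) < ereal \<epsilon> \<or> c0 \<le> norm z - cmod (l z) * norm a"
      unfolding l_def
    proof (rule transversal_gap[of a u m R \<epsilon>])
      show "cmod \<zeta> \<le> R" if "cmod \<zeta> \<le> 3" "\<And>j. cmod \<zeta> * cmod (a $ Some j) \<le> 1" for \<zeta>
        using that(1) that(2)[unfolded aj] by (intro R) (auto simp: norm_divide)
    qed (use a1 shu planar_class_le[OF u] \<epsilon> in auto)
    \<comment> \<open>A gap \<open>c0\<close> in norm is a gap of at least \<open>c0 / B\<close> in the logarithm, and \<open>u \<le> M\<close>.\<close>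
    define h0 where "h0 = \<tau> * c0 / (B * M)"
    have "h0 > 0" using \<tau> c0 B M by (simp add: h0_def)
    moreover have "ereal (\<tau> * \<Phi> (pt 2 w)) + ereal h * (ereal (1 - \<epsilon>) * s 2 - ereal (2 * \<epsilon>)) \<le> F_ext \<Phi> \<tau> (\<tau> + h) (pt 2 w)"
      if h: "0 < h" "h < h0" for h
    proof -
      obtain \<alpha> where \<alpha>: "u 2 = ereal \<alpha>" using u0[of 2] growth[of 2] by (cases "u 2") auto
      define X where "X = (1 - \<epsilon>) * \<alpha> - 2 * \<epsilon>"
      have near: "ereal (\<tau> * \<Phi> (pt 2 w) + h * X - e) \<le> F_ext \<Phi> \<tau> (\<tau> + h) (pt 2 w)" if e: "e > 0" for e
        unfolding F_ext_def usc_reg_def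
      proof (rule Limsup_nhds_ge)
        fix r :: real assume r: "r > 0"
        have "isCont \<Phi> (pt 2 w)" by (rule weight_continuous[OF \<Phi>])
        then obtain r1 where r1: "r1 > 0" "\<And>z. dist z (pt 2 w) < r1 \<Longrightarrow> dist (\<Phi> z) (\<Phi> (pt 2 w)) < e / \<tau>"
          using e \<tau> unfolding continuous_at_eps_delta by (metis divide_pos_pos)
        define r2 where "r2 = min 1 (min (r / norm a) (r1 / norm a))"
        have "r / norm a > 0" "r1 / norm a > 0" using r r1(1) a0 by auto
        then have r2: "r2 > 0" "r2 \<le> 1" "r2 \<le> r / norm a" "r2 \<le> r1 / norm a"
          by (auto simp: r2_def)
        obtain Q where Q: "penalty M \<epsilon> m r2 Q" using m0[OF m r2(1)] by blast
        then have shQ: "subharmonic_at Q z" for z unfolding penalty_def by blast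
        have "u 2 \<noteq> -\<infinity>" using \<alpha> by simp
        then obtain \<zeta> where \<zeta>: "cmod (\<zeta> - 2) < r2" "ereal (1 - \<epsilon>) * u 2 - ereal \<epsilon> \<le> ereal (1 - \<epsilon>) * u \<zeta> + Q \<zeta>"
          using Q shu unfolding penalty_def by blast
        define z where "z = \<zeta> *s a"
        have "2 \<le> cmod \<zeta> + cmod (\<zeta> - 2)" using norm_triangle_ineq4[of \<zeta> "\<zeta> - 2"] by simp
        then have \<zeta>1: "cmod \<zeta> \<ge> 1" using \<zeta>(1) r2(2) by linarith
        have lz: "l z = \<zeta>" unfolding l_def z_def by (rule line_coord_smult[OF a0])
        have z1: "z $ None = \<zeta>" unfolding z_def using a1 by simp
        have "dist z (pt 2 w) = cmod (\<zeta> - 2) * norm a"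
        proof -
          have "z - pt 2 w = (\<zeta> - 2) *s a" unfolding z_def pta by (simp add: vec_eq_iff algebra_simps)
          then show ?thesis unfolding dist_norm by (simp only: norm_cmult_vec)
        qed
        moreover have "cmod (\<zeta> - 2) * norm a < r / norm a * norm a" using \<zeta>(1) r2 na by (intro mult_strict_right_mono) auto
        moreover have "cmod (\<zeta> - 2) * norm a < r1 / norm a * norm a" using \<zeta>(1) r2 na by (intro mult_strict_right_mono) auto
        ultimately have zr: "dist z (pt 2 w) < r" "dist z (pt 2 w) < r1" using a0 by auto
        define A where "A = ln (norm a) + b"
        define S where "S \<xi> = (ereal \<tau> * log_dist 0 \<xi> + ereal (\<tau> * A - h * \<epsilon>)) + ereal (h * (1 - \<epsilon>)) * u \<xi>" for \<xi>
        define U where "U x = S (l x) + ereal h * Q (x $ None)" for x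
        have shS: "subharmonic_at S \<xi>" for \<xi>
          unfolding S_def using \<tau> h \<epsilon> by (intro subharmonic_at_add subharmonic_at_add_const subharmonic_at_cmult subharmonic_at_log_dist shu) auto
        have shhQ: "subharmonic_at (\<lambda>\<xi>. ereal h * Q \<xi>) \<xi>" for \<xi> using h by (intro subharmonic_at_cmult shQ)
        have Uz: "U z \<ge> ereal (\<tau> * \<Phi> z + h * X)"
        proof -
          have "1 * 1 \<le> cmod \<zeta> * norm a" using \<zeta>1 na by (intro mult_mono) auto
          then have "\<Phi> z = ln (cmod \<zeta> * norm a) + b" unfolding z_def by (subst \<Phi>_eq) (auto simp: norm_cmult_vec)
          also have "ln (cmod \<zeta> * norm a) = ln (cmod \<zeta>) + ln (norm a)" using \<zeta>1 na by (intro ln_mult_pos) auto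
          finally have \<Phi>z: "\<Phi> z = ln (cmod \<zeta>) + A" by (simp add: A_def)
          have "\<zeta> \<noteq> 0" using \<zeta>1 by auto
          then have log_dist: "log_dist 0 \<zeta> = ereal (ln (cmod \<zeta>))" by (simp add: log_dist_def)
          have "ereal h * (ereal (1 - \<epsilon>) * u 2 - ereal \<epsilon>) \<le> ereal h * (ereal (1 - \<epsilon>) * u \<zeta> + Q \<zeta>)"
            using \<zeta>(2) h by (intro ereal_cmult_mono) auto
          also have "\<dots> = ereal (h * (1 - \<epsilon>)) * u \<zeta> + ereal h * Q \<zeta>"
            using u0[of \<zeta>] subharmonic_at_less_infty[OF shu, of \<zeta>] subharmonic_at_less_infty[OF shQ, of \<zeta>] h
            by (cases "u \<zeta>"; cases "Q \<zeta>") (auto simp: algebra_simps)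
          finally have ge: "ereal (h * ((1 - \<epsilon>) * \<alpha> - \<epsilon>)) \<le> ereal (h * (1 - \<epsilon>)) * u \<zeta> + ereal h * Q \<zeta>"
            unfolding \<alpha> by simp
          have "ereal (\<tau> * \<Phi> z + h * X) = ereal (\<tau> * ln (cmod \<zeta>) + (\<tau> * A - h * \<epsilon>)) + ereal (h * ((1 - \<epsilon>) * \<alpha> - \<epsilon>))"
            unfolding \<Phi>z X_def by (simp add: algebra_simps)
          also have "\<dots> \<le> ereal (\<tau> * ln (cmod \<zeta>) + (\<tau> * A - h * \<epsilon>)) + (ereal (h * (1 - \<epsilon>)) * u \<zeta> + ereal h * Q \<zeta>)"
            by (intro add_left_mono ge)
          also have "\<dots> = U z" unfolding U_def S_def lz z1 log_dist by (simp add: add.assoc)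
          finally show ?thesis .
        qed
        have "U z \<noteq> -\<infinity>" using Uz by auto
        then have "psh U"
          unfolding U_def l_def
          by (rule psh_add_coordinate_functions[where ?z0.0=z and k=None, OF shS shhQ])
        moreover have "U x \<le> ereal ((\<tau> + h) * log_plus (norm x) + \<tau> * A)" for x
        proof -
          have lp: "log_plus (cmod (l x)) \<le> log_plus (norm x)" by (intro log_plus_mono l_le) simp
          have "log_dist 0 (l x) \<le> ereal (log_plus (norm x))"
            using ln_le_log_plus[of "cmod (l x)"] lp by (auto simp: log_dist_def)
          then have 1: "ereal \<tau> * log_dist 0 (l x) \<le> ereal \<tau> * ereal (log_plus (norm x))" using \<tau> by (intro ereal_cmult_mono) auto
          have "u (l x) \<le> ereal (log_plus (norm x))" using growth[of "l x"] lp by (meson ereal_less_eq(3) order_trans)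
          then have 2: "ereal (h * (1 - \<epsilon>)) * u (l x) \<le> ereal (h * (1 - \<epsilon>)) * ereal (log_plus (norm x))"
            using h \<epsilon> by (intro ereal_cmult_mono) auto
          have "Q (x $ None) \<le> ereal (\<epsilon> * log_plus (cmod (x $ None)))" using Q unfolding penalty_def by blast
          also have "\<dots> \<le> ereal (\<epsilon> * log_plus (norm x))"
            using \<epsilon> Finite_Cartesian_Product.norm_nth_le[of x None] by (simp add: mult_left_mono log_plus_mono)
          finally have 3: "ereal h * Q (x $ None) \<le> ereal h * ereal (\<epsilon> * log_plus (norm x))" using h by (intro ereal_cmult_mono) auto
          have "U x \<le> ereal \<tau> * ereal (log_plus (norm x)) + ereal (\<tau> * A - h * \<epsilon>) + ereal (h * (1 - \<epsilon>)) * ereal (log_plus (norm x)) + ereal h * ereal (\<epsilon> * log_plus (norm x))"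
            unfolding U_def S_def by (intro add_mono 1 2 3 order_refl)
          also have "\<dots> = ereal ((\<tau> + h) * log_plus (norm x) + \<tau> * A - h * \<epsilon>)" by (simp add: algebra_simps)
          also have "\<dots> \<le> ereal ((\<tau> + h) * log_plus (norm x) + \<tau> * A)" using h \<epsilon> by simp
          finally show ?thesis .
        qed
        ultimately have "U \<in> lelong (\<tau> + h)" unfolding lelong_def by blast
        moreover have "U x \<le> ereal (psi \<Phi> \<tau> x)" if x: "x \<in> K_set" for x
        proof (cases "l x = 0")
          case True
          have "S (l x) = -\<infinity>" unfolding S_def True using \<tau> h \<epsilon> subharmonic_at_less_infty[OF shu, of 0]
            by (cases "u 0") (auto simp: log_dist_def)
          moreover have "ereal h * Q (x $ None) < \<infinity>" by (rule subharmonic_at_less_infty[OF shhQ])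
          ultimately have "U x = -\<infinity>" unfolding U_def by (cases "ereal h * Q (x $ None)") auto
          then show ?thesis by simp
        next
          case False
          have x0: "x \<noteq> 0"
          proof
            assume "x = 0"
            then have "l x = 0" unfolding l_def line_coord_def by simp
            then show False using False by simp
          qed
          have nx: "norm x \<le> B" unfolding B_def by (rule K_set_norm_le[OF x])
          define y where "y = cmod (l x) * norm a"
          have y: "0 < y" "y \<le> norm x" unfolding y_def using False a0 line_coord_le[OF a0, of x] by (auto simp: l_def)
          have ly: "ln y = ln (cmod (l x)) + ln (norm a)" unfolding y_def using False na by (intro ln_mult_pos) auto
          define D where "D = ln (norm x) - ln y"
          have D: "D \<ge> 0" unfolding D_def using ln_mono[OF y(2,1)] by simp
          have uM: "u (l x) \<le> ereal M"
          proof -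
            have "log_plus (cmod (l x)) \<le> ln B"
              using l_le[of x] nx B by (intro log_plus_le_ln) auto
            then show ?thesis using growth[of "l x"] unfolding M_def by (meson ereal_less_eq(3) order_trans)
          qed
          define g where "g = ereal (1 - \<epsilon>) * u (l x) + Q (x $ None)"
          have key: "ereal h * g \<le> ereal (h * \<epsilon> + \<tau> * D)"
          proof -
            have bad: ?thesis if "Q (x $ None) \<le> ereal (- M)"
            proof -
              have "g \<le> ereal (1 - \<epsilon>) * ereal M + ereal (- M)"
                unfolding g_def using \<epsilon> uM that by (intro add_mono ereal_cmult_mono) auto
              also have "\<dots> \<le> 0" using \<epsilon> M by (simp add: algebra_simps)
              finally have "ereal h * g \<le> ereal h * 0" using h by (intro ereal_cmult_mono) auto
              also have "\<dots> \<le> ereal (h * \<epsilon> + \<tau> * D)" using h \<epsilon> \<tau> D by simp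
              finally show ?thesis .
            qed
            show ?thesis
            proof (rule E_cases[where z="x $ None" and R="cmod (x $ None)" and m=m])
              show "x $ None \<in> E_set" using x by (simp add: K_set_def)
            next
              assume "x $ None = 2" then show ?thesis using bad Q by (simp add: penalty_def)
            next
              fix j assume "j > m" "x $ None \<in> disc j"
              then show ?thesis using bad Q by (simp add: penalty_def)
            next
              assume "x $ None \<in> trunc m (cmod (x $ None))"
              then have xt: "x $ None \<in> trunc m 3" unfolding trunc_def using disc_norm_le by fastforce
              then have "cmod (x $ None) \<le> 3" by (rule trunc_norm_le)
              then have Q0: "Q (x $ None) \<le> 0" using Q by (simp add: penalty_def)
              have gu: "g \<le> u (l x)"
              proof -
                have "g \<le> ereal (1 - \<epsilon>) * u (l x) + 0" unfolding g_def by (intro add_left_mono Q0)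
                also have "\<dots> \<le> u (l x)"
                proof (cases "u (l x)")
                  case (real t)
                  then have "t \<ge> 0" using u0[of "l x"] by simp
                  then show ?thesis using real \<epsilon> by (simp add: algebra_simps)
                qed (use u0[of "l x"] uM in auto)
                finally show ?thesis .
              qed
              consider "u (l x) < ereal \<epsilon>" | "c0 \<le> norm x - y" unfolding y_def using c0(2)[OF x xt] by blast
              then show ?thesis
              proof cases
                case 1
                then have "ereal h * g \<le> ereal h * ereal \<epsilon>" using gu h by (intro ereal_cmult_mono) auto
                also have "\<dots> \<le> ereal (h * \<epsilon> + \<tau> * D)" using \<tau> D by simp
                finally show ?thesis .
              next
                case 2
                have "c0 / B \<le> D"
                proof -
                  have "c0 / B \<le> c0 / norm x" using c0(1) nx x0 B by (intro divide_left_mono) auto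
                  also have "\<dots> \<le> (norm x - y) / norm x" using 2 x0 by (intro divide_right_mono) auto
                  also have "\<dots> = 1 - y / norm x" using x0 by (simp add: diff_divide_distrib)
                  also have "\<dots> \<le> - ln (y / norm x)" using ln_le_minus_one[of "y / norm x"] y x0 by simp
                  also have "\<dots> = D" unfolding D_def using y x0 by (simp add: ln_div)
                  finally show ?thesis .
                qed
                have "h * M \<le> h0 * M" using h M by (intro mult_right_mono) auto
                also have "\<dots> = \<tau> * (c0 / B)" unfolding h0_def using M by simp
                also have "\<dots> \<le> \<tau> * D" using \<open>c0 / B \<le> D\<close> \<tau> by (intro mult_left_mono) auto
                finally have hM: "h * M \<le> \<tau> * D" .
                have "ereal h * g \<le> ereal h * ereal M" using order_trans[OF gu uM] h by (intro ereal_cmult_mono) auto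
                also have "\<dots> \<le> ereal (h * \<epsilon> + \<tau> * D)" using hM h \<epsilon> by (simp add: add_increasing)
                finally show ?thesis .
              qed
            qed simp
          qed
          have "log_dist 0 (l x) = ereal (ln (cmod (l x)))" using False by (simp add: log_dist_def)
          then have "U x = (ereal (\<tau> * ln (cmod (l x)) + (\<tau> * A - h * \<epsilon>)) + ereal (h * (1 - \<epsilon>)) * u (l x)) + ereal h * Q (x $ None)"
            unfolding U_def S_def by simp
          also have "\<dots> = ereal (\<tau> * ln (cmod (l x)) + (\<tau> * A - h * \<epsilon>)) + ereal h * g"
            unfolding g_def using u0[of "l x"] uM subharmonic_at_less_infty[OF shQ, of "x $ None"] h
            by (cases "u (l x)"; cases "Q (x $ None)") (auto simp: algebra_simps)
          also have "\<dots> \<le> ereal (\<tau> * ln (cmod (l x)) + (\<tau> * A - h * \<epsilon>)) + ereal (h * \<epsilon> + \<tau> * D)"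
            by (intro add_left_mono key)
          also have "\<dots> = ereal (\<tau> * (b + ln (norm x)))"
            unfolding D_def ly A_def by (simp add: algebra_simps)
          also have "\<dots> \<le> ereal (\<tau> * \<Phi> x)" using \<Phi>_ge[OF x0] \<tau> by simp
          finally show ?thesis by (simp add: psi_def)
        qed
        ultimately have "U z \<le> extremal (\<tau> + h) K_set (psi \<Phi> \<tau>) z"
          unfolding extremal_def by (intro SUP_upper) blast
        with Uz have "ereal (\<tau> * \<Phi> z + h * X) \<le> extremal (\<tau> + h) K_set (psi \<Phi> \<tau>) z" by (rule order_trans)
        moreover have "ereal (\<tau> * \<Phi> (pt 2 w) + h * X - e) \<le> ereal (\<tau> * \<Phi> z + h * X)"
        proof -
          have "\<Phi> (pt 2 w) - e / \<tau> < \<Phi> z" using r1(2)[OF zr(2)] unfolding dist_real_def by linarith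
          then have "\<tau> * (\<Phi> (pt 2 w) - e / \<tau>) \<le> \<tau> * \<Phi> z" using \<tau> by (intro mult_left_mono) auto
          then show ?thesis using \<tau> by (simp add: algebra_simps)
        qed
        ultimately have "ereal (\<tau> * \<Phi> (pt 2 w) + h * X - e) \<le> extremal (\<tau> + h) K_set (psi \<Phi> \<tau>) z" by (rule order_trans[rotated])
        then show "\<exists>z. dist z (pt 2 w) < r \<and> ereal (\<tau> * \<Phi> (pt 2 w) + h * X - e) \<le> extremal (\<tau> + h) K_set (psi \<Phi> \<tau>) z"
          using zr(1) by blast
      qed
      have "ereal (\<tau> * \<Phi> (pt 2 w) + h * X) \<le> F_ext \<Phi> \<tau> (\<tau> + h) (pt 2 w)"
      proof (rule ereal_le_epsilon2)
        fix e :: real assume e: "e > 0"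
        have "ereal (\<tau> * \<Phi> (pt 2 w) + h * X - e) + ereal e \<le> F_ext \<Phi> \<tau> (\<tau> + h) (pt 2 w) + ereal e"
          by (intro add_right_mono near e)
        then show "ereal (\<tau> * \<Phi> (pt 2 w) + h * X) \<le> F_ext \<Phi> \<tau> (\<tau> + h) (pt 2 w) + ereal e" by simp
      qed
      moreover have "ereal (\<tau> * \<Phi> (pt 2 w)) + ereal h * (ereal (1 - \<epsilon>) * s 2 - ereal (2 * \<epsilon>)) \<le> ereal (\<tau> * \<Phi> (pt 2 w) + h * X)"
      proof -
        have "ereal (1 - \<epsilon>) * s 2 \<le> ereal (1 - \<epsilon>) * ereal \<alpha>"
          using \<epsilon> unfolding \<alpha>[symmetric] by (intro ereal_cmult_mono) (auto simp: u_def)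
        then have "ereal (1 - \<epsilon>) * s 2 - ereal (2 * \<epsilon>) \<le> ereal (1 - \<epsilon>) * ereal \<alpha> - ereal (2 * \<epsilon>)"
          by (intro ereal_minus_mono order_refl)
        then have "ereal h * (ereal (1 - \<epsilon>) * s 2 - ereal (2 * \<epsilon>)) \<le> ereal h * ereal X"
          using h unfolding X_def by (intro ereal_cmult_mono) auto
        then have "ereal (\<tau> * \<Phi> (pt 2 w)) + ereal h * (ereal (1 - \<epsilon>) * s 2 - ereal (2 * \<epsilon>)) \<le> ereal (\<tau> * \<Phi> (pt 2 w)) + ereal h * ereal X"
          by (rule add_left_mono)
        then show ?thesis by simp
      qed
      ultimately show ?thesis by (rule order_trans[rotated])
    qed
    ultimately show ?thesis by blast
  qed
  then show thesis using that by blast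
qed

section \<open>The derivative\<close>

lemma planar_extremal_trunc_real:
  obtains v where "planar_extremal (trunc m R) 2 = ereal v" "0 \<le> v" "v \<le> ln 2"
proof -
  have "planar_extremal (trunc m R) 2 \<le> ereal (log_plus (cmod 2))" by (rule planar_extremal_le_log_plus[OF cball_subset_trunc])
  then have "planar_extremal (trunc m R) 2 \<le> ereal (ln 2)" by (simp add: log_plus_eq)
  moreover have "0 \<le> planar_extremal (trunc m R) 2" by (rule planar_extremal_nonneg)
  ultimately show thesis using that by (cases "planar_extremal (trunc m R) 2") auto
qed

lemma reg_extremal_2_real:
  assumes "2 \<le> R" "R \<le> 3"
  obtains L where "reg_extremal_2 R = ereal L" "0 \<le> L" "L \<le> ln 2"
proof -
  obtain v where v: "planar_extremal (trunc 0 R) 2 = ereal v" "v \<le> ln 2" using planar_extremal_trunc_real by metis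
  have "reg_extremal_2 R \<le> ereal v" using reg_extremal_2_le[OF assms, of 0] v(1) by simp
  moreover have "0 \<le> reg_extremal_2 R"
    unfolding reg_extremal_2_def planar_extremal_reg_eq by (rule Limsup_nhds_ge) (auto intro!: exI[of _ 2] planar_extremal_nonneg)
  ultimately show thesis using that v(2) by (cases "reg_extremal_2 R") auto
qed

lemma reg_extremal_2_approx:
  assumes R: "2 \<le> R" "R \<le> 3" and \<epsilon>: "0 < \<epsilon>"
  obtains m0 where "\<And>m. m \<ge> m0 \<Longrightarrow> planar_extremal (trunc m R) 2 \<le> reg_extremal_2 R + ereal \<epsilon>"
proof -
  define \<eta> where "\<eta> = min (\<epsilon> / 2) (1/2)"
  have \<eta>: "0 < \<eta>" "\<eta> < 1" "2 * \<eta> \<le> \<epsilon>" using \<epsilon> by (auto simp: \<eta>_def)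
  obtain m0 where m0: "\<And>m R. m \<ge> m0 \<Longrightarrow> ereal (1 - \<eta>) * planar_extremal (trunc m R) 2 - ereal \<eta> \<le> reg_extremal_2 R"
    using reg_extremal_2_ge[OF \<eta>(1,2)] by blast
  obtain L where L: "reg_extremal_2 R = ereal L" using reg_extremal_2_real[OF R] by blast
  have "planar_extremal (trunc m R) 2 \<le> reg_extremal_2 R + ereal \<epsilon>" if m: "m \<ge> m0" for m
  proof -
    obtain v where v: "planar_extremal (trunc m R) 2 = ereal v" "0 \<le> v" "v \<le> ln 2" using planar_extremal_trunc_real by blast
    have "(1 - \<eta>) * v - \<eta> \<le> L" using m0[OF m, of R] unfolding v L by simp
    moreover have "\<eta> * v \<le> \<eta> * 1" using \<eta> v ln_2_less_1 by (intro mult_left_mono) auto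
    moreover have "(1 - \<eta>) * v = v - \<eta> * v" by (simp add: algebra_simps)
    ultimately have "v \<le> L + \<epsilon>" using \<eta> by linarith
    then show ?thesis unfolding v L by simp
  qed
  then show thesis using that by blast
qed

lemma diff_quot_limit:
  fixes \<Phi> :: "complex^('m::finite option) \<Rightarrow> real" and w :: "complex^'m"
  assumes \<Phi>: "admissible_weight b \<Phi>" and \<tau>: "\<tau> > 0" and R: "2 \<le> R" "R \<le> 3"
    and w: "\<And>j. R * cmod (w $ j) \<le> 2"
    and wR: "\<And>\<zeta>. cmod \<zeta> \<le> 3 \<Longrightarrow> (\<And>j. cmod \<zeta> * cmod (w $ j) \<le> 2) \<Longrightarrow> cmod \<zeta> \<le> R"
  shows "(diff_quot \<Phi> \<tau> w \<longlongrightarrow> reg_extremal_2 R) (at_right 0)"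
proof -
  obtain L where L: "reg_extremal_2 R = ereal L" "0 \<le> L" "L \<le> ln 2" using reg_extremal_2_real[OF R] by blast
  have quot_le: "diff_quot \<Phi> \<tau> w h \<le> ereal x"
    if "F_ext \<Phi> \<tau> (\<tau> + h) (pt 2 w) \<le> ereal (\<tau> * \<Phi> (pt 2 w) + h * x)" "h > 0" for h x
    using that unfolding diff_quot_def psi_def
    by (cases "F_ext \<Phi> \<tau> (\<tau> + h) (pt 2 w)") (auto simp: field_simps)
  have quot_ge: "diff_quot \<Phi> \<tau> w h \<ge> ereal x"
    if "F_ext \<Phi> \<tau> (\<tau> + h) (pt 2 w) \<ge> ereal (\<tau> * \<Phi> (pt 2 w) + h * x)" "h > 0" for h x
    using that unfolding diff_quot_def psi_def
    by (cases "F_ext \<Phi> \<tau> (\<tau> + h) (pt 2 w)") (auto simp: field_simps)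
  have upper: "\<forall>\<^sub>F h in at_right 0. diff_quot \<Phi> \<tau> w h \<le> ereal (L + e)" if e: "e > 0" for e
  proof -
    obtain m where m: "planar_extremal (trunc m R) 2 \<le> reg_extremal_2 R + ereal (e / 2)"
      using reg_extremal_2_approx[OF R, of "e / 2"] e by auto
    obtain v where v: "planar_extremal (trunc m R) 2 = ereal v" using planar_extremal_trunc_real by blast
    have "diff_quot \<Phi> \<tau> w h \<le> ereal (L + e)" if h: "h > 0" for h
    proof (rule quot_le[OF _ h])
      have "F_ext \<Phi> \<tau> (\<tau> + h) (pt 2 w) \<le> ereal (\<tau> * \<Phi> (pt 2 w)) + ereal h * (planar_extremal (trunc m R) 2 + ereal (e / 2))"
        using e by (intro F_ext_le[OF \<Phi> \<tau> h R w]) auto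
      also have "\<dots> = ereal (\<tau> * \<Phi> (pt 2 w) + h * (v + e / 2))" unfolding v by simp
      also have "\<dots> \<le> ereal (\<tau> * \<Phi> (pt 2 w) + h * (L + e))"
        using m h unfolding v L by (simp add: mult_left_mono)
      finally show "F_ext \<Phi> \<tau> (\<tau> + h) (pt 2 w) \<le> ereal (\<tau> * \<Phi> (pt 2 w) + h * (L + e))" .
    qed
    then show ?thesis unfolding eventually_at_right_field by (intro exI[of _ 1]) auto
  qed
  have lower: "\<forall>\<^sub>F h in at_right 0. diff_quot \<Phi> \<tau> w h \<ge> ereal (L - e)" if e: "e > 0" for e
  proof -
    define \<epsilon> where "\<epsilon> = min (e / 4) (1/2)"
    have \<epsilon>: "0 < \<epsilon>" "\<epsilon> < 1" "4 * \<epsilon> \<le> e" using e by (auto simp: \<epsilon>_def)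
    obtain m where m: "\<And>s. s \<in> planar_class (trunc m R) \<Longrightarrow>
     \<exists>h0>0. \<forall>h. 0 < h \<and> h < h0 \<longrightarrow>
       ereal (\<tau> * \<Phi> (pt 2 w)) + ereal h * (ereal (1 - \<epsilon>) * s 2 - ereal (2 * \<epsilon>)) \<le> F_ext \<Phi> \<tau> (\<tau> + h) (pt 2 w)"
      using F_ext_ge[OF \<Phi> \<tau> \<epsilon>(1,2) wR] by (metis order_refl)
    have "ereal (L - \<epsilon>) < planar_extremal (trunc m R) 2"
    proof -
      have "ereal (L - \<epsilon>) < reg_extremal_2 R" unfolding L using \<epsilon> by simp
      also have "\<dots> \<le> planar_extremal (trunc m R) 2" by (rule reg_extremal_2_le[OF R])
      finally show ?thesis .
    qed
    then obtain s where s: "s \<in> planar_class (trunc m R)" "ereal (L - \<epsilon>) < s 2"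
      unfolding planar_extremal_def less_SUP_iff by blast
    obtain h0 where h0: "h0 > 0" "\<And>h. 0 < h \<Longrightarrow> h < h0 \<Longrightarrow>
       ereal (\<tau> * \<Phi> (pt 2 w)) + ereal h * (ereal (1 - \<epsilon>) * s 2 - ereal (2 * \<epsilon>)) \<le> F_ext \<Phi> \<tau> (\<tau> + h) (pt 2 w)"
      using m[OF s(1)] by blast
    have "diff_quot \<Phi> \<tau> w h \<ge> ereal (L - e)" if h: "0 < h" "h < h0" for h
    proof (rule quot_ge[OF _ h(1)])
      have "L - e \<le> (1 - \<epsilon>) * (L - \<epsilon>) - 2 * \<epsilon>"
      proof -
        have "\<epsilon> * L \<le> \<epsilon> * 1" using \<epsilon> L ln_2_less_1 by (intro mult_left_mono) auto
        moreover have "\<epsilon> * \<epsilon> \<ge> 0" by simp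
        moreover have "(1 - \<epsilon>) * (L - \<epsilon>) - 2 * \<epsilon> = L - \<epsilon> * L + \<epsilon> * \<epsilon> - 3 * \<epsilon>" by (simp add: algebra_simps)
        ultimately show ?thesis using \<epsilon>(3) by linarith
      qed
      then have "ereal (\<tau> * \<Phi> (pt 2 w) + h * (L - e)) \<le> ereal (\<tau> * \<Phi> (pt 2 w)) + ereal h * (ereal (1 - \<epsilon>) * ereal (L - \<epsilon>) - ereal (2 * \<epsilon>))"
        using h by (simp add: mult_left_mono)
      also have "\<dots> \<le> ereal (\<tau> * \<Phi> (pt 2 w)) + ereal h * (ereal (1 - \<epsilon>) * s 2 - ereal (2 * \<epsilon>))"
        using s(2) h \<epsilon> by (intro add_left_mono ereal_cmult_mono ereal_minus_mono) auto
      also have "\<dots> \<le> F_ext \<Phi> \<tau> (\<tau> + h) (pt 2 w)" using h by (rule h0(2))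
      finally show "ereal (\<tau> * \<Phi> (pt 2 w) + h * (L - e)) \<le> F_ext \<Phi> \<tau> (\<tau> + h) (pt 2 w)" .
    qed
    then show ?thesis unfolding eventually_at_right_field using h0(1) by (intro exI[of _ h0]) auto
  qed
  show ?thesis
    unfolding L
  proof (rule order_tendstoI)
    fix x assume "x < ereal L"
    then obtain c :: real where c: "x < ereal c" "ereal c < ereal L" using ereal_dense2 by blast
    have "\<forall>\<^sub>F h in at_right 0. diff_quot \<Phi> \<tau> w h \<ge> ereal (L - (L - c))" using c by (intro lower) simp
    then show "\<forall>\<^sub>F h in at_right 0. x < diff_quot \<Phi> \<tau> w h"
      by eventually_elim (use c in \<open>auto intro: less_le_trans\<close>)
  next
    fix x assume "ereal L < x"
    then obtain c :: real where c: "ereal c < x" "ereal L < ereal c" using ereal_dense2 by blast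
    have "\<forall>\<^sub>F h in at_right 0. diff_quot \<Phi> \<tau> w h \<le> ereal (L + (c - L))" using c by (intro upper) simp
    then show "\<forall>\<^sub>F h in at_right 0. diff_quot \<Phi> \<tau> w h < x"
      by eventually_elim (use c in \<open>auto intro: le_less_trans\<close>)
  qed
qed

lemma reg_extremal_2_strict:
  assumes R: "2 \<le> R" "R < x_max"
  shows "reg_extremal_2 3 < reg_extremal_2 R"
proof -
  have R3: "R \<le> 3" using R x_max_le by simp
  obtain \<gamma> where \<gamma>: "\<gamma> > 0" "\<And>m. m \<ge> 1 \<Longrightarrow> planar_extremal (trunc m 3) 2 + ereal \<gamma> \<le> planar_extremal (trunc m R) 2"
    using trunc_strict[OF R] by blast
  obtain m0 where m0: "\<And>m. m \<ge> m0 \<Longrightarrow> planar_extremal (trunc m R) 2 \<le> reg_extremal_2 R + ereal (\<gamma> / 2)"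
    using reg_extremal_2_approx[OF R(1) R3, of "\<gamma> / 2"] \<gamma>(1) by auto
  define m where "m = max 1 m0"
  have "reg_extremal_2 3 + ereal \<gamma> \<le> planar_extremal (trunc m 3) 2 + ereal \<gamma>" by (intro add_right_mono reg_extremal_2_le) auto
  also have "\<dots> \<le> planar_extremal (trunc m R) 2" by (rule \<gamma>(2)) (simp add: m_def)
  also have "\<dots> \<le> reg_extremal_2 R + ereal (\<gamma> / 2)" by (rule m0) (simp add: m_def)
  finally have "reg_extremal_2 3 + ereal \<gamma> \<le> reg_extremal_2 R + ereal (\<gamma> / 2)" .
  moreover obtain K where "reg_extremal_2 3 = ereal K" using reg_extremal_2_real[of 3] by auto
  moreover obtain L where "reg_extremal_2 R = ereal L" using reg_extremal_2_real[OF R(1) R3] by blast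
  ultimately show ?thesis using \<gamma>(1) by simp
qed

lemma reg_extremal_2_radius_2: "reg_extremal_2 2 = ereal (ln 2)"
proof -
  have t: "trunc m 2 = cball 0 1" for m
  proof -
    have "disc j \<inter> cball 0 2 = {}" if "j \<in> {1..m}" for j
      using disc_degenerate(2)[of j 2] p_seq_bounds(1)[of j] that by auto
    then show ?thesis unfolding trunc_def by simp
  qed
  have V2: "planar_extremal (trunc m 2) 2 \<ge> ereal (ln 2)" for m
    unfolding t using planar_extremal_upper[OF log_plus_planar_class, of 2] by (simp add: log_dist_def)
  obtain L where L: "reg_extremal_2 2 = ereal L" "L \<le> ln 2" using reg_extremal_2_real[of 2] by auto
  have "ln 2 \<le> L + e" if e: "e > 0" for e
  proof -
    obtain m where "planar_extremal (trunc m 2) 2 \<le> reg_extremal_2 2 + ereal e" using reg_extremal_2_approx[of 2 e] e by auto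
    with V2[of m] have "ereal (ln 2) \<le> reg_extremal_2 2 + ereal e" by (rule order_trans)
    then show ?thesis unfolding L by simp
  qed
  then have "ln 2 \<le> L" by (rule field_le_epsilon)
  then show ?thesis using L by simp
qed

text \<open>
  The truncation radius, capped at 3: larger radii do not change the truncation of \<open>E\<close>.
\<close>

definition radius :: "complex^('m::finite) \<Rightarrow> real" where
  "radius w = (if q_max w \<le> 2/3 then 3 else 2 / q_max w)"

lemma E_set_norm_le_3: "z \<in> E_set \<Longrightarrow> cmod z \<le> 3"
  using E_set_cmod_le[of z] x_max_le unfolding x_max_def by simp

lemma E_sub_eq: "E_sub w = E_set \<inter> cball 0 (radius w)"
proof (cases "q_max w \<le> 2/3")
  case True
  have "E_set \<subseteq> cball 0 3" using E_set_norm_le_3 by auto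
  moreover have "E_set \<subseteq> cball 0 (2 / q_max w)" if "q_max w > 0"
  proof -
    have "3 \<le> 2 / q_max w" using True that by (simp add: field_simps)
    then show ?thesis using E_set_norm_le_3 by force
  qed
  ultimately show ?thesis using True by (auto simp: E_sub_def radius_def)
qed (auto simp: E_sub_def radius_def)

lemma q_max_ge: "cmod (w $ j) \<le> q_max (w :: complex^'m::finite)"
  unfolding q_max_def by (intro Max_ge) auto

lemma q_max_attained: obtains j where "cmod (w $ j) = q_max (w :: complex^'m::finite)"
proof -
  have "q_max w \<in> range (\<lambda>j. cmod (w $ j))" unfolding q_max_def by (intro Max_in) auto
  then show thesis using that by auto
qed

lemma rho_star_x_max: "rho_star = 2 / x_max"
  unfolding rho_star_eq x_max_def by (simp add: field_simps)

theorem theorem6p5: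
  fixes b :: real
    and \<Phi> :: "complex^('m::finite option) \<Rightarrow> real"
  assumes "admissible_weight b \<Phi>"
  shows
    "(\<forall>w\<in>polydisc. \<forall>\<tau>>0.
        (diff_quot \<Phi> \<tau> w \<longlongrightarrow> D_deriv \<Phi> \<tau> w) (at_right 0) \<and>
        D_deriv \<Phi> \<tau> w = planar_extremal_reg (E_sub w) 2 \<and>
        (D_deriv \<Phi> \<tau> w = planar_extremal_reg E_set 2 \<longleftrightarrow> q_max w \<le> rho_star) \<and>
        (rho_star < q_max w \<and> q_max w \<le> 1 \<longrightarrow>
           planar_extremal_reg E_set 2 < D_deriv \<Phi> \<tau> w \<and> D_deriv \<Phi> \<tau> w \<le> ereal (ln 2)) \<and>
        (q_max w = 1 \<longrightarrow> D_deriv \<Phi> \<tau> w = ereal (ln 2))) \<and>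
     (\<forall>w\<in>polydisc. \<forall>\<sigma>>0. \<forall>\<tau>>0. D_deriv \<Phi> \<sigma> w = D_deriv \<Phi> \<tau> w)"
proof -
  have radius: "2 \<le> radius w" "radius w \<le> 3" if "w \<in> polydisc" for w :: "complex^'m"
  proof -
    obtain j where "cmod (w $ j) = q_max w" by (rule q_max_attained)
    then have "q_max w \<le> 1" using that unfolding polydisc_def by (metis mem_Collect_eq mem_cball_0)
    then show "2 \<le> radius w" "radius w \<le> 3" by (auto simp: radius_def field_simps)
  qed
  have lim: "(diff_quot \<Phi> \<tau> w \<longlongrightarrow> reg_extremal_2 (radius w)) (at_right 0)" if w: "w \<in> polydisc" and \<tau>: "\<tau> > 0" for w :: "complex^'m" and \<tau>
  proof (rule diff_quot_limit[OF assms \<tau> radius[OF w]])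
    have q: "q_max w \<ge> 0" using q_max_ge[of w] norm_ge_zero order_trans by blast
    show "radius w * cmod (w $ j) \<le> 2" for j
    proof -
      have "radius w * cmod (w $ j) \<le> radius w * q_max w"
        using radius[OF w] by (intro mult_left_mono q_max_ge) auto
      also have "\<dots> \<le> 2" using q by (auto simp: radius_def)
      finally show ?thesis .
    qed
    fix \<zeta> assume \<zeta>: "cmod \<zeta> \<le> 3" "\<And>j. cmod \<zeta> * cmod (w $ j) \<le> 2"
    obtain j where "cmod (w $ j) = q_max w" by (rule q_max_attained)
    then have "cmod \<zeta> * q_max w \<le> 2" using \<zeta>(2)[of j] by simp
    then show "cmod \<zeta> \<le> radius w" using \<zeta>(1) by (auto simp: radius_def field_simps)
  qed
  have D: "D_deriv \<Phi> \<tau> w = reg_extremal_2 (radius w)" if "w \<in> polydisc" "\<tau> > 0" for w :: "complex^'m" and \<tau>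
    unfolding D_deriv_def by (rule tendsto_Lim[OF _ lim[OF that]]) simp
  have "E_set = E_set \<inter> cball 0 3" using E_set_norm_le_3 by auto
  then have E3: "planar_extremal_reg E_set 2 = reg_extremal_2 3" unfolding reg_extremal_2_def by simp
  have x: "0 < x_max" "x_max < 3" using x_max_le by (auto simp: x_max_def add_pos_pos)
  have small: "reg_extremal_2 (radius w) = reg_extremal_2 3" if "q_max w \<le> rho_star" for w :: "complex^'m"
  proof -
    have "E_set \<subseteq> cball 0 (radius w)"
    proof
      fix z assume z: "z \<in> E_set"
      then have "cmod z \<le> x_max" using E_set_cmod_le[OF z] by (simp add: x_max_def)
      also have "x_max \<le> radius w"
        using that x unfolding rho_star_x_max radius_def by (auto simp: field_simps)
      finally show "z \<in> cball 0 (radius w)" by simp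
    qed
    then have "E_set \<inter> cball 0 (radius w) = E_set" by blast
    then show ?thesis unfolding E3[symmetric] by (simp add: reg_extremal_2_def)
  qed
  have large: "reg_extremal_2 3 < reg_extremal_2 (radius w)" if "w \<in> polydisc" "rho_star < q_max w" for w :: "complex^'m"
  proof (rule reg_extremal_2_strict[OF radius(1)[OF that(1)]])
    have "2 / 3 < 2 / x_max" using x by (simp add: field_simps)
    then have "2/3 < q_max w" using that(2) unfolding rho_star_x_max by linarith
    then show "radius w < x_max" using that(2) x unfolding rho_star_x_max radius_def by (auto simp: field_simps)
  qed
  have le: "reg_extremal_2 (radius w) \<le> ereal (ln 2)" if "w \<in> polydisc" for w :: "complex^'m"
    using reg_extremal_2_real[OF radius[OF that]] by (metis ereal_less_eq(3))
  have one: "reg_extremal_2 (radius w) = ereal (ln 2)" if "q_max w = 1" for w :: "complex^'m"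
    using that reg_extremal_2_radius_2 by (simp add: radius_def)
  show ?thesis
  proof (intro conjI ballI allI impI)
    fix w :: "complex^'m" and \<tau> :: real assume w: "w \<in> polydisc" and \<tau>: "0 < \<tau>"
    show "(diff_quot \<Phi> \<tau> w \<longlongrightarrow> D_deriv \<Phi> \<tau> w) (at_right 0)" unfolding D[OF w \<tau>] by (rule lim[OF w \<tau>])
    show "D_deriv \<Phi> \<tau> w = planar_extremal_reg (E_sub w) 2" unfolding D[OF w \<tau>] E_sub_eq reg_extremal_2_def ..
    show "D_deriv \<Phi> \<tau> w = planar_extremal_reg E_set 2 \<longleftrightarrow> q_max w \<le> rho_star"
      unfolding D[OF w \<tau>] E3 using small[of w] large[OF w] by fastforce
    show "planar_extremal_reg E_set 2 < D_deriv \<Phi> \<tau> w" if "rho_star < q_max w \<and> q_max w \<le> 1"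
      unfolding D[OF w \<tau>] E3 using large[OF w] that by blast
    show "D_deriv \<Phi> \<tau> w \<le> ereal (ln 2)" unfolding D[OF w \<tau>] by (rule le[OF w])
    show "D_deriv \<Phi> \<tau> w = ereal (ln 2)" if "q_max w = 1" unfolding D[OF w \<tau>] by (rule one[OF that])
  next
    fix w :: "complex^'m" and \<sigma> \<tau> :: real assume "w \<in> polydisc" "0 < \<sigma>" "0 < \<tau>"
    then show "D_deriv \<Phi> \<sigma> w = D_deriv \<Phi> \<tau> w" by (simp add: D)
  qed
qed

end
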